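(* Let $M$ be a closed smooth manifold of dimension $2n$ with an almost symplectic structure $\omega$, and let $E\to M$ be a real vector bundle of rank $2m$ with an almost symplectic structure $\mathsf{b}$. Suppose that $\omega$ is a symplectic structure (i.e. $\mathrm{d}\omega=0$). Then any connection $\nabla$ in $E$ such that $\mathrm{sRic}^\nabla=0$ is a solution of $$\mathrm{d}^\nabla{\ast R^\nabla}=0.$$ If, in addition, $n\ge 2$, the same holds true for any connection $\nabla$ in $E$ (not necessarily with $\mathrm{sRic}^\nabla=0$) that satisfies $$R^\nabla=\frac1n\,\mathrm{sRic}^\nabla\otimes\omega.$$
   Context: Connections in $E$ are arbitrary here (not assumed compatible with $\mathsf{b}$). An almost symplectic structure on $M$ is a non-degenerate $2$-form $\omega$. Write $\omega^{(k)}=\frac{1}{k!}\omega^k$. An almost symplectic structure on $E$ is a smooth fibrewise non-degenerate skew-symmetric bilinear form $\mathsf{b}$ on $E$. Let $(e_1,\dots,e_{2n})$ be a local symplectic frame of $TM$, i.e. $\omega(e_i,e_j)=\omega(e_{n+i},e_{n+j})=0$ and $\omega(e_i,e_{n+j})=\delta_{ij}$ for $i,j=1,\dots,n$, and let $J$ be the local almost complex structure with $Je_i=e_{n+i}$ (so $Je_{n+i}=-e_i$) for $i\le n$. Likewise let $(f_1,\dots,f_{2m})$ be a local symplectic frame of $(E,\mathsf{b})$ and $J'$ the local almost complex structure in $E$ with $J'f_i=f_{m+i}$, $J'f_{m+i}=-f_i$ for $i\le m$. The following pairings do not depend on the choice of symplectic frames: for $K,L\in\Gamma(\mathrm{End}(E))$,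 $$\mathsf{b}(K,L)=\sum_{i=1}^{2m}\mathsf{b}(Kf_i,LJ'f_i),$$ and for $\alpha,\beta\in\Omega^k(M,\mathrm{End}(E))$ (the $\mathrm{End}(E)$-valued $k$-forms), $$\mathsf{b}(\alpha,\beta)=\sum_{1\le i_1<\dots<i_k\le 2n}\mathsf{b}(\alpha(e_{i_1},\dots,e_{i_k}),\beta(Je_{i_1},\dots,Je_{i_k})).$$ Let $(\alpha,\alpha')\mapsto\mathsf{b}(\alpha\wedge\alpha')$, $\Omega^k(M,\mathrm{End}(E))\times\Omega^l(M,\mathrm{End}(E))\to\Omega^{k+l}(M)$, be the bilinear map determined by $\mathsf{b}((K\otimes\varphi)\wedge(L\otimes\psi))=\mathsf{b}(K,L)\,\varphi\wedge\psi$. The symplectic Hodge operator is the unique isomorphism $\ast:\Omega^k(M,\mathrm{End}(E))\to\Omega^{2n-k}(M,\mathrm{End}(E))$ with $\mathsf{b}(\alpha,\beta)\,\omega^{(n)}=\mathsf{b}(\alpha\wedge\ast\beta)$ for all $\alpha,\beta\in\Omega^k(M,\mathrm{End}(E))$. The curvature $R^\nabla\in\Omega^2(M,\mathrm{End}(E))$ is $R^\nabla(X,Y)\xi=\nabla_X\nabla_Y\xi-\nabla_Y\nabla_X\xi-\nabla_{[X,Y]}\xi$. The symplectic Ricci operator $\mathrm{sRic}^\nabla\in\Gamma(\mathrm{End}(E))$ is $\mathrm{sRic}^\nabla(\xi)=\sum_{i=1}^n R^\nabla(e_i,Je_i)\xi$. $\mathrm{d}^\nabla$ is the exterior differential on $\mathrm{End}(E)$-valued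 forms associated with (the connection in $\mathrm{End}(E)$ induced by) $\nabla$. *)

theory Defs
  imports "HOL-Analysis.Analysis" "HOL-Combinatorics.Permutations"
begin

section \<open>Smooth manifolds\<close>

text \<open>For open \<open>S\<close> in a Euclidean space: all iterated derivatives exist and are continuous.\<close>

primrec k_smooth_on ::
    "nat \<Rightarrow> 'a::real_normed_vector set \<Rightarrow> ('a \<Rightarrow> 'b::real_normed_vector) \<Rightarrow> bool" where
  "k_smooth_on 0 S f \<longleftrightarrow> continuous_on S f"
| "k_smooth_on (Suc k) S f \<longleftrightarrow> (\<forall>x\<in>S. f differentiable at x) \<and>
     (\<forall>v. k_smooth_on k S (\<lambda>x. frechet_derivative f (at x) v))"

definition smooth_on :: "'a::real_normed_vector set \<Rightarrow> ('a \<Rightarrow> 'b::real_normed_vector) \<Rightarrow> bool" where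
  "smooth_on S f \<longleftrightarrow> (\<forall>k. k_smooth_on k S f)"

text \<open>A chart is a pair \<open>(U, \<phi>)\<close>; only the values of \<open>\<phi>\<close> on \<open>U\<close> matter.
  A manifold is a whole type \<open>'m\<close>, with an atlas (not required to be maximal).\<close>

type_synonym ('m, 'v) chart = "'m set \<times> ('m \<Rightarrow> 'v)"

definition chart_inv :: "('m, 'v) chart \<Rightarrow> 'v \<Rightarrow> 'm" where
  "chart_inv c = inv_into (fst c) (snd c)"

definition smooth_atlas ::
    "('m::{t2_space,second_countable_topology}, 'v::euclidean_space) chart set \<Rightarrow> bool" where
  "smooth_atlas A \<longleftrightarrow>
     (\<Union>c\<in>A. fst c) = UNIV \<and>
     (\<forall>(U, \<phi>)\<in>A. open U \<and> open (\<phi> ` U) \<and> (\<exists>\<psi>. homeomorphism U (\<phi> ` U) \<phi> \<psi>)) \<and>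
     (\<forall>(U, \<phi>)\<in>A. \<forall>(V, \<psi>)\<in>A. smooth_on (\<phi> ` (U \<inter> V)) (\<psi> \<circ> chart_inv (U, \<phi>)))"

definition smooth_fun_on ::
    "('m, 'v::euclidean_space) chart set \<Rightarrow> 'm set \<Rightarrow> ('m \<Rightarrow> 'b::real_normed_vector) \<Rightarrow> bool" where
  "smooth_fun_on A W f \<longleftrightarrow> (\<forall>(U, \<phi>)\<in>A. smooth_on (\<phi> ` (U \<inter> W)) (f \<circ> chart_inv (U, \<phi>)))"

text \<open>Each point \<open>p\<close> has a preferred chart \<open>chart_at A p\<close>, and \<open>T\<^sub>pM\<close> is identified with the model
  space \<open>'v\<close> through the differential of that chart at \<open>p\<close>. Thus \<open>tderiv A f p v\<close> is the
  differential at \<open>p\<close> of a function \<open>f\<close> (smooth near \<open>p\<close>), applied to \<open>v \<in> T\<^sub>pM\<close>. If \<open>\<phi>\<close> is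
  another chart at \<open>p\<close>, then \<open>tderiv A \<phi> p v\<close> is the coordinate vector of \<open>v\<close> in that chart.\<close>

definition chart_at :: "('m, 'v) chart set \<Rightarrow> 'm \<Rightarrow> ('m, 'v) chart" where
  "chart_at A p = (SOME c. c \<in> A \<and> p \<in> fst c)"

definition tderiv ::
    "('m, 'v::euclidean_space) chart set \<Rightarrow> ('m \<Rightarrow> 'b::real_normed_vector) \<Rightarrow> 'm \<Rightarrow> 'v \<Rightarrow> 'b" where
  "tderiv A f p v =
     frechet_derivative (f \<circ> chart_inv (chart_at A p)) (at (snd (chart_at A p) p)) v"

definition vector_fields :: "('m, 'v::euclidean_space) chart set \<Rightarrow> ('m \<Rightarrow> 'v) set" where
  "vector_fields A = {X. \<forall>(U, \<phi>)\<in>A. smooth_fun_on A U (\<lambda>p. tderiv A \<phi> p (X p))}"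

text \<open>The components of \<open>[X, Y]\<close> in a chart are \<open>X(Y\<^sup>i) - Y(X\<^sup>i)\<close>; at \<open>p\<close> we use the preferred chart
  of \<open>p\<close>, through which \<open>T\<^sub>pM\<close> is identified with \<open>'v\<close>.\<close>

definition lie_bracket ::
    "('m, 'v::euclidean_space) chart set \<Rightarrow> ('m \<Rightarrow> 'v) \<Rightarrow> ('m \<Rightarrow> 'v) \<Rightarrow> 'm \<Rightarrow> 'v" where
  "lie_bracket A X Y p = (let \<phi> = snd (chart_at A p) in
     tderiv A (\<lambda>q. tderiv A \<phi> q (Y q)) p (X p) - tderiv A (\<lambda>q. tderiv A \<phi> q (X q)) p (Y p))"


section \<open>Differential forms\<close>

text \<open>Tangent vectors are fed to a \<open>k\<close>-form as a list of length \<open>k\<close>; on lists of any other length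
  the form is \<open>0\<close>, so that equality of forms is equality of functions.\<close>

definition alternating :: "nat \<Rightarrow> ('v::real_vector list \<Rightarrow> 'w::real_vector) \<Rightarrow> bool" where
  "alternating k a \<longleftrightarrow>
     (\<forall>vs. length vs \<noteq> k \<longrightarrow> a vs = 0) \<and>
     (\<forall>vs i. length vs = k \<and> i < k \<longrightarrow> linear (\<lambda>v. a (vs[i := v]))) \<and>
     (\<forall>vs i j. length vs = k \<and> i < j \<and> j < k \<and> vs ! i = vs ! j \<longrightarrow> a vs = 0)"

definition at_point :: "('m \<Rightarrow> 'v) list \<Rightarrow> 'm \<Rightarrow> 'v list" where
  "at_point Xs p = map (\<lambda>X. X p) Xs"

definition forms ::
    "('m, 'v::euclidean_space) chart set \<Rightarrow> nat \<Rightarrow> ('m \<Rightarrow> 'v list \<Rightarrow> real) set" where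
  "forms A k = {\<phi>. (\<forall>p. alternating k (\<phi> p)) \<and>
     (\<forall>Xs. length Xs = k \<and> set Xs \<subseteq> vector_fields A \<longrightarrow>
        smooth_fun_on A UNIV (\<lambda>p. \<phi> p (at_point Xs p)))}"

definition omit :: "nat \<Rightarrow> 'a list \<Rightarrow> 'a list" where
  "omit i xs = take i xs @ drop (Suc i) xs"

text \<open>Exterior derivative of a \<open>k\<close>-form, evaluated on \<open>k + 1\<close> vector fields.\<close>

definition ext_deriv ::
    "('m, 'v::euclidean_space) chart set \<Rightarrow> nat \<Rightarrow> ('m \<Rightarrow> 'v list \<Rightarrow> real) \<Rightarrow>
     ('m \<Rightarrow> 'v) list \<Rightarrow> 'm \<Rightarrow> real" where
  "ext_deriv A k \<phi> Xs p =
     (\<Sum>i\<le>k. (-1) ^ i * tderiv A (\<lambda>q. \<phi> q (at_point (omit i Xs) q)) p ((Xs ! i) p)) +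
     (\<Sum>j\<le>k. \<Sum>i<j. (-1) ^ (i + j) *
        \<phi> p (lie_bracket A (Xs ! i) (Xs ! j) p # at_point (omit i (omit j Xs)) p))"

definition closed_form ::
    "('m, 'v::euclidean_space) chart set \<Rightarrow> nat \<Rightarrow> ('m \<Rightarrow> 'v list \<Rightarrow> real) \<Rightarrow> bool" where
  "closed_form A k \<phi> \<longleftrightarrow>
     (\<forall>Xs p. length Xs = Suc k \<and> set Xs \<subseteq> vector_fields A \<longrightarrow> ext_deriv A k \<phi> Xs p = 0)"

text \<open>Wedge products are normalised so that \<open>(\<phi> \<and> \<psi>)(u, v) = \<phi>(u) \<psi>(v) - \<phi>(v) \<psi>(u)\<close> for 1-forms.
  The values are combined by a pairing \<open>B p\<close>.\<close>

definition wedge_with ::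
    "('m \<Rightarrow> 'a \<Rightarrow> 'b \<Rightarrow> real) \<Rightarrow> nat \<Rightarrow> nat \<Rightarrow> ('m \<Rightarrow> 'v list \<Rightarrow> 'a) \<Rightarrow> ('m \<Rightarrow> 'v list \<Rightarrow> 'b) \<Rightarrow>
     'm \<Rightarrow> 'v list \<Rightarrow> real" where
  "wedge_with B k l \<alpha> \<beta> p vs =
     (if length vs = k + l then
        (\<Sum>\<sigma> | \<sigma> permutes {..<k + l}. of_int (sign \<sigma>) *
           B p (\<alpha> p (map (\<lambda>i. vs ! \<sigma> i) [0..<k])) (\<beta> p (map (\<lambda>i. vs ! \<sigma> i) [k..<k + l])))
        / (fact k * fact l)
      else 0)"

definition wedge ::
    "nat \<Rightarrow> nat \<Rightarrow> ('m \<Rightarrow> 'v list \<Rightarrow> real) \<Rightarrow> ('m \<Rightarrow> 'v list \<Rightarrow> real) \<Rightarrow> 'm \<Rightarrow> 'v list \<Rightarrow> real" where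
  "wedge = wedge_with (\<lambda>p. (*))"

primrec two_form_power ::
    "('m \<Rightarrow> 'v list \<Rightarrow> real) \<Rightarrow> nat \<Rightarrow> 'm \<Rightarrow> 'v list \<Rightarrow> real" where
  "two_form_power \<omega> 0 = (\<lambda>p vs. if vs = [] then 1 else 0)"
| "two_form_power \<omega> (Suc k) = wedge 2 (2 * k) \<omega> (two_form_power \<omega> k)"

definition divided_power ::
    "('m \<Rightarrow> 'v list \<Rightarrow> real) \<Rightarrow> nat \<Rightarrow> 'm \<Rightarrow> 'v list \<Rightarrow> real" where
  "divided_power \<omega> k p vs = two_form_power \<omega> k p vs / fact k"

definition almost_symplectic_form ::
    "('m, 'v::euclidean_space) chart set \<Rightarrow> ('m \<Rightarrow> 'v list \<Rightarrow> real) \<Rightarrow> bool" where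
  "almost_symplectic_form A \<omega> \<longleftrightarrow>
     \<omega> \<in> forms A 2 \<and> (\<forall>p u. (\<forall>v. \<omega> p [u, v] = 0) \<longrightarrow> u = 0)"


section \<open>Vector bundles\<close>

text \<open>The fibres are linear subspaces \<open>E\<^sub>p\<close> of an ambient real vector space \<open>'e\<close>, which carries no
  topology and plays no role otherwise; the total space is the disjoint union of the \<open>E\<^sub>p\<close>. Any family of
  vector spaces has this form (embed them in their direct sum). The local trivialisations
  are given as local frames \<open>(U, f)\<close>, the sections of the frame being \<open>f 0, \<dots>, f (r - 1)\<close>.\<close>

record ('m, 'e) vbundle =
  fibre :: "'m \<Rightarrow> 'e set"
  vb_rank :: nat
  frames :: "('m set \<times> (nat \<Rightarrow> 'm \<Rightarrow> 'e)) set"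

definition basis_family :: "nat \<Rightarrow> 'e::real_vector set \<Rightarrow> (nat \<Rightarrow> 'e) \<Rightarrow> bool" where
  "basis_family r V f \<longleftrightarrow>
     inj_on f {..<r} \<and> independent (f ` {..<r}) \<and> span (f ` {..<r}) = V"

definition vector_bundle ::
    "('m::topological_space, 'v::euclidean_space) chart set \<Rightarrow> ('m, 'e::real_vector) vbundle \<Rightarrow> bool" where
  "vector_bundle A E \<longleftrightarrow>
     (\<forall>p. subspace (fibre E p)) \<and>
     (\<Union>c\<in>frames E. fst c) = UNIV \<and>
     (\<forall>(U, f)\<in>frames E. open U \<and>
        (\<forall>p\<in>U. basis_family (vb_rank E) (fibre E p) (\<lambda>i. f i p))) \<and>
     (\<forall>(U, f)\<in>frames E. \<forall>(V, g)\<in>frames E. \<exists>c :: nat \<Rightarrow> nat \<Rightarrow> 'm \<Rightarrow> real.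
        (\<forall>i<vb_rank E. \<forall>j<vb_rank E. smooth_fun_on A (U \<inter> V) (c i j)) \<and>
        (\<forall>p\<in>U \<inter> V. \<forall>j<vb_rank E. g j p = (\<Sum>i<vb_rank E. c i j p *\<^sub>R f i p)))"

definition sections ::
    "('m, 'v::euclidean_space) chart set \<Rightarrow> ('m, 'e::real_vector) vbundle \<Rightarrow> ('m \<Rightarrow> 'e) set" where
  "sections A E = {\<xi>. (\<forall>p. \<xi> p \<in> fibre E p) \<and>
     (\<forall>(U, f)\<in>frames E. \<exists>c :: nat \<Rightarrow> 'm \<Rightarrow> real.
        (\<forall>i<vb_rank E. smooth_fun_on A U (c i)) \<and>
        (\<forall>p\<in>U. \<xi> p = (\<Sum>i<vb_rank E. c i p *\<^sub>R f i p)))}"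

definition almost_symplectic_bundle ::
    "('m, 'v::euclidean_space) chart set \<Rightarrow> ('m, 'e::real_vector) vbundle \<Rightarrow>
     ('m \<Rightarrow> 'e \<Rightarrow> 'e \<Rightarrow> real) \<Rightarrow> bool" where
  "almost_symplectic_bundle A E b \<longleftrightarrow>
     (\<forall>p. \<forall>x\<in>fibre E p. \<forall>y\<in>fibre E p. b p y x = - b p x y) \<and>
     (\<forall>p. \<forall>x\<in>fibre E p. \<forall>y\<in>fibre E p. \<forall>z\<in>fibre E p. \<forall>s t.
        b p (s *\<^sub>R x + t *\<^sub>R y) z = s * b p x z + t * b p y z) \<and>
     (\<forall>p. \<forall>x\<in>fibre E p. (\<forall>y\<in>fibre E p. b p x y = 0) \<longrightarrow> x = 0) \<and>
     (\<forall>\<xi>\<in>sections A E. \<forall>\<eta>\<in>sections A E. smooth_fun_on A UNIV (\<lambda>p. b p (\<xi> p) (\<eta> p)))"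

text \<open>Endomorphisms of a fibre are extended by \<open>0\<close> outside it, so that they are determined as
  functions by their values on the fibre.\<close>

definition fibre_end :: "'e::real_vector set \<Rightarrow> ('e \<Rightarrow> 'e) set" where
  "fibre_end V = {K. (\<forall>x\<in>V. K x \<in> V) \<and> (\<forall>x. x \<notin> V \<longrightarrow> K x = 0) \<and>
     (\<forall>x\<in>V. \<forall>y\<in>V. \<forall>s t. K (s *\<^sub>R x + t *\<^sub>R y) = s *\<^sub>R K x + t *\<^sub>R K y)}"

definition end_forms ::
    "('m, 'v::euclidean_space) chart set \<Rightarrow> ('m, 'e::real_vector) vbundle \<Rightarrow> nat \<Rightarrow>
     ('m \<Rightarrow> 'v list \<Rightarrow> 'e \<Rightarrow> 'e) set" where
  "end_forms A E k = {\<alpha>.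
     (\<forall>p vs. \<alpha> p vs \<in> fibre_end (fibre E p)) \<and>
     (\<forall>p x. alternating k (\<lambda>vs. \<alpha> p vs x)) \<and>
     (\<forall>Xs. \<forall>\<xi>\<in>sections A E. length Xs = k \<and> set Xs \<subseteq> vector_fields A \<longrightarrow>
        (\<lambda>p. \<alpha> p (at_point Xs p) (\<xi> p)) \<in> sections A E)}"

text \<open>The \<open>End(E)\<close>-valued \<open>k\<close>-form whose values on vector fields (and sections of \<open>E\<close>) are prescribed by \<open>\<Phi>\<close>.\<close>

definition end_form_of ::
    "('m, 'v::euclidean_space) chart set \<Rightarrow> ('m, 'e::real_vector) vbundle \<Rightarrow> nat \<Rightarrow>
     (('m \<Rightarrow> 'v) list \<Rightarrow> ('m \<Rightarrow> 'e) \<Rightarrow> 'm \<Rightarrow> 'e) \<Rightarrow> 'm \<Rightarrow> 'v list \<Rightarrow> 'e \<Rightarrow> 'e" where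
  "end_form_of A E k \<Phi> = (THE \<alpha>. \<alpha> \<in> end_forms A E k \<and>
     (\<forall>Xs. \<forall>\<xi>\<in>sections A E. \<forall>p. length Xs = k \<and> set Xs \<subseteq> vector_fields A \<longrightarrow>
        \<alpha> p (at_point Xs p) (\<xi> p) = \<Phi> Xs \<xi> p))"


section \<open>Connections and curvature\<close>

definition connection ::
    "('m, 'v::euclidean_space) chart set \<Rightarrow> ('m, 'e::real_vector) vbundle \<Rightarrow>
     (('m \<Rightarrow> 'v) \<Rightarrow> ('m \<Rightarrow> 'e) \<Rightarrow> 'm \<Rightarrow> 'e) \<Rightarrow> bool" where
  "connection A E D \<longleftrightarrow>
     (\<forall>X\<in>vector_fields A. \<forall>\<xi>\<in>sections A E. D X \<xi> \<in> sections A E) \<and>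
     (\<forall>X\<in>vector_fields A. \<forall>Y\<in>vector_fields A. \<forall>\<xi>\<in>sections A E.
        D (\<lambda>p. X p + Y p) \<xi> = (\<lambda>p. D X \<xi> p + D Y \<xi> p)) \<and>
     (\<forall>h :: 'm \<Rightarrow> real. \<forall>X\<in>vector_fields A. \<forall>\<xi>\<in>sections A E. smooth_fun_on A UNIV h \<longrightarrow>
        D (\<lambda>p. h p *\<^sub>R X p) \<xi> = (\<lambda>p. h p *\<^sub>R D X \<xi> p)) \<and>
     (\<forall>X\<in>vector_fields A. \<forall>\<xi>\<in>sections A E. \<forall>\<eta>\<in>sections A E.
        D X (\<lambda>p. \<xi> p + \<eta> p) = (\<lambda>p. D X \<xi> p + D X \<eta> p)) \<and>
     (\<forall>h :: 'm \<Rightarrow> real. \<forall>X\<in>vector_fields A. \<forall>\<xi>\<in>sections A E. smooth_fun_on A UNIV h \<longrightarrow>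
        D X (\<lambda>p. h p *\<^sub>R \<xi> p) = (\<lambda>p. tderiv A h p (X p) *\<^sub>R \<xi> p + h p *\<^sub>R D X \<xi> p))"

definition curvature ::
    "('m, 'v::euclidean_space) chart set \<Rightarrow> ('m, 'e::real_vector) vbundle \<Rightarrow>
     (('m \<Rightarrow> 'v) \<Rightarrow> ('m \<Rightarrow> 'e) \<Rightarrow> 'm \<Rightarrow> 'e) \<Rightarrow> 'm \<Rightarrow> 'v list \<Rightarrow> 'e \<Rightarrow> 'e" where
  "curvature A E D = end_form_of A E 2 (\<lambda>Xs \<xi> p. let X = Xs ! 0; Y = Xs ! 1 in
     D X (D Y \<xi>) p - D Y (D X \<xi>) p - D (lie_bracket A X Y) \<xi> p)"

text \<open>The connection induced in \<open>End(E)\<close> is \<open>(\<nabla>\<^sub>X K) \<xi> = \<nabla>\<^sub>X (K \<xi>) - K (\<nabla>\<^sub>X \<xi>)\<close>.\<close>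

definition end_connection ::
    "(('m \<Rightarrow> 'v) \<Rightarrow> ('m \<Rightarrow> 'e::real_vector) \<Rightarrow> 'm \<Rightarrow> 'e) \<Rightarrow>
     ('m \<Rightarrow> 'v) \<Rightarrow> ('m \<Rightarrow> 'e \<Rightarrow> 'e) \<Rightarrow> ('m \<Rightarrow> 'e) \<Rightarrow> 'm \<Rightarrow> 'e" where
  "end_connection D X K \<xi> p = D X (\<lambda>q. K q (\<xi> q)) p - K p (D X \<xi> p)"

definition cov_ext_deriv ::
    "('m, 'v::euclidean_space) chart set \<Rightarrow> ('m, 'e::real_vector) vbundle \<Rightarrow>
     (('m \<Rightarrow> 'v) \<Rightarrow> ('m \<Rightarrow> 'e) \<Rightarrow> 'm \<Rightarrow> 'e) \<Rightarrow> nat \<Rightarrow>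
     ('m \<Rightarrow> 'v list \<Rightarrow> 'e \<Rightarrow> 'e) \<Rightarrow> 'm \<Rightarrow> 'v list \<Rightarrow> 'e \<Rightarrow> 'e" where
  "cov_ext_deriv A E D k \<alpha> = end_form_of A E (Suc k) (\<lambda>Xs \<xi> p.
     (\<Sum>i\<le>k. (-1) ^ i *\<^sub>R
        end_connection D (Xs ! i) (\<lambda>q. \<alpha> q (at_point (omit i Xs) q)) \<xi> p) +
     (\<Sum>j\<le>k. \<Sum>i<j. (-1) ^ (i + j) *\<^sub>R
        \<alpha> p (lie_bracket A (Xs ! i) (Xs ! j) p # at_point (omit i (omit j Xs)) p) (\<xi> p)))"


section \<open>Symplectic frames, pairings and the Hodge operator\<close>

text \<open>Frames are indexed from \<open>0\<close>: \<open>e 0, \<dots>, e (n - 1), e n, \<dots>, e (2 * n - 1)\<close>.\<close>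

definition symplectic_basis ::
    "nat \<Rightarrow> 'w::real_vector set \<Rightarrow> ('w \<Rightarrow> 'w \<Rightarrow> real) \<Rightarrow> (nat \<Rightarrow> 'w) \<Rightarrow> bool" where
  "symplectic_basis n V \<beta> e \<longleftrightarrow> basis_family (2 * n) V e \<and>
     (\<forall>i<n. \<forall>j<n. \<beta> (e i) (e j) = 0 \<and> \<beta> (e (n + i)) (e (n + j)) = 0 \<and>
        \<beta> (e i) (e (n + j)) = (if i = j then 1 else 0))"

text \<open>\<open>J_frame n e i\<close> is \<open>J (e i)\<close>.\<close>

definition J_frame :: "nat \<Rightarrow> (nat \<Rightarrow> 'w::real_vector) \<Rightarrow> nat \<Rightarrow> 'w" where
  "J_frame n e i = (if i < n then e (n + i) else - e (i - n))"

text \<open>The frame sums below only involve the values of the frame at the point \<open>p\<close> and do not depend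
  on the frame, so a symplectic basis of each \<open>T\<^sub>pM\<close> and each \<open>E\<^sub>p\<close> is chosen arbitrarily.\<close>

definition tangent_basis :: "nat \<Rightarrow> ('m \<Rightarrow> 'v::real_vector list \<Rightarrow> real) \<Rightarrow> 'm \<Rightarrow> nat \<Rightarrow> 'v" where
  "tangent_basis n \<omega> p = (SOME e. symplectic_basis n UNIV (\<lambda>u v. \<omega> p [u, v]) e)"

definition fibre_basis ::
    "nat \<Rightarrow> ('m, 'e::real_vector) vbundle \<Rightarrow> ('m \<Rightarrow> 'e \<Rightarrow> 'e \<Rightarrow> real) \<Rightarrow> 'm \<Rightarrow> nat \<Rightarrow> 'e" where
  "fibre_basis m E b p = (SOME f. symplectic_basis m (fibre E p) (b p) f)"

definition end_pairing ::
    "nat \<Rightarrow> ('m, 'e::real_vector) vbundle \<Rightarrow> ('m \<Rightarrow> 'e \<Rightarrow> 'e \<Rightarrow> real) \<Rightarrow>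
     'm \<Rightarrow> ('e \<Rightarrow> 'e) \<Rightarrow> ('e \<Rightarrow> 'e) \<Rightarrow> real" where
  "end_pairing m E b p K L = (let f = fibre_basis m E b p in
     \<Sum>i<2 * m. b p (K (f i)) (L (J_frame m f i)))"

definition end_form_pairing ::
    "nat \<Rightarrow> ('m \<Rightarrow> 'v::real_vector list \<Rightarrow> real) \<Rightarrow>
     nat \<Rightarrow> ('m, 'e::real_vector) vbundle \<Rightarrow> ('m \<Rightarrow> 'e \<Rightarrow> 'e \<Rightarrow> real) \<Rightarrow> nat \<Rightarrow>
     ('m \<Rightarrow> 'v list \<Rightarrow> 'e \<Rightarrow> 'e) \<Rightarrow> ('m \<Rightarrow> 'v list \<Rightarrow> 'e \<Rightarrow> 'e) \<Rightarrow> 'm \<Rightarrow> real" where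
  "end_form_pairing n \<omega> m E b k \<alpha> \<beta> p = (let e = tangent_basis n \<omega> p in
     \<Sum>I | I \<subseteq> {..<2 * n} \<and> card I = k.
       end_pairing m E b p (\<alpha> p (map e (sorted_list_of_set I)))
         (\<beta> p (map (J_frame n e) (sorted_list_of_set I))))"

definition end_wedge ::
    "nat \<Rightarrow> ('m, 'e::real_vector) vbundle \<Rightarrow> ('m \<Rightarrow> 'e \<Rightarrow> 'e \<Rightarrow> real) \<Rightarrow> nat \<Rightarrow> nat \<Rightarrow>
     ('m \<Rightarrow> 'v list \<Rightarrow> 'e \<Rightarrow> 'e) \<Rightarrow> ('m \<Rightarrow> 'v list \<Rightarrow> 'e \<Rightarrow> 'e) \<Rightarrow> 'm \<Rightarrow> 'v list \<Rightarrow> real" where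
  "end_wedge m E b = wedge_with (end_pairing m E b)"

definition hodge_star ::
    "('m, 'v::euclidean_space) chart set \<Rightarrow> nat \<Rightarrow> ('m \<Rightarrow> 'v list \<Rightarrow> real) \<Rightarrow>
     nat \<Rightarrow> ('m, 'e::real_vector) vbundle \<Rightarrow> ('m \<Rightarrow> 'e \<Rightarrow> 'e \<Rightarrow> real) \<Rightarrow> nat \<Rightarrow>
     ('m \<Rightarrow> 'v list \<Rightarrow> 'e \<Rightarrow> 'e) \<Rightarrow> 'm \<Rightarrow> 'v list \<Rightarrow> 'e \<Rightarrow> 'e" where
  "hodge_star A n \<omega> m E b k \<beta> = (THE \<gamma>. \<gamma> \<in> end_forms A E (2 * n - k) \<and>
     (\<forall>\<alpha>\<in>end_forms A E k.
        (\<lambda>p vs. end_form_pairing n \<omega> m E b k \<alpha> \<beta> p * divided_power \<omega> n p vs) =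
        end_wedge m E b k (2 * n - k) \<alpha> \<gamma>))"

definition sRic ::
    "('m, 'v::euclidean_space) chart set \<Rightarrow> nat \<Rightarrow> ('m \<Rightarrow> 'v list \<Rightarrow> real) \<Rightarrow>
     ('m, 'e::real_vector) vbundle \<Rightarrow> (('m \<Rightarrow> 'v) \<Rightarrow> ('m \<Rightarrow> 'e) \<Rightarrow> 'm \<Rightarrow> 'e) \<Rightarrow>
     'm \<Rightarrow> 'e \<Rightarrow> 'e" where
  "sRic A n \<omega> E D p x = (let e = tangent_basis n \<omega> p in
     \<Sum>i<n. curvature A E D p [e i, J_frame n e i] x)"

definition end_tensor_form ::
    "('m \<Rightarrow> 'e \<Rightarrow> 'e::real_vector) \<Rightarrow> ('m \<Rightarrow> 'v list \<Rightarrow> real) \<Rightarrow> 'm \<Rightarrow> 'v list \<Rightarrow> 'e \<Rightarrow> 'e" where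
  "end_tensor_form K \<phi> p vs x = \<phi> p vs *\<^sub>R K p x"

end

theory Submission
  imports Defs "HOL-Computational_Algebra.Polynomial"
begin

text \<open>In both cases the Hodge dual of \<open>R = R\<^sup>\<nabla>\<close> is a constant multiple of \<open>R \<and> \<omega>\<^sup>n\<^sup>-\<^sup>2\<close>, which is
  \<open>d\<^sup>\<nabla>\<close>-closed by the Bianchi identity and \<open>d\<omega> = 0\<close>. Indeed, for 2-forms \<open>\<alpha>\<close>, \<open>\<beta>\<close> on a symplectic vector
  space, with \<open>\<Lambda>\<close> the contraction with \<open>\<omega>\<close>,
  \<open>\<alpha> \<and> \<beta> \<and> \<omega>\<^sup>n\<^sup>-\<^sup>2 / (n - 2)! = (\<Lambda>\<alpha> \<Lambda>\<beta> - \<langle>\<alpha>, \<beta>\<rangle>) \<omega>\<^sup>(\<^sup>n\<^sup>)\<close>. For \<open>\<Lambda>R = sRic = 0\<close> this makes \<open>*R\<close> equal to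
  \<open>- R \<and> \<omega>\<^sup>n\<^sup>-\<^sup>2 / (n - 2)!\<close>, and for \<open>R = (1/n) sRic \<otimes> \<omega>\<close> it gives \<open>*R = R \<and> \<omega>\<^sup>n\<^sup>-\<^sup>2 / (n - 1)!\<close>; if \<open>n = 1\<close>, then
  \<open>sRic = 0\<close> already forces \<open>R = 0\<close>. Wedge products are handled through the recursion
  \<open>\<iota>\<^sub>X(\<alpha> \<and> \<beta>) = \<iota>\<^sub>X\<alpha> \<and> \<beta> \<plusminus> \<alpha> \<and> \<iota>\<^sub>X\<beta>\<close> on lists of vectors, and the Leibniz rule for \<open>d\<^sup>\<nabla>\<close> follows by
  induction from Cartan's formula \<open>\<iota>\<^sub>X d = L\<^sub>X - d \<iota>\<^sub>X\<close>.\<close>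

section \<open>Smooth functions on Euclidean spaces\<close>

text \<open>The connection need not preserve b, although b enters the definition of the star. In
  both cases the dual of R turns out to be free of b, so b is never differentiated. The constants
  come from pairing with an arbitrary 2-form \<alpha>. If \<Lambda>R = 0, only - \<langle>\<alpha>,
  R\<rangle> is left, whence -1 / (n-2)!. If R = K \<otimes> \<omega> / n, put s =
  b(\<Lambda>\<alpha>, K) / n; then \<langle>\<alpha>, R\<rangle> = s and \<Lambda>\<alpha>
  \<Lambda>R = n s, whence 1 / ((n-1) (n-2)!) = 1 / (n-1)!. For n = 1 the second condition says
  nothing, since R = sRic \<otimes> \<omega> holds anyway, and the dual of R is sRic, which need not
  be parallel. Star, curvature and d^\<nabla> are definite descriptions, so existence and uniqueness
  must be proved for each. For the star, uniqueness is nondegeneracy of the wedge pairing, tested on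
  forms dual to symplectic bases. For the others it rests on extending vectors and fibre elements
  globally by bump functions; existence of the curvature form needs C^\<infinity>-linearity.
  \<open>shuffle\<close> takes a function of two lists rather than two forms, so real, fibre-valued
  and paired products share one calculus.\<close>

lemma k_smooth_on_cong:
  assumes "k_smooth_on k S f" "open S" "\<And>x. x \<in> S \<Longrightarrow> f x = g x"
  shows "k_smooth_on k S g"
  using assms
proof (induction k arbitrary: f g)
  case 0
  then show ?case using continuous_on_eq by auto
next
  case (Suc k)
  have d: "(g has_derivative frechet_derivative f (at x)) (at x)" if "x \<in> S" for x
    using Suc.prems that has_derivative_transform_within_open[of f _ x UNIV S g]
    by (auto simp: frechet_derivative_works)
  then have "frechet_derivative g (at x) = frechet_derivative f (at x)" if "x \<in> S" for x
    using frechet_derivative_at that by metis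
  then have "k_smooth_on k S (\<lambda>x. frechet_derivative g (at x) v)" for v
    using Suc.IH[of "\<lambda>x. frechet_derivative f (at x) v" "\<lambda>x. frechet_derivative g (at x) v"]
      Suc.prems by auto
  then show ?case using d by (auto simp: differentiable_def)
qed

lemma k_smooth_on_subset: "k_smooth_on k S f \<Longrightarrow> T \<subseteq> S \<Longrightarrow> k_smooth_on k T f"
  by (induction k arbitrary: f) (auto intro: continuous_on_subset)

lemma k_smooth_on_SucD: "k_smooth_on (Suc k) S f \<Longrightarrow> k_smooth_on k S f"
proof (induction k arbitrary: f)
  case 0
  then show ?case
    by (auto intro!: continuous_at_imp_continuous_on differentiable_imp_continuous_within)
next
  case (Suc k)
  then show ?case by (metis k_smooth_on.simps(2))
qed

lemma k_smooth_on_local: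
  assumes "\<And>x. x \<in> S \<Longrightarrow> \<exists>T. open T \<and> x \<in> T \<and> k_smooth_on k T f"
  shows "k_smooth_on k S f"
  using assms
proof (induction k arbitrary: f)
  case 0
  have "isCont f x" if "x \<in> S" for x
    using 0[OF that] by (auto simp: continuous_on_eq_continuous_at)
  then show ?case by (auto intro!: continuous_at_imp_continuous_on)
next
  case (Suc k)
  have "k_smooth_on k S (\<lambda>x. frechet_derivative f (at x) v)" for v
    by (rule Suc.IH) (use Suc.prems in \<open>fastforce\<close>)
  moreover have "f differentiable at x" if "x \<in> S" for x
    using Suc.prems[OF that] by auto
  ultimately show ?case by simp
qed

text \<open>Accepts any explicit derivative, so that the rules of differentiation can supply it in
  place of the opaque \<open>frechet_derivative\<close>.\<close>

lemma k_smooth_on_SucI: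
  assumes "open S" "\<And>x. x \<in> S \<Longrightarrow> (f has_derivative f' x) (at x)"
    and "\<And>v. k_smooth_on k S (\<lambda>x. f' x v)"
  shows "k_smooth_on (Suc k) S f"
proof -
  have "frechet_derivative f (at x) = f' x" if "x \<in> S" for x
    using assms(2)[OF that] frechet_derivative_at by metis
  then show ?thesis
    using assms k_smooth_on_cong[OF assms(3) assms(1)]
    by (auto simp: differentiable_def)
qed

lemma k_smooth_on_has_derivative:
  "k_smooth_on (Suc k) S f \<Longrightarrow> x \<in> S \<Longrightarrow> (f has_derivative frechet_derivative f (at x)) (at x)"
  by (simp add: frechet_derivative_works)

lemma k_smooth_on_const: "open S \<Longrightarrow> k_smooth_on k S (\<lambda>x. c)"
proof (induction k arbitrary: c)
  case (Suc k)
  show ?case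
    by (rule k_smooth_on_SucI[where f'="\<lambda>_ _. 0"]) (use Suc in auto)
qed simp

lemma k_smooth_on_add:
  "open S \<Longrightarrow> k_smooth_on k S f \<Longrightarrow> k_smooth_on k S g \<Longrightarrow> k_smooth_on k S (\<lambda>x. f x + g x)"
proof (induction k arbitrary: f g)
  case (Suc k)
  show ?case
    by (rule k_smooth_on_SucI[OF Suc.prems(1) has_derivative_add])
      (use Suc.prems in \<open>auto intro!: Suc.IH simp: frechet_derivative_works\<close>)
qed (auto intro: continuous_intros)

text \<open>The product rule gives two terms of the same bilinear shape, so the induction runs over
  all \<open>f\<close> and \<open>g\<close>. The factor left undifferentiated has one order to
  spare, which \<open>k_smooth_on_SucD\<close> gives up.\<close>

lemma k_smooth_on_bilinear:
  assumes B: "bounded_bilinear B" and "open S" "k_smooth_on k S f" "k_smooth_on k S g"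
  shows "k_smooth_on k S (\<lambda>x. B (f x) (g x))"
  using assms(2-)
proof (induction k arbitrary: f g)
  case 0
  then show ?case by (auto intro: bounded_bilinear.continuous_on[OF B])
next
  case (Suc k)
  show ?case
    by (rule k_smooth_on_SucI[OF Suc.prems(1) bounded_bilinear.FDERIV[OF B]])
      (use Suc.prems k_smooth_on_SucD[OF Suc.prems(2)] k_smooth_on_SucD[OF Suc.prems(3)] in
        \<open>auto intro!: k_smooth_on_add Suc.IH simp: frechet_derivative_works\<close>)
qed

lemma k_smooth_on_linear:
  assumes h: "bounded_linear h" and "open S" "k_smooth_on k S f"
  shows "k_smooth_on k S (\<lambda>x. h (f x))"
  using assms(2-)
proof (induction k arbitrary: f)
  case 0
  then show ?case by (auto intro: bounded_linear.continuous_on[OF h])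
next
  case (Suc k)
  show ?case
    by (rule k_smooth_on_SucI[OF Suc.prems(1) bounded_linear.has_derivative[OF h]])
      (use Suc.prems in \<open>auto intro!: Suc.IH simp: frechet_derivative_works\<close>)
qed

lemma k_smooth_on_sum:
  "open S \<Longrightarrow> (\<And>i. i \<in> I \<Longrightarrow> k_smooth_on k S (f i)) \<Longrightarrow> k_smooth_on k S (\<lambda>x. \<Sum>i\<in>I. f i x)"
  by (induction I rule: infinite_finite_induct) (auto intro: k_smooth_on_const k_smooth_on_add)

text \<open>\<open>k_smooth_on\<close> differentiates in fixed directions, but in the chain rule the
  direction fed to the derivative of \<open>g\<close> moves with the point. Expanding it over
  \<open>Basis\<close> turns the derivative into a finite sum of products of functions of lower
  order; hence the Euclidean middle space.\<close>

lemma k_smooth_on_compose: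
  fixes f :: "'a::real_normed_vector \<Rightarrow> 'b::euclidean_space" and g :: "'b \<Rightarrow> 'c::real_normed_vector"
  assumes "open S" "open T" "f ` S \<subseteq> T" "k_smooth_on k S f" "k_smooth_on k T g"
  shows "k_smooth_on k S (\<lambda>x. g (f x))"
  using assms
proof (induction k arbitrary: g)
  case 0
  then show ?case by (auto intro: continuous_on_compose2)
next
  case (Suc k)
  let ?f' = "\<lambda>x. frechet_derivative f (at x)"
  let ?g' = "\<lambda>y. frechet_derivative g (at y)"
  have eq: "?g' (f x) (?f' x v) = (\<Sum>b\<in>Basis. (?f' x v \<bullet> b) *\<^sub>R ?g' (f x) b)" if "x \<in> S" for x v
  proof -
    have "linear (?g' (f x))"
      using Suc.prems that by (intro linear_frechet_derivative) auto
    then have "?g' (f x) (\<Sum>b\<in>Basis. (?f' x v \<bullet> b) *\<^sub>R b) = (\<Sum>b\<in>Basis. (?f' x v \<bullet> b) *\<^sub>R ?g' (f x) b)"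
      by (simp add: linear_sum linear_cmul)
    then show ?thesis by (simp add: euclidean_representation)
  qed
  show ?case
  proof (rule k_smooth_on_SucI[OF Suc.prems(1)])
    fix x assume "x \<in> S"
    then show "((\<lambda>x. g (f x)) has_derivative (\<lambda>v. ?g' (f x) (?f' x v))) (at x)"
      using has_derivative_compose[OF k_smooth_on_has_derivative[OF Suc.prems(4)]
          k_smooth_on_has_derivative[OF Suc.prems(5)]] Suc.prems(3) by blast
  next
    fix v
    have "k_smooth_on k S (\<lambda>x. \<Sum>b\<in>Basis. (?f' x v \<bullet> b) *\<^sub>R ?g' (f x) b)"
    proof (rule k_smooth_on_sum[OF Suc.prems(1)], rule k_smooth_on_bilinear[OF bounded_bilinear_scaleR Suc.prems(1)])
      fix b
      have "k_smooth_on k S (\<lambda>x. ?f' x v)"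
        using Suc.prems(4) by simp
      then show "k_smooth_on k S (\<lambda>x. ?f' x v \<bullet> b)"
        by (rule k_smooth_on_linear[OF bounded_linear_inner_left Suc.prems(1)])
      show "k_smooth_on k S (\<lambda>x. ?g' (f x) b)"
        using Suc.prems(5) by (intro Suc.IH[OF Suc.prems(1-3) k_smooth_on_SucD[OF Suc.prems(4)]]) simp
    qed
    then show "k_smooth_on k S (\<lambda>x. ?g' (f x) (?f' x v))"
      by (rule k_smooth_on_cong[OF _ Suc.prems(1)]) (simp add: eq)
  qed
qed

lemma smooth_on_cong:
  "smooth_on S f \<Longrightarrow> open S \<Longrightarrow> (\<And>x. x \<in> S \<Longrightarrow> f x = g x) \<Longrightarrow> smooth_on S g"
  unfolding smooth_on_def using k_smooth_on_cong by blast

lemma smooth_on_subset: "smooth_on S f \<Longrightarrow> T \<subseteq> S \<Longrightarrow> smooth_on T f"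
  unfolding smooth_on_def using k_smooth_on_subset by blast

lemma smooth_on_local:
  "(\<And>x. x \<in> S \<Longrightarrow> \<exists>T. open T \<and> x \<in> T \<and> smooth_on T f) \<Longrightarrow> smooth_on S f"
  unfolding smooth_on_def using k_smooth_on_local[of S _ f] by meson

lemma smooth_on_const: "open S \<Longrightarrow> smooth_on S (\<lambda>x. c)"
  by (simp add: smooth_on_def k_smooth_on_const)

lemma smooth_on_add:
  "open S \<Longrightarrow> smooth_on S f \<Longrightarrow> smooth_on S g \<Longrightarrow> smooth_on S (\<lambda>x. f x + g x)"
  by (simp add: smooth_on_def k_smooth_on_add)

lemma smooth_on_bilinear:
  "bounded_bilinear B \<Longrightarrow> open S \<Longrightarrow> smooth_on S f \<Longrightarrow> smooth_on S g \<Longrightarrow> smooth_on S (\<lambda>x. B (f x) (g x))"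
  by (simp add: smooth_on_def k_smooth_on_bilinear)

lemma smooth_on_linear:
  "bounded_linear h \<Longrightarrow> open S \<Longrightarrow> smooth_on S f \<Longrightarrow> smooth_on S (\<lambda>x. h (f x))"
  by (simp add: smooth_on_def k_smooth_on_linear)

lemma smooth_on_sum:
  "open S \<Longrightarrow> (\<And>i. i \<in> I \<Longrightarrow> smooth_on S (f i)) \<Longrightarrow> smooth_on S (\<lambda>x. \<Sum>i\<in>I. f i x)"
  by (simp add: smooth_on_def k_smooth_on_sum)

lemma smooth_on_compose:
  fixes f :: "'a::real_normed_vector \<Rightarrow> 'b::euclidean_space" and g :: "'b \<Rightarrow> 'c::real_normed_vector"
  assumes "open S" "open T" "f ` S \<subseteq> T" "smooth_on S f" "smooth_on T g"
  shows "smooth_on S (\<lambda>x. g (f x))"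
  unfolding smooth_on_def
proof
  show "k_smooth_on k S (\<lambda>x. g (f x))" for k
    by (rule k_smooth_on_compose[OF assms(1-3)]) (use assms(4,5) in \<open>simp_all add: smooth_on_def\<close>)
qed

lemma smooth_on_id: "open S \<Longrightarrow> smooth_on S (\<lambda>x. x)"
  unfolding smooth_on_def
proof
  fix k assume "open S"
  show "k_smooth_on k S (\<lambda>x. x)"
  proof (cases k)
    case (Suc l)
    then show ?thesis
      using k_smooth_on_SucI[OF \<open>open S\<close>, of "\<lambda>x. x" "\<lambda>_ v. v"]
      by (simp add: k_smooth_on_const[OF \<open>open S\<close>] del: k_smooth_on.simps)
  qed simp
qed

lemma smooth_on_has_derivative:
  "smooth_on S f \<Longrightarrow> x \<in> S \<Longrightarrow> (f has_derivative frechet_derivative f (at x)) (at x)"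
  using k_smooth_on_has_derivative[of 0 S f x] unfolding smooth_on_def by blast

lemma smooth_on_frechet_derivative: "smooth_on S f \<Longrightarrow> smooth_on S (\<lambda>x. frechet_derivative f (at x) v)"
  unfolding smooth_on_def
proof
  fix k assume "\<forall>k. k_smooth_on k S f"
  then have "k_smooth_on (Suc k) S f" ..
  then show "k_smooth_on k S (\<lambda>x. frechet_derivative f (at x) v)" by simp
qed

lemma frechet_derivative_basis:
  fixes f :: "'a::euclidean_space \<Rightarrow> 'b::real_normed_vector"
  assumes "f differentiable at x"
  shows "frechet_derivative f (at x) v = (\<Sum>b\<in>Basis. (v \<bullet> b) *\<^sub>R frechet_derivative f (at x) b)"
proof -
  have "linear (frechet_derivative f (at x))"
    using assms by (rule linear_frechet_derivative)
  then have "frechet_derivative f (at x) (\<Sum>b\<in>Basis. (v \<bullet> b) *\<^sub>R b)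
      = (\<Sum>b\<in>Basis. (v \<bullet> b) *\<^sub>R frechet_derivative f (at x) b)"
    by (simp add: linear_sum linear_cmul)
  then show ?thesis unfolding euclidean_representation .
qed

lemma smooth_on_derivative_field:
  fixes f :: "'a::euclidean_space \<Rightarrow> 'b::real_normed_vector"
  assumes "open S" "smooth_on S f" "smooth_on S V"
  shows "smooth_on S (\<lambda>x. frechet_derivative f (at x) (V x))"
proof -
  have "smooth_on S (\<lambda>x. \<Sum>b\<in>Basis. (V x \<bullet> b) *\<^sub>R frechet_derivative f (at x) b)"
    by (rule smooth_on_sum[OF assms(1)], rule smooth_on_bilinear[OF bounded_bilinear_scaleR assms(1)],
        rule smooth_on_linear[OF bounded_linear_inner_left assms(1,3)],
        rule smooth_on_frechet_derivative[OF assms(2)])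
  moreover have "(\<Sum>b\<in>Basis. (V x \<bullet> b) *\<^sub>R frechet_derivative f (at x) b) = frechet_derivative f (at x) (V x)"
    if "x \<in> S" for x
  proof (rule frechet_derivative_basis[symmetric])
    show "f differentiable at x"
      using smooth_on_has_derivative[OF assms(2) that] by (auto simp: differentiable_def)
  qed
  ultimately show ?thesis
    by (rule smooth_on_cong[OF _ assms(1)])
qed

section \<open>Bump functions on Euclidean spaces\<close>

text \<open>For P = 1 this is the classical flat function exp(-1/t). The polynomial is there because
  differentiation changes only \<open>P\<close>: all derivatives stay in one family, and a single
  induction gives smoothness.\<close>

definition flat_exp :: "real poly \<Rightarrow> real \<Rightarrow> real" where
  "flat_exp P t = (if t > 0 then poly P (1 / t) * exp (- (1 / t)) else 0)"

lemma poly_exp_neg_tendsto_0: "((\<lambda>x::real. poly P x * exp (- x)) \<longlongrightarrow> 0) at_top"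
proof -
  have "((\<lambda>x::real. coeff P i * (x ^ i / exp x)) \<longlongrightarrow> 0) at_top" for i
    by (rule tendsto_mult_right_zero) (rule tendsto_power_div_exp_0)
  then have "((\<lambda>x::real. \<Sum>i\<le>degree P. coeff P i * (x ^ i / exp x)) \<longlongrightarrow> (\<Sum>i\<le>degree P. 0)) at_top"
    by (intro tendsto_sum)
  then show ?thesis
    by (simp add: poly_altdef sum_distrib_right exp_minus divide_inverse mult.assoc)
qed

lemma flat_exp_tendsto_0: "(flat_exp P \<longlongrightarrow> 0) (at 0)"
proof -
  have "((\<lambda>t. poly P (inverse t) * exp (- inverse t)) \<longlongrightarrow> 0) (at_right 0)"
    using filterlim_compose[OF poly_exp_neg_tendsto_0 filterlim_inverse_at_top_right] by simp
  then have "(flat_exp P \<longlongrightarrow> 0) (at_right 0)"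
    by (rule Lim_transform_eventually)
      (auto simp: flat_exp_def eventually_at_right_field inverse_eq_divide intro!: exI[of _ 1])
  moreover have "(flat_exp P \<longlongrightarrow> 0) (at_left 0)"
    by (rule tendsto_eventually)
      (auto simp: flat_exp_def eventually_at_left_field intro!: exI[of _ "-1"])
  ultimately show ?thesis by (simp add: filterlim_split_at)
qed

text \<open>The factor \<open>[:0, 0, 1:]\<close> in the derivative is \<open>(1 / t)\<^sup>2\<close>, from differentiating \<open>1 / t\<close>.\<close>

lemma flat_exp_has_derivative:
  "(flat_exp P has_real_derivative flat_exp ([:0, 0, 1:] * (P - pderiv P)) t) (at t)"
proof (cases "t = 0")
  case True
  \<comment> \<open>Dividing by the increment multiplies the polynomial by its variable, so the
    difference quotient at 0 stays in the family and tends to 0.\<close>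
  have "(flat_exp ([:0, 1:] * P) \<longlongrightarrow> 0) (at 0)"
    by (rule flat_exp_tendsto_0)
  moreover have "flat_exp ([:0, 1:] * P) = (\<lambda>h. flat_exp P h / h)"
    by (auto simp: flat_exp_def fun_eq_iff field_simps)
  ultimately show ?thesis
    unfolding True DERIV_def by (simp add: flat_exp_def)
next
  case False
  show ?thesis
  proof (cases "t > 0")
    case True
    have inv: "((\<lambda>t. 1 / t) has_real_derivative - (1 / t) * (1 / t)) (at t)"
      using DERIV_inverse'[OF DERIV_ident, of t UNIV] True by (simp add: inverse_eq_divide)
    have "((\<lambda>t. poly P (1 / t)) has_real_derivative poly (pderiv P) (1 / t) * (- (1 / t) * (1 / t))) (at t)"
      by (rule DERIV_chain2[OF poly_DERIV inv])
    moreover have "((\<lambda>t. exp (- (1 / t))) has_real_derivative exp (- (1 / t)) * - (- (1 / t) * (1 / t))) (at t)"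
      by (rule DERIV_chain2[OF DERIV_exp DERIV_minus[OF inv]])
    ultimately have "((\<lambda>t. poly P (1 / t) * exp (- (1 / t))) has_real_derivative
        poly (pderiv P) (1 / t) * (- (1 / t) * (1 / t)) * exp (- (1 / t))
        + exp (- (1 / t)) * - (- (1 / t) * (1 / t)) * poly P (1 / t)) (at t)"
      by (rule DERIV_mult)
    moreover have "poly (pderiv P) (1 / t) * (- (1 / t) * (1 / t)) * exp (- (1 / t))
        + exp (- (1 / t)) * - (- (1 / t) * (1 / t)) * poly P (1 / t)
        = flat_exp ([:0, 0, 1:] * (P - pderiv P)) t"
      using True by (simp add: flat_exp_def algebra_simps)
    ultimately have "((\<lambda>t. poly P (1 / t) * exp (- (1 / t))) has_real_derivative
        flat_exp ([:0, 0, 1:] * (P - pderiv P)) t) (at t)"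
      by simp
    then show ?thesis
      by (rule has_field_derivative_transform_within_open[of _ _ _ "{0<..}"])
        (use True in \<open>auto simp: flat_exp_def\<close>)
  next
    case neg: False
    have "((\<lambda>t. 0) has_real_derivative flat_exp ([:0, 0, 1:] * (P - pderiv P)) t) (at t)"
      using neg by (auto simp: flat_exp_def)
    then show ?thesis
      by (rule has_field_derivative_transform_within_open[of _ _ _ "{..<0}"])
        (use False neg in \<open>auto simp: flat_exp_def\<close>)
  qed
qed

lemma smooth_on_flat_exp: "smooth_on UNIV (flat_exp P)"
  unfolding smooth_on_def
proof
  fix k
  show "k_smooth_on k UNIV (flat_exp P)"
  proof (induction k arbitrary: P)
    case 0
    have "isCont (flat_exp P) t" for t
      using flat_exp_has_derivative by (rule DERIV_isCont)
    then show ?case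
      by (simp add: continuous_at_imp_continuous_on)
  next
    case (Suc k)
    show ?case
    proof (rule k_smooth_on_SucI)
      show "(flat_exp P has_derivative (\<lambda>v. flat_exp ([:0, 0, 1:] * (P - pderiv P)) t * v)) (at t)" for t
        using flat_exp_has_derivative by (simp add: has_field_derivative_def)
      show "k_smooth_on k UNIV (\<lambda>t. flat_exp ([:0, 0, 1:] * (P - pderiv P)) t * v)" for v
        using k_smooth_on_linear[OF bounded_linear_mult_left open_UNIV Suc.IH] .
    qed auto
  qed
qed

lemma euclidean_bump:
  fixes a :: "'a::euclidean_space"
  assumes "r > 0"
  obtains \<rho> :: "'a \<Rightarrow> real" where "smooth_on UNIV \<rho>" "\<rho> a = 1" "\<And>x. x \<notin> cball a r \<Longrightarrow> \<rho> x = 0"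
proof
  \<comment> \<open>The argument r^2 - |x - a|^2 is positive exactly in the open ball; the constant
    factor normalises the value at the centre to 1.\<close>
  define \<rho> where "\<rho> = (\<lambda>x. flat_exp 1 (r\<^sup>2 - (x - a) \<bullet> (x - a)) * (1 / flat_exp 1 (r\<^sup>2)))"
  have "smooth_on UNIV (\<lambda>x::'a. x + - a)"
    by (intro smooth_on_add smooth_on_id smooth_on_const) auto
  then have "smooth_on UNIV (\<lambda>x. (x - a) \<bullet> (x - a))"
    using smooth_on_bilinear[OF bounded_bilinear_inner, of UNIV "\<lambda>x. x - a" "\<lambda>x. x - a"] by simp
  then have "smooth_on UNIV (\<lambda>x. r\<^sup>2 + (- 1) * ((x - a) \<bullet> (x - a)))"
    by (intro smooth_on_add smooth_on_const smooth_on_linear[OF bounded_linear_mult_right]) auto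
  then have "smooth_on UNIV (\<lambda>x. flat_exp 1 (r\<^sup>2 - (x - a) \<bullet> (x - a)))"
    by (intro smooth_on_compose[OF open_UNIV open_UNIV _ _ smooth_on_flat_exp, of "\<lambda>x. r\<^sup>2 - (x - a) \<bullet> (x - a)"]) auto
  then show "smooth_on UNIV \<rho>"
    unfolding \<rho>_def by (intro smooth_on_linear[OF bounded_linear_mult_left]) auto
  show "\<rho> a = 1"
    using assms by (simp add: \<rho>_def flat_exp_def)
  fix x assume "x \<notin> cball a r"
  then have "r \<le> norm (x - a)" by (auto simp: dist_norm norm_minus_commute)
  then have "r\<^sup>2 \<le> (x - a) \<bullet> (x - a)"
    using assms by (simp add: dot_square_norm)
  then show "\<rho> x = 0" by (simp add: \<rho>_def flat_exp_def)
qed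

section \<open>Symmetry of second derivatives\<close>

lemma directional_derivative:
  assumes "smooth_on S f" "a + t *\<^sub>R w \<in> S"
  shows "((\<lambda>t. f (a + t *\<^sub>R w)) has_real_derivative frechet_derivative f (at (a + t *\<^sub>R w)) w) (at t)"
proof -
  have g: "((\<lambda>t. a + t *\<^sub>R w) has_derivative (\<lambda>h. h *\<^sub>R w)) (at t)"
    by (auto intro!: derivative_eq_intros)
  have f': "(f has_derivative frechet_derivative f (at (a + t *\<^sub>R w))) (at (a + t *\<^sub>R w))"
    by (rule smooth_on_has_derivative[OF assms])
  have "frechet_derivative f (at (a + t *\<^sub>R w)) (h *\<^sub>R w) = frechet_derivative f (at (a + t *\<^sub>R w)) w * h" for h
    using has_derivative_linear[OF f'] by (simp add: linear_cmul)
  then show ?thesis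
    using has_derivative_compose[OF g f'] by (simp add: has_field_derivative_def)
qed

text \<open>The mean value theorem, once along \<open>u\<close> and once along \<open>v\<close>,
  applied to the second difference over a parallelogram. The left side is symmetric in
  \<open>u\<close> and \<open>v\<close>, which is what Schwarz's theorem exploits.\<close>

lemma second_difference_mean_value:
  fixes f :: "'a::real_normed_vector \<Rightarrow> real"
  assumes f: "smooth_on S f" and "s > 0"
    and S: "\<And>t t'. 0 \<le> t \<Longrightarrow> t \<le> s \<Longrightarrow> 0 \<le> t' \<Longrightarrow> t' \<le> s \<Longrightarrow> x + t *\<^sub>R u + t' *\<^sub>R v \<in> S"
  obtains t t' where "0 < t" "t < s" "0 < t'" "t' < s"
    "f (x + s *\<^sub>R u + s *\<^sub>R v) - f (x + s *\<^sub>R u) - f (x + s *\<^sub>R v) + f x =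
     s * s * frechet_derivative (\<lambda>y. frechet_derivative f (at y) u) (at (x + t *\<^sub>R u + t' *\<^sub>R v)) v"
proof -
  define Df where "Df y = frechet_derivative f (at y) u" for y
  have "((\<lambda>t. f (x + s *\<^sub>R v + t *\<^sub>R u) - f (x + t *\<^sub>R u)) has_real_derivative
      Df (x + s *\<^sub>R v + t *\<^sub>R u) - Df (x + t *\<^sub>R u)) (at t)" if "0 \<le> t" "t \<le> s" for t
    unfolding Df_def
    by (intro DERIV_diff directional_derivative[OF f])
      (use S[of t s] S[of t 0] that \<open>s > 0\<close> in \<open>simp_all add: algebra_simps\<close>)
  from MVT2[OF \<open>s > 0\<close> this] obtain t where t: "0 < t" "t < s" and
    1: "f (x + s *\<^sub>R v + s *\<^sub>R u) - f (x + s *\<^sub>R u) - (f (x + s *\<^sub>R v) - f x) =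
      s * (Df (x + s *\<^sub>R v + t *\<^sub>R u) - Df (x + t *\<^sub>R u))"
    by auto
  have "((\<lambda>t'. Df (x + t *\<^sub>R u + t' *\<^sub>R v)) has_real_derivative
      frechet_derivative Df (at (x + t *\<^sub>R u + t' *\<^sub>R v)) v) (at t')" if "0 \<le> t'" "t' \<le> s" for t'
    unfolding Df_def
    by (rule directional_derivative[OF smooth_on_frechet_derivative[OF f]])
      (use S that t in auto)
  from MVT2[OF \<open>s > 0\<close> this] obtain t' where t': "0 < t'" "t' < s" and
    2: "Df (x + t *\<^sub>R u + s *\<^sub>R v) - Df (x + t *\<^sub>R u) = s * frechet_derivative Df (at (x + t *\<^sub>R u + t' *\<^sub>R v)) v"
    by auto
  have 3: "x + s *\<^sub>R v + t *\<^sub>R u = x + t *\<^sub>R u + s *\<^sub>R v"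
    "x + s *\<^sub>R v + s *\<^sub>R u = x + s *\<^sub>R u + s *\<^sub>R v"
    by (simp_all add: algebra_simps)
  have "f (x + s *\<^sub>R u + s *\<^sub>R v) - f (x + s *\<^sub>R u) - f (x + s *\<^sub>R v) + f x =
     s * s * frechet_derivative Df (at (x + t *\<^sub>R u + t' *\<^sub>R v)) v"
    using 1 2 unfolding 3 by simp
  with t t' show ?thesis
    using that unfolding Df_def[abs_def] by blast
qed

text \<open>The second difference does not see the order of \<open>u\<close> and \<open>v\<close>,
  so the two mixed derivatives agree, each at some point near \<open>x\<close>. Their continuity
  carries this to \<open>x\<close>.\<close>

lemma second_derivative_symmetric_real:
  fixes f :: "'a::real_normed_vector \<Rightarrow> real"
  assumes S: "open S" and f: "smooth_on S f" and x: "x \<in> S"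
  shows "frechet_derivative (\<lambda>y. frechet_derivative f (at y) u) (at x) v =
    frechet_derivative (\<lambda>y. frechet_derivative f (at y) v) (at x) u"
proof -
  define D2 where "D2 u v y = frechet_derivative (\<lambda>y. frechet_derivative f (at y) u) (at y) v" for u v y
  have "smooth_on S (D2 u v)" for u v
    unfolding D2_def[abs_def] using f by (intro smooth_on_frechet_derivative)
  then have cont: "isCont (D2 u v) x" for u v
    using x S by (metis continuous_on_eq_continuous_at k_smooth_on.simps(1) smooth_on_def)
  have "\<bar>D2 u v x - D2 v u x\<bar> \<le> e" if "e > 0" for e
  proof -
    obtain r1 where r1: "r1 > 0" "\<And>y. dist y x < r1 \<Longrightarrow> dist (D2 u v y) (D2 u v x) < e / 2"
      using cont[of u v] \<open>e > 0\<close> unfolding continuous_at_eps_delta by (metis half_gt_zero)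
    obtain r2 where r2: "r2 > 0" "\<And>y. dist y x < r2 \<Longrightarrow> dist (D2 v u y) (D2 v u x) < e / 2"
      using cont[of v u] \<open>e > 0\<close> unfolding continuous_at_eps_delta by (metis half_gt_zero)
    obtain r3 where r3: "r3 > 0" "ball x r3 \<subseteq> S"
      using S x open_contains_ball by metis
    define r where "r = min r1 (min r2 r3)"
    have "r > 0" using r1 r2 r3 by (simp add: r_def)
    \<comment> \<open>Small enough for the parallelogram with sides s u and s v at \<open>x\<close>
      to stay within distance \<open>r\<close>.\<close>
    define s where "s = r / (2 * (norm u + norm v + 1))"
    have N: "norm u + norm v + 1 > 0" by (simp add: add_nonneg_pos)
    have "s > 0" using \<open>r > 0\<close> N by (simp add: s_def)
    have sr: "s * (norm u + norm v + 1) < r"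
    proof -
      have "a / (2 * c) * c = a / 2" if "c > 0" for a c :: real
        using that by simp
      from this[OF N] have "s * (norm u + norm v + 1) = r / 2"
        unfolding s_def .
      then show ?thesis using \<open>r > 0\<close> by simp
    qed
    have near: "dist (x + t *\<^sub>R u + t' *\<^sub>R v) x < r" if "0 \<le> t" "t \<le> s" "0 \<le> t'" "t' \<le> s" for t t'
    proof -
      have "dist (x + t *\<^sub>R u + t' *\<^sub>R v) x = norm (t *\<^sub>R u + t' *\<^sub>R v)"
        by (simp add: dist_norm algebra_simps)
      also have "\<dots> \<le> t * norm u + t' * norm v"
        using norm_triangle_ineq[of "t *\<^sub>R u" "t' *\<^sub>R v"] that by simp
      also have "\<dots> \<le> s * norm u + s * norm v"
        using that by (intro add_mono mult_right_mono) auto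
      also have "\<dots> \<le> s * (norm u + norm v + 1)"
        using \<open>s > 0\<close> by (simp add: algebra_simps)
      finally show ?thesis using sr by simp
    qed
    have near': "dist (x + t *\<^sub>R v + t' *\<^sub>R u) x < r" if "0 \<le> t" "t \<le> s" "0 \<le> t'" "t' \<le> s" for t t'
      using near[OF that(3,4,1,2)] by (simp add: algebra_simps)
    have inS: "y \<in> S" if "dist y x < r" for y
      using that r3 by (auto simp: r_def dist_commute)
    obtain t t' where t: "0 < t" "t < s" "0 < t'" "t' < s"
      "f (x + s *\<^sub>R u + s *\<^sub>R v) - f (x + s *\<^sub>R u) - f (x + s *\<^sub>R v) + f x =
       s * s * D2 u v (x + t *\<^sub>R u + t' *\<^sub>R v)"
      using second_difference_mean_value[OF f \<open>s > 0\<close>, of x u v] near inS unfolding D2_def by blast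
    obtain l l' where l: "0 < l" "l < s" "0 < l'" "l' < s"
      "f (x + s *\<^sub>R v + s *\<^sub>R u) - f (x + s *\<^sub>R v) - f (x + s *\<^sub>R u) + f x =
       s * s * D2 v u (x + l *\<^sub>R v + l' *\<^sub>R u)"
      using second_difference_mean_value[OF f \<open>s > 0\<close>, of x v u] near' inS unfolding D2_def by blast
    have swap: "x + s *\<^sub>R v + s *\<^sub>R u = x + s *\<^sub>R u + s *\<^sub>R v"
      by (simp add: algebra_simps)
    have "s * s * D2 u v (x + t *\<^sub>R u + t' *\<^sub>R v) = s * s * D2 v u (x + l *\<^sub>R v + l' *\<^sub>R u)"
      using t(5) l(5) unfolding swap by linarith
    then have "D2 u v (x + t *\<^sub>R u + t' *\<^sub>R v) = D2 v u (x + l *\<^sub>R v + l' *\<^sub>R u)"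
      using \<open>s > 0\<close> by simp
    moreover have "dist (D2 u v (x + t *\<^sub>R u + t' *\<^sub>R v)) (D2 u v x) < e / 2"
      using r1(2)[of "x + t *\<^sub>R u + t' *\<^sub>R v"] near[of t t'] t by (simp add: r_def)
    moreover have "dist (D2 v u (x + l *\<^sub>R v + l' *\<^sub>R u)) (D2 v u x) < e / 2"
      using r2(2)[of "x + l *\<^sub>R v + l' *\<^sub>R u"] near'[of l l'] l by (simp add: r_def)
    ultimately show ?thesis
      unfolding dist_real_def by linarith
  qed
  then have "\<bar>D2 u v x - D2 v u x\<bar> \<le> 0"
    by (rule field_le_epsilon) simp
  then show ?thesis by (simp add: D2_def)
qed

lemma frechet_derivative_eqI: "(f has_derivative f') (at x) \<Longrightarrow> frechet_derivative f (at x) v = f' v"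
  using frechet_derivative_at by metis

lemma frechet_derivative_cong:
  assumes "open S" "x \<in> S" "\<And>y. y \<in> S \<Longrightarrow> f y = g y"
  shows "frechet_derivative f (at x) = frechet_derivative g (at x)"
proof -
  have "(f has_derivative h) (at x) \<longleftrightarrow> (g has_derivative h) (at x)" for h
    using has_derivative_transform_within_open[of f h x UNIV S g]
      has_derivative_transform_within_open[of g h x UNIV S f] assms by auto
  then show ?thesis by (simp add: frechet_derivative_def)
qed

lemma frechet_derivative_inner:
  assumes "f differentiable at x"
  shows "frechet_derivative (\<lambda>y. f y \<bullet> b) (at x) v = frechet_derivative f (at x) v \<bullet> b"
  using assms bounded_linear.has_derivative[OF bounded_linear_inner_left]
  by (intro frechet_derivative_eqI) (auto simp: frechet_derivative_works)

lemma smooth_on_differentiable: "smooth_on S f \<Longrightarrow> x \<in> S \<Longrightarrow> f differentiable at x"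
  using smooth_on_has_derivative by (auto simp: differentiable_def)

lemma second_derivative_symmetric:
  fixes f :: "'a::real_normed_vector \<Rightarrow> 'b::euclidean_space"
  assumes S: "open S" and f: "smooth_on S f" and x: "x \<in> S"
  shows "frechet_derivative (\<lambda>y. frechet_derivative f (at y) u) (at x) v =
    frechet_derivative (\<lambda>y. frechet_derivative f (at y) v) (at x) u"
proof (rule euclidean_eqI)
  fix b :: 'b assume "b \<in> Basis"
  have fb: "smooth_on S (\<lambda>y. f y \<bullet> b)"
    by (rule smooth_on_linear[OF bounded_linear_inner_left S f])
  have *: "frechet_derivative (\<lambda>y. frechet_derivative (\<lambda>y. f y \<bullet> b) (at y) u) (at x) v =
     frechet_derivative (\<lambda>y. frechet_derivative f (at y) u) (at x) v \<bullet> b" for u v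
  proof -
    have "frechet_derivative (\<lambda>y. frechet_derivative (\<lambda>y. f y \<bullet> b) (at y) u) (at x) =
       frechet_derivative (\<lambda>y. frechet_derivative f (at y) u \<bullet> b) (at x)"
      by (rule frechet_derivative_cong[OF S x])
        (rule frechet_derivative_inner[OF smooth_on_differentiable[OF f]])
    then show ?thesis
      using frechet_derivative_inner[OF smooth_on_differentiable[OF smooth_on_frechet_derivative[OF f] x]]
      by simp
  qed
  show "frechet_derivative (\<lambda>y. frechet_derivative f (at y) u) (at x) v \<bullet> b =
    frechet_derivative (\<lambda>y. frechet_derivative f (at y) v) (at x) u \<bullet> b"
    using second_derivative_symmetric_real[OF S fb x, of u v] unfolding * .
qed

text \<open>The product rule, with the direction frozen at \<open>V x\<close> in the second-order
  term, because \<open>second_derivative_symmetric\<close> speaks of fixed directions. This isolates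
  the symmetric part that cancels in a Lie bracket.\<close>

lemma derivative_along_field_derivative:
  fixes f :: "'a::euclidean_space \<Rightarrow> 'b::real_normed_vector"
  assumes S: "open S" and x: "x \<in> S" and f: "smooth_on S f" and V: "smooth_on S V"
  shows "frechet_derivative (\<lambda>y. frechet_derivative f (at y) (V y)) (at x) w =
    frechet_derivative (\<lambda>y. frechet_derivative f (at y) (V x)) (at x) w +
    frechet_derivative f (at x) (frechet_derivative V (at x) w)"
proof -
  let ?f' = "\<lambda>y. frechet_derivative f (at y)"
  let ?V' = "frechet_derivative V (at x)"
  have d: "((\<lambda>y. ?f' y b) has_derivative frechet_derivative (\<lambda>y. ?f' y b) (at x)) (at x)" for b
    by (rule smooth_on_has_derivative[OF smooth_on_frechet_derivative[OF f] x])
  have V': "(V has_derivative ?V') (at x)"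
    by (rule smooth_on_has_derivative[OF V x])
  have *: "?f' y v = (\<Sum>b\<in>Basis. (v \<bullet> b) *\<^sub>R ?f' y b)" if "y \<in> S" for y v
    by (rule frechet_derivative_basis[OF smooth_on_differentiable[OF f that]])
  have "frechet_derivative (\<lambda>y. ?f' y (V y)) (at x) w =
      frechet_derivative (\<lambda>y. \<Sum>b\<in>Basis. (V y \<bullet> b) *\<^sub>R ?f' y b) (at x) w"
    by (rule fun_cong[OF frechet_derivative_cong[OF S x *]])
  also have "\<dots> = (\<Sum>b\<in>Basis. (V x \<bullet> b) *\<^sub>R frechet_derivative (\<lambda>y. ?f' y b) (at x) w + (?V' w \<bullet> b) *\<^sub>R ?f' x b)"
    by (rule frechet_derivative_eqI)
      (intro has_derivative_sum has_derivative_scaleR d has_derivative_inner_left V')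
  also have "\<dots> = (\<Sum>b\<in>Basis. (V x \<bullet> b) *\<^sub>R frechet_derivative (\<lambda>y. ?f' y b) (at x) w) + ?f' x (?V' w)"
    unfolding sum.distrib *[OF x, of "?V' w"] ..
  also have "(\<Sum>b\<in>Basis. (V x \<bullet> b) *\<^sub>R frechet_derivative (\<lambda>y. ?f' y b) (at x) w) =
      frechet_derivative (\<lambda>y. \<Sum>b\<in>Basis. (V x \<bullet> b) *\<^sub>R ?f' y b) (at x) w"
    by (rule frechet_derivative_eqI[symmetric])
      (intro has_derivative_sum has_derivative_scaleR_right d)
  also have "\<dots> = frechet_derivative (\<lambda>y. ?f' y (V x)) (at x) w"
    by (rule fun_cong[OF frechet_derivative_cong[OF S x *[symmetric]]])
  finally show ?thesis .
qed

section \<open>Calculus on manifolds\<close>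

locale smooth_manifold =
  fixes A :: "('m::{t2_space,second_countable_topology}, 'v::euclidean_space) chart set"
  assumes atlas: "smooth_atlas A"
begin

lemma chart_exists:
  obtains U \<phi> where "(U, \<phi>) \<in> A" "p \<in> U"
proof -
  have "p \<in> (\<Union>c\<in>A. fst c)"
    using atlas by (simp add: smooth_atlas_def)
  then show ?thesis using that by (metis UN_E surjective_pairing)
qed

lemma chart_at_chart: "chart_at A p \<in> A \<and> p \<in> fst (chart_at A p)"
proof -
  obtain U \<phi> where "(U, \<phi>) \<in> A" "p \<in> U" by (rule chart_exists)
  then show ?thesis
    unfolding chart_at_def by (intro someI[of "\<lambda>c. c \<in> A \<and> p \<in> fst c" "(U, \<phi>)"]) simp
qed

lemma chart_at_obtain:
  obtains U \<phi> where "chart_at A p = (U, \<phi>)" "(U, \<phi>) \<in> A" "p \<in> U"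
  using chart_at_chart[of p] by (cases "chart_at A p") auto

context
  fixes U \<phi> assumes c: "(U, \<phi>) \<in> A"
begin

lemma chart_open: "open U"
  using atlas c by (auto simp: smooth_atlas_def)

lemma chart_homeomorphism: obtains \<psi> where "homeomorphism U (\<phi> ` U) \<phi> \<psi>"
  using atlas c by (auto simp: smooth_atlas_def)

lemma chart_inj: "inj_on \<phi> U"
  by (rule chart_homeomorphism) (auto simp: homeomorphism_def intro: inj_on_inverseI)

lemma chart_inv_chart [simp]: "p \<in> U \<Longrightarrow> chart_inv (U, \<phi>) (\<phi> p) = p"
  by (simp add: chart_inv_def chart_inj)

lemma continuous_on_chart_inv: "continuous_on (\<phi> ` U) (chart_inv (U, \<phi>))"
proof (rule chart_homeomorphism)
  fix \<psi> assume "homeomorphism U (\<phi> ` U) \<phi> \<psi>"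
  then have "continuous_on (\<phi> ` U) \<psi>" "\<And>x. x \<in> \<phi> ` U \<Longrightarrow> \<psi> x = chart_inv (U, \<phi>) x"
    by (auto simp: homeomorphism_def)
  then show ?thesis by (rule continuous_on_eq)
qed

lemma open_chart_image:
  assumes "open W"
  shows "open (\<phi> ` (U \<inter> W))"
proof -
  have "open (\<phi> ` U)" using atlas c by (auto simp: smooth_atlas_def)
  then have "open (\<phi> ` U \<inter> chart_inv (U, \<phi>) -` W)"
    using continuous_on_chart_inv assms continuous_on_open_vimage by (metis Int_commute)
  also have "\<phi> ` U \<inter> chart_inv (U, \<phi>) -` W = \<phi> ` (U \<inter> W)"
    by auto
  finally show ?thesis .
qed

lemma smooth_fun_on_chart: "smooth_fun_on A U \<phi>"
  using atlas c by (auto simp: smooth_atlas_def smooth_fun_on_def)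

lemma smooth_fun_onD: "smooth_fun_on A W f \<Longrightarrow> smooth_on (\<phi> ` (U \<inter> W)) (\<lambda>x. f (chart_inv (U, \<phi>) x))"
  using c by (auto simp: smooth_fun_on_def comp_def)

end

lemma smooth_fun_onI:
  "(\<And>U \<phi>. (U, \<phi>) \<in> A \<Longrightarrow> smooth_on (\<phi> ` (U \<inter> W)) (\<lambda>x. f (chart_inv (U, \<phi>) x))) \<Longrightarrow> smooth_fun_on A W f"
  by (auto simp: smooth_fun_on_def comp_def)

lemma smooth_fun_on_subset: "smooth_fun_on A W f \<Longrightarrow> W' \<subseteq> W \<Longrightarrow> smooth_fun_on A W' f"
  by (rule smooth_fun_onI) (blast intro: smooth_on_subset smooth_fun_onD)

lemma smooth_fun_on_cong:
  assumes "smooth_fun_on A W f" "open W" "\<And>q. q \<in> W \<Longrightarrow> f q = g q"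
  shows "smooth_fun_on A W g"
proof (rule smooth_fun_onI)
  fix U \<phi> assume c: "(U, \<phi>) \<in> A"
  show "smooth_on (\<phi> ` (U \<inter> W)) (\<lambda>x. g (chart_inv (U, \<phi>) x))"
    by (rule smooth_on_cong[OF smooth_fun_onD[OF c assms(1)] open_chart_image[OF c assms(2)]])
      (use c assms(3) in auto)
qed

lemma smooth_fun_on_local:
  assumes "\<And>p. p \<in> W \<Longrightarrow> \<exists>W'. open W' \<and> p \<in> W' \<and> smooth_fun_on A W' f"
  shows "smooth_fun_on A W f"
proof (rule smooth_fun_onI)
  fix U \<phi> assume c: "(U, \<phi>) \<in> A"
  show "smooth_on (\<phi> ` (U \<inter> W)) (\<lambda>x. f (chart_inv (U, \<phi>) x))"
  proof (rule smooth_on_local)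
    fix x assume "x \<in> \<phi> ` (U \<inter> W)"
    then obtain p where p: "x = \<phi> p" "p \<in> U" "p \<in> W" by blast
    with assms obtain W' where "open W'" "p \<in> W'" "smooth_fun_on A W' f" by blast
    then show "\<exists>T. open T \<and> x \<in> T \<and> smooth_on T (\<lambda>x. f (chart_inv (U, \<phi>) x))"
      using open_chart_image[OF c] smooth_fun_onD[OF c] p by blast
  qed
qed

lemma smooth_fun_on_Un: "open W \<Longrightarrow> open W' \<Longrightarrow> smooth_fun_on A W f \<Longrightarrow> smooth_fun_on A W' f \<Longrightarrow> smooth_fun_on A (W \<union> W') f"
  by (rule smooth_fun_on_local) blast

lemma smooth_fun_on_const: "open W \<Longrightarrow> smooth_fun_on A W (\<lambda>q. c)"
  by (rule smooth_fun_onI, rule smooth_on_const, rule open_chart_image)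

lemma smooth_fun_on_add:
  "open W \<Longrightarrow> smooth_fun_on A W f \<Longrightarrow> smooth_fun_on A W g \<Longrightarrow> smooth_fun_on A W (\<lambda>q. f q + g q)"
  by (rule smooth_fun_onI, rule smooth_on_add) (auto intro: open_chart_image smooth_fun_onD)

lemma smooth_fun_on_bilinear:
  "bounded_bilinear B \<Longrightarrow> open W \<Longrightarrow> smooth_fun_on A W f \<Longrightarrow> smooth_fun_on A W g \<Longrightarrow> smooth_fun_on A W (\<lambda>q. B (f q) (g q))"
  by (rule smooth_fun_onI, rule smooth_on_bilinear) (auto intro: open_chart_image smooth_fun_onD)

lemmas smooth_fun_on_scaleR = smooth_fun_on_bilinear[OF bounded_bilinear_scaleR]
lemmas smooth_fun_on_mult = smooth_fun_on_bilinear[OF bounded_bilinear_mult]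

lemma smooth_fun_on_linear:
  "bounded_linear h \<Longrightarrow> open W \<Longrightarrow> smooth_fun_on A W f \<Longrightarrow> smooth_fun_on A W (\<lambda>q. h (f q))"
  by (rule smooth_fun_onI, rule smooth_on_linear) (auto intro: open_chart_image smooth_fun_onD)

lemma smooth_fun_on_diff:
  fixes f :: "'m \<Rightarrow> 'b::real_normed_vector"
  assumes "open W" "smooth_fun_on A W f" "smooth_fun_on A W g"
  shows "smooth_fun_on A W (\<lambda>q. f q - g q)"
  using smooth_fun_on_add[OF assms(1,2) smooth_fun_on_linear[OF bounded_linear_minus[OF bounded_linear_ident] assms(1,3)]]
  by simp

lemma smooth_fun_on_chart_compose:
  assumes c: "(U, \<phi>) \<in> A" and g: "smooth_on T g" and T: "open T" "\<phi> ` U \<subseteq> T"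
  shows "smooth_fun_on A U (\<lambda>q. g (\<phi> q))"
proof (rule smooth_fun_onI)
  fix V \<psi> assume d: "(V, \<psi>) \<in> A"
  show "smooth_on (\<psi> ` (V \<inter> U)) (\<lambda>x. g (\<phi> (chart_inv (V, \<psi>) x)))"
    by (rule smooth_on_compose[OF open_chart_image[OF d chart_open[OF c]] T(1) _
          smooth_fun_onD[OF d smooth_fun_on_chart[OF c]] g])
      (use T d in auto)
qed

section \<open>Differentials of functions on a manifold\<close>

lemma smooth_has_derivative:
  assumes "(U, \<phi>) \<in> A" "smooth_fun_on A W f" "p \<in> U" "p \<in> W"
  shows "((\<lambda>x. f (chart_inv (U, \<phi>) x)) has_derivative
    frechet_derivative (\<lambda>x. f (chart_inv (U, \<phi>) x)) (at (\<phi> p))) (at (\<phi> p))"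
  by (rule smooth_on_has_derivative[OF smooth_fun_onD[OF assms(1,2)]]) (use assms in auto)

lemma tderiv_eq:
  "chart_at A p = (U, \<phi>) \<Longrightarrow> tderiv A f p v = frechet_derivative (\<lambda>x. f (chart_inv (U, \<phi>) x)) (at (\<phi> p)) v"
  by (simp add: tderiv_def comp_def)

lemma tderiv_has_derivative:
  assumes "chart_at A p = (U, \<phi>)" "smooth_fun_on A W f" "p \<in> W"
  shows "((\<lambda>x. f (chart_inv (U, \<phi>) x)) has_derivative tderiv A f p) (at (\<phi> p))"
proof -
  have c: "(U, \<phi>) \<in> A" "p \<in> U" using chart_at_chart[of p] assms(1) by auto
  have "tderiv A f p = frechet_derivative (\<lambda>x. f (chart_inv (U, \<phi>) x)) (at (\<phi> p))"
    by (rule ext) (rule tderiv_eq[OF assms(1)])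
  then show ?thesis
    using smooth_has_derivative[OF c(1) assms(2) c(2) assms(3)] by simp
qed

lemma linear_tderiv: "smooth_fun_on A W f \<Longrightarrow> p \<in> W \<Longrightarrow> linear (tderiv A f p)"
  by (rule chart_at_obtain[of p]) (blast dest: tderiv_has_derivative has_derivative_linear)

lemma tderivI:
  assumes "chart_at A p = (U, \<phi>)" "((\<lambda>x. f (chart_inv (U, \<phi>) x)) has_derivative f') (at (\<phi> p))"
  shows "tderiv A f p v = f' v"
  by (rule trans[OF tderiv_eq[OF assms(1)] frechet_derivative_eqI[OF assms(2)]])

lemma tderiv_cong:
  assumes "open W" "p \<in> W" "\<And>q. q \<in> W \<Longrightarrow> f q = g q"
  shows "tderiv A f p = tderiv A g p"
proof (rule chart_at_obtain[of p])
  fix U \<phi> assume c: "chart_at A p = (U, \<phi>)" "(U, \<phi>) \<in> A" "p \<in> U"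
  have "frechet_derivative (\<lambda>x. f (chart_inv (U, \<phi>) x)) (at (\<phi> p)) =
      frechet_derivative (\<lambda>x. g (chart_inv (U, \<phi>) x)) (at (\<phi> p))"
    by (rule frechet_derivative_cong[OF open_chart_image[OF c(2) assms(1)]])
      (use c assms in auto)
  then show ?thesis
    by (intro ext trans[OF tderiv_eq[OF c(1)] trans[OF _ tderiv_eq[OF c(1), symmetric]]]) simp
qed

lemma tderiv_const: "tderiv A (\<lambda>q. c) p v = 0"
  by (simp add: tderiv_def comp_def)

lemma tderiv_add:
  assumes "smooth_fun_on A W f" "smooth_fun_on A W g" "p \<in> W"
  shows "tderiv A (\<lambda>q. f q + g q) p v = tderiv A f p v + tderiv A g p v"
proof (rule chart_at_obtain[of p])
  fix U \<phi> assume c: "chart_at A p = (U, \<phi>)" "(U, \<phi>) \<in> A" "p \<in> U"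
  show ?thesis
    by (rule tderivI[OF c(1) has_derivative_add[OF tderiv_has_derivative[OF c(1) assms(1,3)]
          tderiv_has_derivative[OF c(1) assms(2,3)]]])
qed

lemma tderiv_bilinear:
  assumes B: "bounded_bilinear B" and "smooth_fun_on A W f" "smooth_fun_on A W g" "p \<in> W"
  shows "tderiv A (\<lambda>q. B (f q) (g q)) p v = B (f p) (tderiv A g p v) + B (tderiv A f p v) (g p)"
proof (rule chart_at_obtain[of p])
  fix U \<phi> assume c: "chart_at A p = (U, \<phi>)" "(U, \<phi>) \<in> A" "p \<in> U"
  show ?thesis
    using tderivI[OF c(1) bounded_bilinear.FDERIV[OF B tderiv_has_derivative[OF c(1) assms(2,4)]
          tderiv_has_derivative[OF c(1) assms(3,4)]]] c by simp
qed

lemma tderiv_linear: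
  assumes h: "bounded_linear h" and "smooth_fun_on A W f" "p \<in> W"
  shows "tderiv A (\<lambda>q. h (f q)) p v = h (tderiv A f p v)"
proof (rule chart_at_obtain[of p])
  fix U \<phi> assume c: "chart_at A p = (U, \<phi>)" "(U, \<phi>) \<in> A" "p \<in> U"
  show ?thesis
    by (rule tderivI[OF c(1) bounded_linear.has_derivative[OF h tderiv_has_derivative[OF c(1) assms(2,3)]]])
qed

lemma tderiv_chart_at:
  assumes "chart_at A p = (U, \<phi>)"
  shows "tderiv A \<phi> p v = v"
proof -
  have c: "(U, \<phi>) \<in> A" "p \<in> U" using chart_at_chart[of p] assms by auto
  have "frechet_derivative (\<lambda>x. \<phi> (chart_inv (U, \<phi>) x)) (at (\<phi> p)) = frechet_derivative (\<lambda>x. x) (at (\<phi> p))"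
    by (rule frechet_derivative_cong[OF open_chart_image[OF c(1) open_UNIV]]) (use c in auto)
  then show ?thesis by (simp add: tderiv_eq[OF assms])
qed

text \<open>The preferred chart jumps with the point, so smooth dependence on \<open>p\<close>
  cannot be read off \<open>tderiv\<close> directly. The chain rule through the transition map
  rewrites it in one fixed chart.\<close>

lemma tderiv_chart:
  assumes c: "(U, \<phi>) \<in> A" and p: "p \<in> U" "p \<in> W" and W: "open W" and f: "smooth_fun_on A W f"
  shows "tderiv A f p v = frechet_derivative (\<lambda>x. f (chart_inv (U, \<phi>) x)) (at (\<phi> p)) (tderiv A \<phi> p v)"
proof (rule chart_at_obtain[of p])
  fix V \<psi> assume d: "chart_at A p = (V, \<psi>)" "(V, \<psi>) \<in> A" "p \<in> V"
  let ?f = "\<lambda>x. f (chart_inv (U, \<phi>) x)"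
  have inv: "chart_inv (V, \<psi>) (\<psi> p) = p" using d by simp
  have "((\<lambda>x. ?f (\<phi> (chart_inv (V, \<psi>) x))) has_derivative
      (\<lambda>v. frechet_derivative ?f (at (\<phi> p)) (tderiv A \<phi> p v))) (at (\<psi> p))"
    using has_derivative_compose[OF tderiv_has_derivative[OF d(1) smooth_fun_on_chart[OF c] p(1)], of ?f]
      smooth_has_derivative[OF c f p] unfolding inv .
  then have "((\<lambda>x. f (chart_inv (V, \<psi>) x)) has_derivative
      (\<lambda>v. frechet_derivative ?f (at (\<phi> p)) (tderiv A \<phi> p v))) (at (\<psi> p))"
    by (rule has_derivative_transform_within_open[OF _ open_chart_image[OF d(2) open_Int[OF W chart_open[OF c]]]])
      (use c d p in auto)
  then show ?thesis by (rule tderivI[OF d(1)])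
qed

text \<open>The inverse of \<open>tderiv A \<phi> p\<close>, that is, the tangent vector with
  coordinates \<open>w\<close> in the given chart. It is the derivative of the transition map to the
  preferred chart.\<close>

definition chart_vec :: "'m set \<Rightarrow> ('m \<Rightarrow> 'v) \<Rightarrow> 'm \<Rightarrow> 'v \<Rightarrow> 'v" where
  "chart_vec U \<phi> p w = frechet_derivative (\<lambda>x. snd (chart_at A p) (chart_inv (U, \<phi>) x)) (at (\<phi> p)) w"

lemma chart_vec_tderiv:
  assumes "(U, \<phi>) \<in> A" "p \<in> U"
  shows "chart_vec U \<phi> p (tderiv A \<phi> p v) = v"
proof (rule chart_at_obtain[of p])
  fix V \<psi> assume d: "chart_at A p = (V, \<psi>)" "(V, \<psi>) \<in> A" "p \<in> V"
  show ?thesis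
    using tderiv_chart[OF assms d(3) chart_open[OF d(2)] smooth_fun_on_chart[OF d(2)], of v]
    by (simp add: chart_vec_def d(1) tderiv_chart_at)
qed

text \<open>By finite dimension a one-sided inverse of a linear endomorphism is two-sided.\<close>

lemma tderiv_chart_vec:
  assumes "(U, \<phi>) \<in> A" "p \<in> U"
  shows "tderiv A \<phi> p (chart_vec U \<phi> p w) = w"
proof -
  have lin: "linear (tderiv A \<phi> p)"
    using linear_tderiv smooth_fun_on_chart assms by blast
  have "inj (tderiv A \<phi> p)"
    by (rule inj_on_inverseI[where g="chart_vec U \<phi> p"]) (rule chart_vec_tderiv[OF assms])
  then obtain v where "w = tderiv A \<phi> p v"
    using linear_injective_imp_surjective[OF lin] by (metis surjD)
  then show ?thesis using chart_vec_tderiv[OF assms] by simp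
qed

section \<open>Vector fields and the Lie bracket\<close>

lemma vector_fieldsD: "X \<in> vector_fields A \<Longrightarrow> (U, \<phi>) \<in> A \<Longrightarrow> smooth_fun_on A U (\<lambda>p. tderiv A \<phi> p (X p))"
  by (auto simp: vector_fields_def)

lemma vector_fieldsI:
  "(\<And>U \<phi>. (U, \<phi>) \<in> A \<Longrightarrow> smooth_fun_on A U (\<lambda>p. tderiv A \<phi> p (X p))) \<Longrightarrow> X \<in> vector_fields A"
  by (auto simp: vector_fields_def)

lemma smooth_fun_on_tderiv_field:
  assumes X: "X \<in> vector_fields A" and W: "open W" and f: "smooth_fun_on A W f"
  shows "smooth_fun_on A W (\<lambda>q. tderiv A f q (X q))"
proof (rule smooth_fun_onI)
  fix U \<phi> assume c: "(U, \<phi>) \<in> A"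
  let ?S = "\<phi> ` (U \<inter> W)"
  have S: "open ?S" by (rule open_chart_image[OF c W])
  have "smooth_on ?S (\<lambda>x. tderiv A \<phi> (chart_inv (U, \<phi>) x) (X (chart_inv (U, \<phi>) x)))"
    by (rule smooth_on_subset[OF smooth_fun_onD[OF c vector_fieldsD[OF X c]]]) auto
  from smooth_on_derivative_field[OF S smooth_fun_onD[OF c f] this]
  show "smooth_on ?S (\<lambda>x. tderiv A f (chart_inv (U, \<phi>) x) (X (chart_inv (U, \<phi>) x)))"
    by (rule smooth_on_cong[OF _ S]) (use c tderiv_chart[OF c _ _ W f] in auto)
qed

lemma vector_fields_add:
  assumes "X \<in> vector_fields A" "Y \<in> vector_fields A"
  shows "(\<lambda>p. X p + Y p) \<in> vector_fields A"
proof (rule vector_fieldsI)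
  fix U \<phi> assume c: "(U, \<phi>) \<in> A"
  show "smooth_fun_on A U (\<lambda>p. tderiv A \<phi> p (X p + Y p))"
    by (rule smooth_fun_on_cong[OF smooth_fun_on_add[OF _ vector_fieldsD[OF assms(1) c] vector_fieldsD[OF assms(2) c]]])
      (use linear_tderiv[OF smooth_fun_on_chart[OF c]] in \<open>auto simp: chart_open[OF c] linear_add\<close>)
qed

lemma vector_fields_scale:
  assumes h: "smooth_fun_on A UNIV h" and X: "X \<in> vector_fields A"
  shows "(\<lambda>p. h p *\<^sub>R X p) \<in> vector_fields A"
proof (rule vector_fieldsI)
  fix U \<phi> assume c: "(U, \<phi>) \<in> A"
  show "smooth_fun_on A U (\<lambda>p. tderiv A \<phi> p (h p *\<^sub>R X p))"
    by (rule smooth_fun_on_cong[OF smooth_fun_on_scaleR[OF _ smooth_fun_on_subset[OF h] vector_fieldsD[OF X c]]])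
      (use linear_tderiv[OF smooth_fun_on_chart[OF c]] in \<open>auto simp: chart_open[OF c] linear_cmul\<close>)
qed

text \<open>In both iterated derivatives the second-order parts agree by symmetry, and the
  first-order parts combine to the bracket. So the bracket, defined through one preferred chart per
  point, is the commutator of derivations on every function.\<close>

lemma tderiv_lie_bracket:
  fixes f :: "'m \<Rightarrow> 'b::euclidean_space"
  assumes X: "X \<in> vector_fields A" and Y: "Y \<in> vector_fields A"
    and W: "open W" "p \<in> W" and f: "smooth_fun_on A W f"
  shows "tderiv A f p (lie_bracket A X Y p) =
    tderiv A (\<lambda>q. tderiv A f q (Y q)) p (X p) - tderiv A (\<lambda>q. tderiv A f q (X q)) p (Y p)"
proof (rule chart_at_obtain[of p])
  fix U \<phi> assume d: "chart_at A p = (U, \<phi>)" and c: "(U, \<phi>) \<in> A" and p: "p \<in> U"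
  let ?S = "\<phi> ` (U \<inter> W)"
  have S: "open ?S" by (rule open_chart_image[OF c W(1)])
  have x: "\<phi> p \<in> ?S" using p W by auto
  let ?i = "chart_inv (U, \<phi>)"
  let ?f = "\<lambda>x. f (?i x)"
  define V where "V X x = tderiv A \<phi> (?i x) (X (?i x))" for X x
  have f': "smooth_on ?S ?f" by (rule smooth_fun_onD[OF c f])
  have V: "smooth_on ?S (V X)" if "X \<in> vector_fields A" for X
    unfolding V_def[abs_def]
    by (rule smooth_on_subset[OF smooth_fun_onD[OF c vector_fieldsD[OF that c]]]) auto
  have Vp: "V X (\<phi> p) = X p" for X
    using p c by (simp add: V_def tderiv_chart_at[OF d])
  have *: "tderiv A (\<lambda>q. tderiv A f q (Y q)) p w =
      frechet_derivative (\<lambda>y. frechet_derivative ?f (at y) (Y p)) (at (\<phi> p)) w +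
      tderiv A f p (tderiv A (\<lambda>q. tderiv A \<phi> q (Y q)) p w)" if Y: "Y \<in> vector_fields A" for Y w
  proof -
    have "tderiv A (\<lambda>q. tderiv A f q (Y q)) p w = frechet_derivative (\<lambda>x. tderiv A f (?i x) (Y (?i x))) (at (\<phi> p)) w"
      by (rule tderiv_eq[OF d])
    also have "\<dots> = frechet_derivative (\<lambda>y. frechet_derivative ?f (at y) (V Y y)) (at (\<phi> p)) w"
      by (rule fun_cong[OF frechet_derivative_cong[OF S x]])
        (use c tderiv_chart[OF c _ _ W(1) f] in \<open>auto simp: V_def\<close>)
    also have "\<dots> = frechet_derivative (\<lambda>y. frechet_derivative ?f (at y) (V Y (\<phi> p))) (at (\<phi> p)) w
        + frechet_derivative ?f (at (\<phi> p)) (frechet_derivative (V Y) (at (\<phi> p)) w)"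
      by (rule derivative_along_field_derivative[OF S x f' V[OF Y]])
    finally show ?thesis
      unfolding Vp by (simp add: tderiv_eq[OF d] V_def[abs_def])
  qed
  have lin: "linear (tderiv A f p)" by (rule linear_tderiv[OF f W(2)])
  have "lie_bracket A X Y p = tderiv A (\<lambda>q. tderiv A \<phi> q (Y q)) p (X p) - tderiv A (\<lambda>q. tderiv A \<phi> q (X q)) p (Y p)"
    by (simp add: lie_bracket_def d)
  then show ?thesis
    unfolding *[OF X] *[OF Y] second_derivative_symmetric[OF S f' x, of "Y p" "X p"]
    by (simp add: linear_diff[OF lin])
qed

text \<open>Applied to a chart map, \<open>tderiv_lie_bracket\<close> gives the components of the
  bracket in every chart, not only in the preferred one.\<close>

lemma lie_bracket_vector_fields:
  assumes "X \<in> vector_fields A" "Y \<in> vector_fields A"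
  shows "lie_bracket A X Y \<in> vector_fields A"
proof (rule vector_fieldsI)
  fix U \<phi> assume c: "(U, \<phi>) \<in> A"
  have 1: "smooth_fun_on A U (\<lambda>q. tderiv A (\<lambda>q. tderiv A \<phi> q (Y q)) q (X q))"
    if "X \<in> vector_fields A" "Y \<in> vector_fields A" for X Y
    by (rule smooth_fun_on_tderiv_field[OF that(1) chart_open[OF c] vector_fieldsD[OF that(2) c]])
  show "smooth_fun_on A U (\<lambda>p. tderiv A \<phi> p (lie_bracket A X Y p))"
    by (rule smooth_fun_on_cong[OF smooth_fun_on_diff[OF chart_open[OF c] 1[OF assms] 1[OF assms(2,1)]] chart_open[OF c]])
      (simp add: tderiv_lie_bracket[OF assms chart_open[OF c] _ smooth_fun_on_chart[OF c]])
qed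

section \<open>Bump functions on a manifold\<close>

text \<open>A Euclidean bump is pulled back by a chart and extended by 0. Outside the image
  \<open>K\<close> of a closed ball it vanishes, and \<open>K\<close> is compact, hence closed in
  the Hausdorff space M. \<open>K\<close> is part of the result because its closedness makes later
  extensions by 0 smooth.\<close>

lemma bump_function:
  assumes W: "open W" "p \<in> W"
  obtains \<rho> :: "'m \<Rightarrow> real" and K where "smooth_fun_on A UNIV \<rho>" "\<rho> p = 1" "closed K" "K \<subseteq> W" "\<And>q. q \<notin> K \<Longrightarrow> \<rho> q = 0"
proof (rule chart_exists[of p])
  fix U \<phi> assume c: "(U, \<phi>) \<in> A" and p: "p \<in> U"
  have "open (\<phi> ` (U \<inter> W))" by (rule open_chart_image[OF c W(1)])
  then obtain r where r: "r > 0" "cball (\<phi> p) r \<subseteq> \<phi> ` (U \<inter> W)"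
    using p W open_contains_cball by (metis IntI imageI)
  obtain \<beta> :: "'v \<Rightarrow> real" where \<beta>: "smooth_on UNIV \<beta>" "\<beta> (\<phi> p) = 1" "\<And>x. x \<notin> cball (\<phi> p) r \<Longrightarrow> \<beta> x = 0"
    by (rule euclidean_bump[OF r(1), of "\<phi> p"]) blast
  define K where "K = chart_inv (U, \<phi>) ` cball (\<phi> p) r"
  define \<rho> where "\<rho> q = (if q \<in> U then \<beta> (\<phi> q) else 0)" for q
  have "compact K"
    unfolding K_def
    by (intro compact_continuous_image compact_cball continuous_on_subset[OF continuous_on_chart_inv[OF c]]) (use r in auto)
  then have K: "closed K" by (rule compact_imp_closed)
  have KW: "K \<subseteq> U \<inter> W" using r c by (force simp: K_def)
  have out: "\<rho> q = 0" if "q \<notin> K" for q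
  proof (cases "q \<in> U")
    case True
    have "\<phi> q \<notin> cball (\<phi> p) r"
    proof
      assume "\<phi> q \<in> cball (\<phi> p) r"
      then have "chart_inv (U, \<phi>) (\<phi> q) \<in> K" unfolding K_def by (rule imageI)
      with that True c show False by simp
    qed
    then show ?thesis using \<beta>(3) by (simp add: \<rho>_def)
  qed (simp add: \<rho>_def)
  have 1: "smooth_fun_on A U \<rho>"
    by (rule smooth_fun_on_cong[OF smooth_fun_on_chart_compose[OF c \<beta>(1)] chart_open[OF c]])
      (auto simp: \<rho>_def)
  have 2: "smooth_fun_on A (- K) \<rho>"
    by (rule smooth_fun_on_cong[OF smooth_fun_on_const[of _ 0]]) (use K out in auto)
  have "smooth_fun_on A (U \<union> - K) \<rho>"
    by (rule smooth_fun_on_Un[OF chart_open[OF c] _ 1 2]) (use K in auto)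
  moreover have "U \<union> - K = UNIV" using KW by auto
  ultimately have "smooth_fun_on A UNIV \<rho>" by simp
  then show ?thesis
    using that[of \<rho> K] out K KW p \<beta> by (auto simp: \<rho>_def)
qed

text \<open>\<open>V\<close> is covered by two open sets: on \<open>W \<inter> V\<close> the
  function is a product of smooth ones, and on \<open>V - K\<close> it is 0.\<close>

lemma smooth_fun_on_cutoff:
  fixes f :: "'m \<Rightarrow> 'b::real_normed_vector"
  assumes W: "open W" "open V" and f: "smooth_fun_on A (W \<inter> V) f"
    and \<rho>: "smooth_fun_on A UNIV \<rho>" "closed K" "K \<subseteq> W" "\<And>q. q \<notin> K \<Longrightarrow> \<rho> q = 0"
  shows "smooth_fun_on A V (\<lambda>q. if q \<in> W then \<rho> q *\<^sub>R f q else 0)"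
proof -
  let ?g = "\<lambda>q. if q \<in> W then \<rho> q *\<^sub>R f q else 0"
  have 1: "smooth_fun_on A (W \<inter> V) ?g"
    by (rule smooth_fun_on_cong[OF smooth_fun_on_scaleR[OF _ smooth_fun_on_subset[OF \<rho>(1)] f]])
      (use W in auto)
  have 2: "smooth_fun_on A (V - K) ?g"
    by (rule smooth_fun_on_cong[OF smooth_fun_on_const[of _ 0]]) (use W \<rho> in auto)
  have "smooth_fun_on A ((W \<inter> V) \<union> (V - K)) ?g"
    by (rule smooth_fun_on_Un[OF _ _ 1 2]) (use W \<rho> in auto)
  moreover have "(W \<inter> V) \<union> (V - K) = V" using \<rho> by auto
  ultimately show ?thesis by simp
qed

end

section \<open>Shuffle products and alternating maps\<close>

text \<open>The wedge product as a sum over shuffles. Following the head \<open>x\<close> is the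
  rule for contracting a product with \<open>x\<close>; sent to the second list, \<open>x\<close>
  has to pass the later entries that go to the first one, hence the sign.\<close>

fun shuffle :: "('x list \<Rightarrow> 'x list \<Rightarrow> 'r::real_vector) \<Rightarrow> 'x list \<Rightarrow> 'r" where
  "shuffle f [] = f [] []"
| "shuffle f (x # xs) = shuffle (\<lambda>ys zs. f (x # ys) zs) xs +
     shuffle (\<lambda>ys zs. (-1) ^ length ys *\<^sub>R f ys (x # zs)) xs"

lemma shuffle_cong:
  assumes "\<And>ys zs. set ys \<subseteq> set xs \<Longrightarrow> set zs \<subseteq> set xs \<Longrightarrow> length ys + length zs = length xs \<Longrightarrow> f ys zs = g ys zs"
  shows "shuffle f xs = shuffle g xs"
  using assms
proof (induction xs arbitrary: f g)
  case (Cons x xs)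
  have "shuffle (\<lambda>ys zs. f (x # ys) zs) xs = shuffle (\<lambda>ys zs. g (x # ys) zs) xs"
    by (rule Cons.IH) (rule Cons.prems; auto)
  moreover have "shuffle (\<lambda>ys zs. (-1) ^ length ys *\<^sub>R f ys (x # zs)) xs = shuffle (\<lambda>ys zs. (-1) ^ length ys *\<^sub>R g ys (x # zs)) xs"
    by (rule Cons.IH) (rule arg_cong, rule Cons.prems; auto)
  ultimately show ?case by simp
qed simp

lemma shuffle_zero [simp]: "shuffle (\<lambda>ys zs. 0) xs = 0"
  by (induction xs) auto

lemma shuffle_add: "shuffle (\<lambda>ys zs. f ys zs + g ys zs) xs = shuffle f xs + shuffle g xs"
  by (induction xs arbitrary: f g) (auto simp: scaleR_right_distrib algebra_simps)

lemma shuffle_scaleR: "shuffle (\<lambda>ys zs. c *\<^sub>R f ys zs) xs = c *\<^sub>R shuffle f xs"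
  by (induction xs arbitrary: f)
    (simp_all add: scaleR_right_distrib scaleR_left_commute[of _ c] del: scaleR_scaleR)

lemma shuffle_uminus: "shuffle (\<lambda>ys zs. - f ys zs) xs = - shuffle f xs"
  using shuffle_scaleR[of "-1" f xs] by simp

lemma shuffle_mult: "shuffle (\<lambda>ys zs. c * f ys zs) xs = c * shuffle f xs" for c :: real
  using shuffle_scaleR[of c f xs] by simp

lemma shuffle_sum: "shuffle (\<lambda>ys zs. \<Sum>i\<in>I. f i ys zs) xs = (\<Sum>i\<in>I. shuffle (f i) xs)"
  by (induction I rule: infinite_finite_induct) (auto simp: shuffle_add)

lemma shuffle_sign:
  "shuffle (\<lambda>ys zs. (-1) ^ (length ys + length zs) *\<^sub>R f ys zs) xs = (-1) ^ length xs *\<^sub>R shuffle f xs"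
proof -
  have "shuffle (\<lambda>ys zs. (-1) ^ (length ys + length zs) *\<^sub>R f ys zs) xs = shuffle (\<lambda>ys zs. (-1) ^ length xs *\<^sub>R f ys zs) xs"
    by (rule shuffle_cong) simp
  then show ?thesis by (simp add: shuffle_scaleR)
qed

lemma shuffle_map: "shuffle f (map g xs) = shuffle (\<lambda>ys zs. f (map g ys) (map g zs)) xs"
  by (induction xs arbitrary: f) auto

text \<open>Both sides distribute the entries over three lists, and the head is followed into each.
  Sent to the third list it passes the other two, and the signs combine because \<open>ys\<close>
  and \<open>zs\<close> together have the length of \<open>us\<close>.\<close>

lemma shuffle_assoc:
  "shuffle (\<lambda>ys us. shuffle (\<lambda>zs ws. f ys zs ws) us) xs = shuffle (\<lambda>us ws. shuffle (\<lambda>ys zs. f ys zs ws) us) xs"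
proof (induction xs arbitrary: f)
  case (Cons x xs)
  have 1: "shuffle (\<lambda>ys zs. (-1) ^ length ys *\<^sub>R ((-1) ^ length zs *\<^sub>R f ys zs (x # ws))) us
      = (-1) ^ length us *\<^sub>R shuffle (\<lambda>ys zs. f ys zs (x # ws)) us" for us ws
    using shuffle_sign[of "\<lambda>ys zs. f ys zs (x # ws)" us] by (simp add: power_add)
  show ?case
    by (simp add: shuffle_add scaleR_right_distrib shuffle_scaleR[symmetric]
        Cons.IH[of "\<lambda>ys zs ws. (-1) ^ length ys *\<^sub>R f ys (x # zs) ws"]
        Cons.IH[of "\<lambda>ys zs ws. (-1) ^ length ys *\<^sub>R ((-1) ^ length zs *\<^sub>R f ys zs (x # ws))"]
        Cons.IH[of "\<lambda>ys. f (x # ys)"] del: scaleR_scaleR)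
      (simp add: 1 shuffle_scaleR del: scaleR_scaleR)
qed simp

text \<open>In the step the head lengthens one list, which turns the exponent kl into (k+1)l; the
  additional (-1)^l is the sign in the recursion of \<open>shuffle\<close>.\<close>

lemma shuffle_commute:
  "shuffle f xs = shuffle (\<lambda>ys zs. (-1) ^ (length ys * length zs) *\<^sub>R f zs ys) xs"
proof (induction xs arbitrary: f)
  case (Cons x xs)
  have "shuffle f (x # xs) = shuffle (\<lambda>ys zs. (-1) ^ (length ys * length zs) *\<^sub>R f (x # zs) ys) xs
      + shuffle (\<lambda>ys zs. (-1) ^ (length ys * length zs) *\<^sub>R (-1) ^ length zs *\<^sub>R f zs (x # ys)) xs"
    unfolding shuffle.simps Cons.IH[of "\<lambda>ys zs. f (x # ys) zs"]
      Cons.IH[of "\<lambda>ys zs. (-1) ^ length ys *\<^sub>R f ys (x # zs)"] ..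
  moreover have "(\<lambda>ys zs. (-1) ^ (length ys * length zs) *\<^sub>R (-1) ^ length zs *\<^sub>R f zs (x # ys))
      = (\<lambda>ys zs. (-1) ^ (length (x # ys) * length zs) *\<^sub>R f zs (x # ys))"
    by (auto simp: power_add mult.commute)
  moreover have "(\<lambda>ys zs. (-1) ^ (length ys * length zs) *\<^sub>R f (x # zs) ys)
      = (\<lambda>ys zs. (-1) ^ length ys *\<^sub>R (-1) ^ (length ys * length (x # zs)) *\<^sub>R f (x # zs) ys)"
    by (auto simp: power_add)
  ultimately show ?case by simp
qed simp

section \<open>From sums over permutations to shuffles\<close>

definition insert_at :: "nat \<Rightarrow> 'x \<Rightarrow> 'x list \<Rightarrow> 'x list" where
  "insert_at i x ys = take i ys @ x # drop i ys"

lemma insert_at_0 [simp]: "insert_at 0 x ys = x # ys"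
  by (simp add: insert_at_def)

lemma insert_at_Suc [simp]: "insert_at (Suc i) x (y # ys) = y # insert_at i x ys"
  by (simp add: insert_at_def)

lemma length_insert_at [simp]: "length (insert_at i x ys) = Suc (length ys)"
  by (simp add: insert_at_def)

lemma take_insert_at:
  assumes "i < k" "k \<le> Suc (length ys)"
  shows "take k (insert_at i x ys) = insert_at i x (take (k - 1) ys)"
    and "drop k (insert_at i x ys) = drop (k - 1) ys"
proof -
  obtain d where d: "k = Suc (i + d)"
    using less_imp_Suc_add[OF assms(1)] by blast
  have len: "length (take i ys) = i"
    using assms by simp
  show "take k (insert_at i x ys) = insert_at i x (take (k - 1) ys)"
    using assms(2) unfolding insert_at_def take_append drop_append len d
    by (simp add: drop_take min_absorb2 min_absorb1)
  show "drop k (insert_at i x ys) = drop (k - 1) ys"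
    using assms(2) unfolding insert_at_def take_append drop_append len d
    by (simp add: add.commute)
qed

lemma drop_insert_at:
  assumes "k \<le> i" "i \<le> length ys"
  shows "take k (insert_at i x ys) = take k ys"
    and "drop k (insert_at i x ys) = insert_at (i - k) x (drop k ys)"
  using assms by (auto simp: insert_at_def min_def drop_take)

text \<open>The signed sum over all permutations of a list, organised by the position of its first entry.\<close>

fun altsum :: "('x list \<Rightarrow> 'r::real_vector) \<Rightarrow> 'x list \<Rightarrow> 'r" where
  "altsum F [] = F []"
| "altsum F (x # xs) = (\<Sum>i\<le>length xs. (-1) ^ i *\<^sub>R altsum (\<lambda>ys. F (insert_at i x ys)) xs)"

lemma altsum_cong:
  assumes "\<And>ys. length ys = length xs \<Longrightarrow> F ys = G ys"
  shows "altsum F xs = altsum G xs"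
  using assms
proof (induction xs arbitrary: F G)
  case (Cons x xs)
  have "altsum (\<lambda>ys. F (insert_at i x ys)) xs = altsum (\<lambda>ys. G (insert_at i x ys)) xs" for i
    by (rule Cons.IH) (simp add: Cons.prems)
  then show ?case by simp
qed simp

lemma altsum_scaleR: "altsum (\<lambda>ys. c *\<^sub>R F ys) xs = c *\<^sub>R altsum F xs"
  by (induction xs arbitrary: F)
    (simp_all add: scaleR_sum_right scaleR_left_commute[of _ c] del: scaleR_scaleR)

text \<open>What alternation contributes to sign counts: an entry comes to the front at the price of
  the parity of its position. In this form it makes sense for lists of vector fields as well as of
  vectors.\<close>

definition antisym_list :: "('x list \<Rightarrow> 'r::real_vector) \<Rightarrow> bool" where
  "antisym_list a \<longleftrightarrow> (\<forall>i x ys. i \<le> length ys \<longrightarrow> a (insert_at i x ys) = (-1) ^ i *\<^sub>R a (x # ys))"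

lemma antisym_list_Cons:
  assumes "antisym_list a" shows "antisym_list (\<lambda>ys. a (x # ys))"
  unfolding antisym_list_def
proof (intro allI impI)
  fix i y and ys :: "'a list" assume "i \<le> length ys"
  then have "a (insert_at (Suc i) y (x # ys)) = (-1) ^ Suc i *\<^sub>R a (y # x # ys)"
    using assms unfolding antisym_list_def by (metis Suc_le_mono length_Cons)
  moreover have "a (insert_at 1 x (y # ys)) = (-1) ^ 1 *\<^sub>R a (x # y # ys)"
    using assms unfolding antisym_list_def by (metis One_nat_def Suc_le_mono le0 length_Cons)
  ultimately show "a (x # insert_at i y ys) = (-1) ^ i *\<^sub>R a (x # y # ys)"
    by simp
qed

text \<open>Each shuffle arises from k! l! permutations. Following the head, \<open>k\<close>
  positions place it in the first block, each with weight (k-1)! l!, and \<open>l\<close> positions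
  in the second, each with weight k! (l-1)!. These are the two branches of
  \<open>shuffle\<close>.\<close>

lemma altsum_eq_shuffle:
  assumes "length xs = k + l" "\<And>zs. antisym_list (\<lambda>ys. f ys zs)" "\<And>ys. antisym_list (f ys)"
    "\<And>ys zs. length ys \<noteq> k \<or> length zs \<noteq> l \<Longrightarrow> f ys zs = 0"
  shows "altsum (\<lambda>ys. f (take k ys) (drop k ys)) xs = (fact k * fact l) *\<^sub>R shuffle f xs"
  using assms
proof (induction xs arbitrary: f k l)
  case (Cons x xs)
  let ?F = "\<lambda>ys. f (take k ys) (drop k ys)"
  let ?A = "\<lambda>i. (-1) ^ i *\<^sub>R altsum (\<lambda>ys. ?F (insert_at i x ys)) xs"
  let ?f = "\<lambda>ys zs. f (x # ys) zs" and ?g = "\<lambda>ys zs. (-1) ^ length ys *\<^sub>R f ys (x # zs)"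
  have len: "length xs = k + l - 1" "k + l > 0" using Cons.prems(1) by auto
  have fst: "?A i = (fact (k - 1) * fact l) *\<^sub>R shuffle ?f xs" if "i < k" for i
  proof -
    have "altsum (\<lambda>ys. ?F (insert_at i x ys)) xs
        = altsum (\<lambda>ys. (-1) ^ i *\<^sub>R ?f (take (k - 1) ys) (drop (k - 1) ys)) xs"
    proof (rule altsum_cong)
      fix ys :: "'a list" assume ys: "length ys = length xs"
      have "?F (insert_at i x ys) = f (insert_at i x (take (k - 1) ys)) (drop (k - 1) ys)"
        using take_insert_at[of i k ys x] that ys len by simp
      also have "\<dots> = (-1) ^ i *\<^sub>R ?f (take (k - 1) ys) (drop (k - 1) ys)"
        using Cons.prems(2)[of "drop (k - 1) ys"] that ys len unfolding antisym_list_def by simp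
      finally show "?F (insert_at i x ys) = (-1) ^ i *\<^sub>R ?f (take (k - 1) ys) (drop (k - 1) ys)" .
    qed
    also have "\<dots> = (-1) ^ i *\<^sub>R altsum (\<lambda>ys. ?f (take (k - 1) ys) (drop (k - 1) ys)) xs"
      by (rule altsum_scaleR)
    also have "altsum (\<lambda>ys. ?f (take (k - 1) ys) (drop (k - 1) ys)) xs = (fact (k - 1) * fact l) *\<^sub>R shuffle ?f xs"
      using that len Cons.prems by (intro Cons.IH antisym_list_Cons) auto
    finally show ?thesis by (simp flip: power_mult_distrib)
  qed
  have snd: "?A i = (fact k * fact (l - 1)) *\<^sub>R shuffle ?g xs" if "k \<le> i" "i \<le> length xs" for i
  proof -
    have l: "length xs = k + (l - 1)" using that len by simp
    have "altsum (\<lambda>ys. ?F (insert_at i x ys)) xs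
        = altsum (\<lambda>ys. (-1) ^ i *\<^sub>R ?g (take k ys) (drop k ys)) xs"
    proof (rule altsum_cong)
      fix ys :: "'a list" assume ys: "length ys = length xs"
      have "?F (insert_at i x ys) = f (take k ys) (insert_at (i - k) x (drop k ys))"
        using drop_insert_at[of k i ys x] that ys by simp
      also have "\<dots> = (-1) ^ (i - k) *\<^sub>R f (take k ys) (x # drop k ys)"
        using Cons.prems(3)[of "take k ys"] that ys unfolding antisym_list_def by simp
      \<comment> \<open>The numbers i - k and i + k have equal parity. The factor (-1)^k is the sign
        in the second branch of \<open>shuffle\<close>, whose first list has length \<open>k\<close>
        here.\<close>
      also have "(-1::real) ^ (i - k) = (-1) ^ i * (-1) ^ k"
      proof -
        obtain d where d: "i = k + d" using \<open>k \<le> i\<close> le_iff_add by blast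
        have "(-1) ^ k * (-1) ^ k = (1::real)" by (simp flip: power_mult_distrib)
        then show ?thesis by (simp add: d power_add mult.commute mult.left_commute)
      qed
      finally show "?F (insert_at i x ys) = (-1) ^ i *\<^sub>R ?g (take k ys) (drop k ys)"
        using that ys by (simp add: min_absorb2)
    qed
    also have "\<dots> = (-1) ^ i *\<^sub>R altsum (\<lambda>ys. ?g (take k ys) (drop k ys)) xs"
      by (rule altsum_scaleR)
    also have "altsum (\<lambda>ys. ?g (take k ys) (drop k ys)) xs = (fact k * fact (l - 1)) *\<^sub>R shuffle ?g xs"
    proof (rule Cons.IH[OF l])
      show "antisym_list (\<lambda>ys. ?g ys zs)" for zs
        using Cons.prems(2)[of "x # zs"] by (simp add: antisym_list_def)
      show "antisym_list (?g ys)" for ys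
        using antisym_list_Cons[OF Cons.prems(3)[of ys]] by (simp add: antisym_list_def scaleR_left_commute)
      show "?g ys zs = 0" if "length ys \<noteq> k \<or> length zs \<noteq> l - 1" for ys zs
      proof -
        have "f ys (x # zs) = 0"
          by (rule Cons.prems(4)) (use that \<open>k \<le> i\<close> \<open>i \<le> length xs\<close> len in auto)
        then show ?thesis by simp
      qed
    qed
    finally show ?thesis by (simp flip: power_mult_distrib)
  qed
  \<comment> \<open>For k = 0 the left side is 0, and the right side vanishes as well because
    \<open>f\<close> is 0 on a nonempty first list.\<close>
  have k: "real k *\<^sub>R (fact (k - 1) * fact l) *\<^sub>R shuffle ?f xs = (fact k * fact l) *\<^sub>R shuffle ?f xs"
  proof (cases k)
    case 0
    have "shuffle ?f xs = shuffle (\<lambda>_ _. 0) xs"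
      by (rule shuffle_cong, rule Cons.prems(4)) (simp add: 0)
    then show ?thesis by simp
  qed (simp add: fact_reduce)
  have l: "real l *\<^sub>R (fact k * fact (l - 1)) *\<^sub>R shuffle ?g xs = (fact k * fact l) *\<^sub>R shuffle ?g xs"
  proof (cases l)
    case 0
    have "f ys (x # zs) = 0" for ys zs
      by (rule Cons.prems(4)) (simp add: 0)
    then show ?thesis by simp
  qed (simp add: fact_reduce mult.left_commute)
  have "altsum ?F (x # xs) = (\<Sum>i\<le>length xs. ?A i)" by simp
  also have "{..length xs} = {..<k} \<union> {k..<k + l}" using len by auto
  also have "(\<Sum>i\<in>{..<k} \<union> {k..<k + l}. ?A i) = (\<Sum>i<k. ?A i) + (\<Sum>i=k..<k + l. ?A i)"
    by (rule sum.union_disjoint) auto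
  also have "(\<Sum>i<k. ?A i) = (fact k * fact l) *\<^sub>R shuffle ?f xs"
    using k by (simp add: fst sum_constant_scaleR del: scaleR_scaleR)
  also have "(\<Sum>i=k..<k + l. ?A i) = (\<Sum>i=k..<k + l. (fact k * fact (l - 1)) *\<^sub>R shuffle ?g xs)"
    by (rule sum.cong[OF refl], rule snd) (use len in auto)
  also have "\<dots> = (fact k * fact l) *\<^sub>R shuffle ?g xs"
    using l by (simp add: sum_constant_scaleR del: scaleR_scaleR)
  finally show ?case by (simp add: scaleR_right_distrib)
qed simp

lemma nth_insert_at:
  "i \<le> length ys \<Longrightarrow> j \<le> length ys \<Longrightarrow>
    insert_at i x ys ! j = (if j < i then ys ! j else if j = i then x else ys ! (j - 1))"
  by (auto simp: insert_at_def nth_append nth_Cons')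

text \<open>The permutation that puts the new entry 0 at position \<open>i\<close> and arranges the
  shifted others by \<open>q\<close>. On lists it corresponds to \<open>insert_at i\<close> for the
  head.\<close>

definition perm_ext :: "nat \<Rightarrow> (nat \<Rightarrow> nat) \<Rightarrow> nat \<Rightarrow> nat" where
  "perm_ext i q j = (if j < i then Suc (q j) else if j = i then 0 else Suc (q (j - 1)))"

lemma perm_ext_Suc: "perm_ext (Suc i) q = perm_ext i q \<circ> Transposition.transpose i (Suc i)"
  by (auto simp: perm_ext_def Transposition.transpose_def fun_eq_iff)

lemma perm_ext_0:
  assumes "q permutes {..<N}"
  shows "perm_ext 0 q = map_permutation {..<N} Suc q"
proof
  fix j
  show "perm_ext 0 q j = map_permutation {..<N} Suc q j"
  proof (cases j)
    case 0
    then show ?thesis by (auto simp: perm_ext_def map_permutation_def restrict_id_def)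
  next
    case (Suc l)
    show ?thesis
    proof (cases "l < N")
      case True
      then have "inv_into {..<N} Suc (Suc l) = l" by (intro inv_into_f_f) auto
      then show ?thesis using True Suc by (auto simp: perm_ext_def map_permutation_def restrict_id_def)
    next
      case False
      then have "q l = l" using assms by (auto simp: permutes_def)
      then show ?thesis using False Suc by (auto simp: perm_ext_def map_permutation_def restrict_id_def)
    qed
  qed
qed

text \<open>With 0 in front the permutation is a shifted copy of \<open>q\<close>, of the same sign;
  \<open>i\<close> adjacent transpositions then carry 0 to its place, each reversing the
  sign.\<close>

lemma perm_ext_permutes_sign:
  assumes q: "q permutes {..<N}" and "i \<le> N"
  shows "perm_ext i q permutes {..<Suc N} \<and> sign (perm_ext i q) = (-1) ^ i * sign q"
  using assms(2)
proof (induction i)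
  case 0
  have "map_permutation {..<N} Suc q permutes Suc ` {..<N}"
    by (rule map_permutation_permutes[OF _ q]) (simp add: bij_betw_def)
  then have "map_permutation {..<N} Suc q permutes {..<Suc N}"
    by (rule permutes_subset) auto
  then show ?case
    by (simp add: perm_ext_0[OF q] sign_map_permutation[OF _ q])
next
  case (Suc i)
  have t: "Transposition.transpose i (Suc i) permutes {..<Suc N}"
    using Suc.prems by (intro permutes_swap_id) auto
  have p: "perm_ext i q permutes {..<Suc N}" and s: "sign (perm_ext i q) = (-1) ^ i * sign q"
    using Suc by auto
  have "permutation (perm_ext i q)" "permutation (Transposition.transpose i (Suc i))"
    using p t by (auto simp: permutation_permutes)
  then have "sign (perm_ext (Suc i) q) = (-1) ^ Suc i * sign q"
    unfolding perm_ext_Suc by (simp add: sign_compose sign_swap_id s)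
  moreover have "perm_ext (Suc i) q permutes {..<Suc N}"
    unfolding perm_ext_Suc by (rule permutes_compose[OF t p])
  ultimately show ?case by blast
qed

lemma perm_ext_inj: "inj_on (\<lambda>(i, q). perm_ext i q) (UNIV \<times> Q)"
proof (rule inj_onI, clarify)
  fix i i' and q q' :: "nat \<Rightarrow> nat" assume eq: "perm_ext i q = perm_ext i' q'"
  have "perm_ext i' q' i = 0" using fun_cong[OF eq, of i] by (simp add: perm_ext_def)
  then have i: "i = i'" by (auto simp: perm_ext_def split: if_splits)
  have "q j = q' j" for j
    using fun_cong[OF eq, of j] fun_cong[OF eq, of "Suc j"] i by (auto simp: perm_ext_def split: if_splits)
  then show "i = i' \<and> q = q'" using i by auto
qed

text \<open>Injectivity and the count (N+1) N! = (N+1)! give surjectivity.\<close>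

lemma bij_betw_perm_ext:
  "bij_betw (\<lambda>(i, q). perm_ext i q) ({..N} \<times> {q. q permutes {..<N}}) {\<sigma>. \<sigma> permutes {..<Suc N}}"
proof -
  let ?e = "\<lambda>(i, q). perm_ext i q" and ?D = "{..N} \<times> {q. q permutes {..<N}}"
  have inj: "inj_on ?e ?D"
    by (rule inj_on_subset[OF perm_ext_inj]) auto
  have sub: "?e ` ?D \<subseteq> {\<sigma>. \<sigma> permutes {..<Suc N}}"
    using perm_ext_permutes_sign by auto
  have "card (?e ` ?D) = Suc N * fact N"
    using card_image[OF inj] by (simp add: card_cartesian_product card_permutations)
  then have "card (?e ` ?D) = card {\<sigma>. \<sigma> permutes {..<Suc N}}"
    by (simp add: card_permutations)
  then have "?e ` ?D = {\<sigma>. \<sigma> permutes {..<Suc N}}"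
    using sub by (intro card_subset_eq finite_permutations) auto
  then show ?thesis using inj by (simp add: bij_betw_def)
qed

lemma altsum_permutations:
  "(\<Sum>\<sigma> | \<sigma> permutes {..<length xs}. of_int (sign \<sigma>) *\<^sub>R F (map (\<lambda>i. xs ! \<sigma> i) [0..<length xs])) = altsum F xs"
proof (induction xs arbitrary: F)
  case (Cons x xs)
  let ?N = "length xs"
  let ?G = "\<lambda>\<sigma>. of_int (sign \<sigma>) *\<^sub>R F (map (\<lambda>i. (x # xs) ! \<sigma> i) [0..<Suc ?N])"
  have *: "?G (perm_ext i q) = (-1) ^ i *\<^sub>R of_int (sign q) *\<^sub>R F (insert_at i x (map (\<lambda>i. xs ! q i) [0..<?N]))"
    if "i \<le> ?N" "q permutes {..<?N}" for i q
  proof -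
    have "map (\<lambda>j. (x # xs) ! perm_ext i q j) [0..<Suc ?N] = insert_at i x (map (\<lambda>i. xs ! q i) [0..<?N])"
      by (rule nth_equalityI) (use that in \<open>auto simp: nth_insert_at perm_ext_def simp del: upt_Suc\<close>)
    moreover have "of_int (sign (perm_ext i q)) = (-1) ^ i * (of_int (sign q) :: real)"
      using perm_ext_permutes_sign[OF that(2,1)] by simp
    ultimately show ?thesis by simp
  qed
  have "(\<Sum>\<sigma> | \<sigma> permutes {..<Suc ?N}. ?G \<sigma>) = (\<Sum>z\<in>{..?N} \<times> {q. q permutes {..<?N}}. ?G (case z of (i, q) \<Rightarrow> perm_ext i q))"
    by (rule sum.reindex_bij_betw[OF bij_betw_perm_ext, symmetric])
  also have "\<dots> = (\<Sum>i\<le>?N. \<Sum>q | q permutes {..<?N}. ?G (perm_ext i q))"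
    by (subst sum.cartesian_product) (auto intro!: sum.cong)
  also have "\<dots> = (\<Sum>i\<le>?N. (-1) ^ i *\<^sub>R altsum (\<lambda>ys. F (insert_at i x ys)) xs)"
    unfolding Cons.IH[symmetric] scaleR_sum_right
    by (intro sum.cong refl) (use * in auto)
  finally show ?case by simp
qed simp

section \<open>Multilinear and alternating maps\<close>

text \<open>Multilinearity for all lengths at once, so that it passes to
  \<open>\<lambda>ys. a (x # ys)\<close> and through the recursion of \<open>shuffle\<close> without
  bookkeeping of degrees.\<close>

definition slot_linear :: "('v::real_vector list \<Rightarrow> 'w::real_vector) \<Rightarrow> bool" where
  "slot_linear a \<longleftrightarrow> (\<forall>ys i. i < length ys \<longrightarrow> linear (\<lambda>v. a (ys[i := v])))"

lemma slot_linearD: "slot_linear a \<Longrightarrow> i < length ys \<Longrightarrow> linear (\<lambda>v. a (ys[i := v]))"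
  by (simp add: slot_linear_def)

lemma alternating_length: "alternating k a \<Longrightarrow> length vs \<noteq> k \<Longrightarrow> a vs = 0"
  by (simp add: alternating_def)

lemma alternating_slot_linear: "alternating k a \<Longrightarrow> slot_linear a"
  unfolding slot_linear_def
proof (intro allI impI)
  fix ys :: "'a list" and i assume a: "alternating k a" and "i < length ys"
  show "linear (\<lambda>v. a (ys[i := v]))"
  proof (cases "length ys = k")
    case True
    then show ?thesis using a \<open>i < length ys\<close> by (simp add: alternating_def)
  next
    case False
    then have "(\<lambda>v. a (ys[i := v])) = (\<lambda>v. 0)"
      using alternating_length[OF a] by simp
    then show ?thesis by (simp add: linear_iff)
  qed
qed

text \<open>Polarisation: with \<open>g\<close> the form in the two adjacent slots, expand g(x + y,
  x + y) = 0.\<close>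

lemma alternating_swap:
  assumes a: "alternating k a"
  shows "a (ps @ x # y # qs) = - a (ps @ y # x # qs)"
proof (cases "length (ps @ x # y # qs) = k")
  case True
  define g where "g u v = a (ps @ u # v # qs)" for u v
  have 1: "linear (\<lambda>u. g u v)" for v
  proof -
    have "linear (\<lambda>u. a ((ps @ x # v # qs)[length ps := u]))"
      by (rule slot_linearD[OF alternating_slot_linear[OF a]]) simp
    then show ?thesis by (simp add: g_def)
  qed
  have 2: "linear (g u)" for u
  proof -
    have "linear (\<lambda>v. a ((ps @ u # y # qs)[Suc (length ps) := v]))"
      by (rule slot_linearD[OF alternating_slot_linear[OF a]]) simp
    then show ?thesis by (simp add: g_def[abs_def] list_update_append)
  qed
  have 3: "g u u = 0" for u
  proof -
    have "length ps < Suc (length ps)" "Suc (length ps) < k" "length (ps @ u # u # qs) = k"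
      "(ps @ u # u # qs) ! length ps = (ps @ u # u # qs) ! Suc (length ps)"
      using True by (auto simp: nth_append)
    then show ?thesis
      using a unfolding alternating_def g_def by blast
  qed
  have "g (x + y) (x + y) = g x x + g x y + (g y x + g y y)"
    by (simp add: linear_add[OF 1] linear_add[OF 2])
  then have "g x y + g y x = 0" by (simp add: 3)
  then show ?thesis unfolding g_def by (simp add: eq_neg_iff_add_eq_0)
next
  case False
  then show ?thesis using alternating_length[OF a] by simp
qed

lemma alternating_antisym_list:
  assumes a: "alternating k a" shows "antisym_list a"
  unfolding antisym_list_def
proof (intro allI impI)
  fix i x and ys :: "'a list" assume "i \<le> length ys"
  then show "a (insert_at i x ys) = (-1) ^ i *\<^sub>R a (x # ys)"
  proof (induction i)
    case (Suc i)
    then have "i < length ys" by simp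
    then have "insert_at (Suc i) x ys = take i ys @ ys ! i # x # drop (Suc i) ys"
      "insert_at i x ys = take i ys @ x # ys ! i # drop (Suc i) ys"
      by (simp_all add: insert_at_def take_Suc_conv_app_nth Cons_nth_drop_Suc)
    then have "a (insert_at (Suc i) x ys) = - a (insert_at i x ys)"
      by (simp only: alternating_swap[OF a, of "take i ys" "ys ! i" x "drop (Suc i) ys"])
    then show ?case using Suc by simp
  qed simp
qed

lemma linear_shuffle_param:
  "(\<And>ys zs. linear (\<lambda>v. f v ys zs)) \<Longrightarrow> linear (\<lambda>v. shuffle (f v) xs)"
proof (induction xs arbitrary: f)
  case (Cons x xs)
  have "linear (\<lambda>v. shuffle (\<lambda>ys zs. f v (x # ys) zs) xs)"
    by (rule Cons.IH) (rule Cons.prems)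
  moreover have "linear (\<lambda>v. shuffle (\<lambda>ys zs. (-1) ^ length ys *\<^sub>R f v ys (x # zs)) xs)"
    by (rule Cons.IH) (rule linear_compose_scale_right, rule Cons.prems)
  ultimately show ?case by (simp add: linear_compose_add)
qed simp

lemma slot_linear_Cons: "slot_linear a \<Longrightarrow> slot_linear (\<lambda>ys. a (x # ys))"
  unfolding slot_linear_def
proof (intro allI impI)
  fix ys :: "'a list" and i assume "\<forall>ys i. i < length ys \<longrightarrow> linear (\<lambda>v. a (ys[i := v]))" "i < length ys"
  then have "linear (\<lambda>v. a ((x # ys)[Suc i := v]))" by (metis Suc_less_eq length_Cons)
  then show "linear (\<lambda>v. a (x # ys[i := v]))" by simp
qed

lemma slot_linear_head: "slot_linear a \<Longrightarrow> linear (\<lambda>v. a (v # ys))"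
  unfolding slot_linear_def by (drule spec[of _ "undefined # ys"], drule spec[of _ 0]) simp

lemma slot_linear_scaleR: "slot_linear a \<Longrightarrow> slot_linear (\<lambda>ys. (-1) ^ length ys *\<^sub>R a ys)"
  by (auto simp: slot_linear_def intro: linear_compose_scale_right)

lemma slot_linear_shuffle:
  assumes "\<And>zs. slot_linear (\<lambda>ys. f ys zs)" "\<And>ys. slot_linear (f ys)"
  shows "slot_linear (shuffle f)"
proof -
  have "linear (\<lambda>v. shuffle f (xs[i := v]))" if "i < length xs" for xs i
    using assms that
  proof (induction xs arbitrary: f i)
    case (Cons x xs)
    show ?case
    proof (cases i)
      case 0
      have "linear (\<lambda>v. shuffle (\<lambda>ys zs. f (v # ys) zs) xs)"
        by (rule linear_shuffle_param) (rule slot_linear_head, rule Cons.prems)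
      moreover have "linear (\<lambda>v. shuffle (\<lambda>ys zs. (-1) ^ length ys *\<^sub>R f ys (v # zs)) xs)"
        by (rule linear_shuffle_param)
          (rule linear_compose_scale_right, rule slot_linear_head, rule Cons.prems)
      ultimately show ?thesis using 0 by (simp add: linear_compose_add)
    next
      case (Suc j)
      have "linear (\<lambda>v. shuffle (\<lambda>ys zs. f (x # ys) zs) (xs[j := v]))"
        by (rule Cons.IH) (use Cons.prems Suc in \<open>auto intro: slot_linear_Cons[of "\<lambda>ys. f ys _"]\<close>)
      moreover have "linear (\<lambda>v. shuffle (\<lambda>ys zs. (-1) ^ length ys *\<^sub>R f ys (x # zs)) (xs[j := v]))"
      proof (rule Cons.IH)
        show "slot_linear (\<lambda>ys. (-1) ^ length ys *\<^sub>R f ys (x # zs))" for zs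
          by (rule slot_linear_scaleR) (rule Cons.prems)
        show "slot_linear (\<lambda>zs. (-1) ^ length ys *\<^sub>R f ys (x # zs))" for ys
          using slot_linear_Cons[OF Cons.prems(2)[of ys], of x]
          by (auto simp: slot_linear_def intro: linear_compose_scale_right)
      qed (use Cons.prems Suc in auto)
      ultimately show ?thesis using Suc by (simp add: linear_compose_add)
    qed
  qed simp
  then show ?thesis by (simp add: slot_linear_def)
qed

lemma shuffle_permutations:
  assumes "\<And>zs. alternating k (\<lambda>ys. f ys zs)" "\<And>ys. alternating l (f ys)" "length xs = k + l"
  shows "(\<Sum>\<sigma> | \<sigma> permutes {..<k + l}. of_int (sign \<sigma>) *\<^sub>R
      f (map (\<lambda>i. xs ! \<sigma> i) [0..<k]) (map (\<lambda>i. xs ! \<sigma> i) [k..<k + l])) = (fact k * fact l) *\<^sub>R shuffle f xs"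
proof -
  have "altsum (\<lambda>ys. f (take k ys) (drop k ys)) xs = (fact k * fact l) *\<^sub>R shuffle f xs"
    using assms alternating_antisym_list alternating_length by (intro altsum_eq_shuffle) blast+
  moreover have "take k (map (\<lambda>i. xs ! \<sigma> i) [0..<k + l]) = map (\<lambda>i. xs ! \<sigma> i) [0..<k]"
    "drop k (map (\<lambda>i. xs ! \<sigma> i) [0..<k + l]) = map (\<lambda>i. xs ! \<sigma> i) [k..<k + l]" for \<sigma>
    by (simp_all add: take_map drop_map)
  ultimately show ?thesis
    using altsum_permutations[where xs=xs and F="\<lambda>ys. f (take k ys) (drop k ys)"] assms(3) by simp
qed

text \<open>Vanishing on a repeated argument is invisible in the recursion. It comes from the sum
  over permutations, where composition with the transposition of the two equal positions reverses
  every sign.\<close>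

lemma alternating_shuffle:
  assumes f: "\<And>zs. alternating k (\<lambda>ys. f ys zs)" "\<And>ys. alternating l (f ys)"
  shows "alternating (k + l) (shuffle f)"
  unfolding alternating_def
proof (intro conjI allI impI)
  fix vs :: "'a list"
  show "shuffle f vs = 0" if "length vs \<noteq> k + l"
  proof -
    have "f ys zs = 0" if "length ys + length zs = length vs" for ys zs
      using that \<open>length vs \<noteq> k + l\<close> alternating_length[OF f(1)[of zs], of ys] alternating_length[OF f(2)[of ys], of zs]
      by (cases "length ys = k") auto
    then have "shuffle f vs = shuffle (\<lambda>_ _. 0) vs"
      by (intro shuffle_cong) simp
    then show ?thesis by simp
  qed
next
  fix vs :: "'a list" and i assume "length vs = k + l \<and> i < k + l"
  moreover have "slot_linear (shuffle f)"
    using f alternating_slot_linear by (intro slot_linear_shuffle) blast+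
  ultimately show "linear (\<lambda>v. shuffle f (vs[i := v]))"
    by (simp add: slot_linear_def)
next
  fix vs :: "'a list" and i j
  assume ij: "length vs = k + l \<and> i < j \<and> j < k + l \<and> vs ! i = vs ! j"
  let ?t = "Transposition.transpose i j"
  define G where "G \<sigma> = of_int (sign \<sigma>) *\<^sub>R f (map (\<lambda>i. vs ! \<sigma> i) [0..<k]) (map (\<lambda>i. vs ! \<sigma> i) [k..<k + l])" for \<sigma>
  let ?S = "\<Sum>\<sigma> | \<sigma> permutes {..<k + l}. G \<sigma>"
  have t: "?t permutes {..<k + l}" using ij by (intro permutes_swap_id) auto
  have vt: "vs ! ?t a = vs ! a" for a using ij by (auto simp: Transposition.transpose_def)
  have "?S = (\<Sum>\<sigma> | \<sigma> permutes {..<k + l}. - G \<sigma>)"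
  proof (rule sum.reindex_bij_witness[where i="\<lambda>\<sigma>. ?t \<circ> \<sigma>" and j="\<lambda>\<sigma>. ?t \<circ> \<sigma>"])
    fix \<sigma> assume "\<sigma> \<in> {\<sigma>. \<sigma> permutes {..<k + l}}"
    then have s: "\<sigma> permutes {..<k + l}" by simp
    show "?t \<circ> (?t \<circ> \<sigma>) = \<sigma>" by (simp add: fun_eq_iff)
    then show "?t \<circ> (?t \<circ> \<sigma>) = \<sigma>" .
    show "?t \<circ> \<sigma> \<in> {\<sigma>. \<sigma> permutes {..<k + l}}" using permutes_compose[OF s t] by simp
    then show "?t \<circ> \<sigma> \<in> {\<sigma>. \<sigma> permutes {..<k + l}}" .
    have "permutation ?t" "permutation \<sigma>" using s t by (auto simp: permutation_permutes)
    then have "sign (?t \<circ> \<sigma>) = - sign \<sigma>" using ij by (simp add: sign_compose sign_swap_id)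
    then show "- G (?t \<circ> \<sigma>) = G \<sigma>" by (simp add: G_def vt)
  qed
  then have "?S = - ?S" by (simp add: sum_negf)
  then have "?S + ?S = 0" by (metis add.right_inverse)
  then have "2 *\<^sub>R ?S = 0" by (simp only: scaleR_2)
  then have "?S = 0" by simp
  then show "shuffle f vs = 0"
    using shuffle_permutations[OF f, of vs] ij unfolding G_def by simp
qed

text \<open>Maps on a fibre are linear only there, not on the ambient space, so \<open>h\<close> is
  controlled just on a set \<open>V\<close> that contains the values of \<open>a\<close>.\<close>

lemma alternating_compose:
  assumes a: "alternating k a" and V: "\<And>vs. a vs \<in> V"
    and h: "\<And>x y s t. x \<in> V \<Longrightarrow> y \<in> V \<Longrightarrow> h (s *\<^sub>R x + t *\<^sub>R y) = s *\<^sub>R h x + t *\<^sub>R h y"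
  shows "alternating k (\<lambda>vs. h (a vs))"
proof -
  have h0: "h 0 = 0" using h[OF V V, of 0 _ 0] by simp
  show ?thesis
    unfolding alternating_def
  proof (intro conjI allI impI)
    fix vs :: "'a list" and i assume "length vs = k \<and> i < k"
    then have "linear (\<lambda>v. a (vs[i := v]))" using a by (simp add: alternating_def)
    note lin = linear_add[OF this] linear_cmul[OF this]
    show "linear (\<lambda>v. h (a (vs[i := v])))"
      using h[OF V V, of 1 _ 1] h[OF V V, of _ _ 0] by (intro linearI) (simp_all add: lin)
  next
    fix vs :: "'a list" assume "length vs \<noteq> k"
    then show "h (a vs) = 0" using alternating_length[OF a] h0 by simp
  next
    fix vs :: "'a list" and i j assume "length vs = k \<and> i < j \<and> j < k \<and> vs ! i = vs ! j"
    then have "a vs = 0" using a unfolding alternating_def by blast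
    then show "h (a vs) = 0" using h0 by simp
  qed
qed

lemma alternating_scaleR: "alternating k a \<Longrightarrow> alternating k (\<lambda>vs. c *\<^sub>R a vs)"
  by (rule alternating_compose[of k a UNIV]) (auto simp: scaleR_right_distrib mult.commute)

lemma alternating_mult_left: "alternating k a \<Longrightarrow> alternating k (\<lambda>vs. c * a vs)" for c :: real
  using alternating_scaleR[of k a c] by simp

lemma alternating_scaleR_left: "alternating k a \<Longrightarrow> alternating k (\<lambda>vs. a vs *\<^sub>R c)"
  by (rule alternating_compose[of k a UNIV]) (auto simp: scaleR_left_distrib)

lemma alternating_zero: "alternating k (\<lambda>vs. 0)"
  by (simp add: alternating_def linear_iff)

lemma alternating_add:
  "alternating k a \<Longrightarrow> alternating k a' \<Longrightarrow> alternating k (\<lambda>vs. a vs + a' vs)"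
  by (simp add: alternating_def linear_compose_add)

lemma alternating_sum: "(\<And>i. i \<in> I \<Longrightarrow> alternating k (a i)) \<Longrightarrow> alternating k (\<lambda>vs. \<Sum>i\<in>I. a i vs)"
  by (induction I rule: infinite_finite_induct) (auto intro: alternating_zero alternating_add)

text \<open>The factorials in \<open>wedge_with\<close> cancel those of
  \<open>shuffle_permutations\<close>. This is where wedge products pass from permutations to the
  list recursion.\<close>

lemma wedge_with_eq_shuffle:
  assumes "\<And>zs. alternating k (\<lambda>ys. B p (\<alpha> p ys) (\<beta> p zs))" "\<And>ys. alternating l (\<lambda>zs. B p (\<alpha> p ys) (\<beta> p zs))"
  shows "wedge_with B k l \<alpha> \<beta> p = shuffle (\<lambda>ys zs. B p (\<alpha> p ys) (\<beta> p zs))"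
proof
  fix vs
  show "wedge_with B k l \<alpha> \<beta> p vs = shuffle (\<lambda>ys zs. B p (\<alpha> p ys) (\<beta> p zs)) vs"
  proof (cases "length vs = k + l")
    case True
    then show ?thesis
      using shuffle_permutations[of k "\<lambda>ys zs. B p (\<alpha> p ys) (\<beta> p zs)", OF assms True]
      by (simp add: wedge_with_def)
  next
    case False
    then show ?thesis
      using alternating_length[OF alternating_shuffle[of k "\<lambda>ys zs. B p (\<alpha> p ys) (\<beta> p zs)", OF assms]]
      by (simp add: wedge_with_def)
  qed
qed

section \<open>Evaluation on symplectic bases\<close>

lemma slot_linear_append:
  assumes "slot_linear a" shows "linear (\<lambda>u. a (ps @ u # qs))"
  using slot_linearD[OF assms, of "length ps" "ps @ undefined # qs"] by simp

lemma slot_linear_eq_zero: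
  assumes a: "slot_linear a" and B: "span B = UNIV" and 0: "\<And>vs. set vs \<subseteq> B \<Longrightarrow> a vs = 0"
  shows "a vs = 0"
proof -
  \<comment> \<open>The tail \<open>qs\<close> holds the slots already reduced to vectors of
    \<open>B\<close>; the reduction proceeds from the last slot to the first.\<close>
  have "\<forall>qs. set qs \<subseteq> B \<longrightarrow> a (vs @ qs) = 0"
  proof (induction vs rule: rev_induct)
    case Nil
    then show ?case using 0 by simp
  next
    case (snoc x xs)
    show ?case
    proof (intro allI impI)
      fix qs assume qs: "set qs \<subseteq> B"
      have lin: "linear (\<lambda>u. a (xs @ u # qs))" by (rule slot_linear_append[OF a])
      have "x \<in> span B" using B by simp
      then have "a (xs @ x # qs) = 0"
      proof (induction rule: span_induct_alt)
        case base
        then show ?case using linear_0[OF lin] by simp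
      next
        case (step c y z)
        have "a (xs @ y # qs) = 0" using snoc[rule_format, of "y # qs"] qs step by simp
        then show ?case using linear_add[OF lin] linear_cmul[OF lin] step by simp
      qed
      then show "a ((xs @ [x]) @ qs) = 0" by simp
    qed
  qed
  then show ?thesis by (metis append_Nil2 empty_subsetI list.set(1))
qed

text \<open>A rearrangement changes the value only by a sign, which does not affect vanishing;
  multisets express the rearrangement without naming a permutation.\<close>

lemma antisym_list_mset_zero:
  "antisym_list a \<Longrightarrow> mset vs = mset es \<Longrightarrow> a es = 0 \<Longrightarrow> a vs = 0"
proof (induction vs arbitrary: a es)
  case (Cons v vs)
  then have "v \<in> set es" by (metis list.set_intros(1) mset_eq_setD)
  then obtain xs ys where es: "es = xs @ v # ys" by (meson split_list)
  then have "es = insert_at (length xs) v (xs @ ys)" by (simp add: insert_at_def)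
  then have "a es = (-1) ^ length xs *\<^sub>R a (v # xs @ ys)"
    using Cons.prems(1) unfolding antisym_list_def by (metis le_add1 length_append)
  then have "a (v # xs @ ys) = 0" using Cons.prems(3) by simp
  moreover have "mset vs = mset (xs @ ys)" using Cons.prems(2) es by simp
  ultimately show ?case
    using Cons.IH[OF antisym_list_Cons[OF Cons.prems(1)]] by blast
qed simp

lemma alternating_distinct: "alternating k a \<Longrightarrow> \<not> distinct vs \<Longrightarrow> a vs = 0"
proof (cases "length vs = k")
  case True
  assume a: "alternating k a" and "\<not> distinct vs"
  then obtain i j where "i < length vs" "j < length vs" "i \<noteq> j" "vs ! i = vs ! j"
    by (auto simp: distinct_conv_nth)
  then obtain i j where "i < j" "j < length vs" "vs ! i = vs ! j"
    by (metis nat_neq_iff)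
  then show "a vs = 0" using a True unfolding alternating_def by blast
qed (simp add: alternating_def)

lemma alternating_top_zero:
  assumes a: "alternating (length es) a" and es: "distinct es" "span (set es) = UNIV" and 0: "a es = 0"
  shows "a vs = 0"
proof (rule slot_linear_eq_zero[OF alternating_slot_linear[OF a] es(2)])
  fix vs assume vs: "set vs \<subseteq> set es"
  show "a vs = 0"
  proof (cases "distinct vs \<and> length vs = length es")
    case True
    then have "set vs = set es"
      using vs es by (intro card_subset_eq) (auto simp: distinct_card)
    then have "mset vs = mset es" using True es by (simp add: set_eq_iff_mset_eq_distinct)
    then show ?thesis using antisym_list_mset_zero[OF alternating_antisym_list[OF a]] 0 by blast
  next
    case False
    then show ?thesis using alternating_distinct[OF a] alternating_length[OF a] by blast
  qed
qed

text \<open>A list of \<open>k\<close> vectors from a basis of k + 2 leaves at least two of them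
  out. In \<open>end_wedge_nondegenerate\<close> these two are the arguments given to a
  2-form.\<close>

lemma alternating_codim2_zero:
  assumes a: "alternating k a" and B: "finite B" "card B = k + 2" "span B = UNIV"
    and 0: "\<And>x y vs. x \<in> B \<Longrightarrow> y \<in> B \<Longrightarrow> x \<noteq> y \<Longrightarrow> set vs \<subseteq> B - {x, y} \<Longrightarrow> length vs = k \<Longrightarrow> a vs = 0"
  shows "a vs = 0"
proof (rule slot_linear_eq_zero[OF alternating_slot_linear[OF a] B(3)])
  fix vs assume vs: "set vs \<subseteq> B"
  show "a vs = 0"
  proof (cases "length vs = k")
    case True
    have "card (B - set vs) \<ge> 2"
      using card_length[of vs] True B vs by (simp add: card_Diff_subset)
    then obtain C where C: "C \<subseteq> B - set vs" "card C = 2"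
      by (meson obtain_subset_with_card_n)
    then obtain x y where "C = {x, y}" "x \<noteq> y" by (meson card_2_iff)
    then show ?thesis using 0[of x y vs] C vs True by blast
  next
    case False
    then show ?thesis using alternating_length[OF a] by blast
  qed
qed

section \<open>Powers of a symplectic form on hyperbolic pairs\<close>

text \<open>For \<open>w\<close> = \<omega> at a point this is the Lefschetz operator. The second
  factor has values in any real vector space, because the operator acts on real forms and on
  fibre-valued ones.\<close>

definition wedge2 :: "('v list \<Rightarrow> real) \<Rightarrow> ('v list \<Rightarrow> 'r::real_vector) \<Rightarrow> 'v list \<Rightarrow> 'r" where
  "wedge2 w \<theta> = shuffle (\<lambda>ys zs. w ys *\<^sub>R \<theta> zs)"

lemma shuffle_Nil: "shuffle (\<lambda>ys zs. if ys = [] then f zs else 0) r = f r"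
proof (induction r arbitrary: f)
  case (Cons x r)
  have "shuffle (\<lambda>ys zs. (-1) ^ length ys *\<^sub>R (if ys = [] then f (x # zs) else 0)) r
      = shuffle (\<lambda>ys zs. if ys = [] then f (x # zs) else 0) r"
    by (rule shuffle_cong) simp
  then show ?case using Cons.IH[of "\<lambda>zs. f (x # zs)"] by simp
qed simp

lemma wedge2_cong:
  "(\<And>zs. set zs \<subseteq> set r \<Longrightarrow> \<theta> zs = \<theta>' zs) \<Longrightarrow> wedge2 w \<theta> r = wedge2 w \<theta>' r"
  unfolding wedge2_def by (rule shuffle_cong) simp

lemma wedge2_add: "wedge2 w (\<lambda>zs. \<theta> zs + \<theta>' zs) r = wedge2 w \<theta> r + wedge2 w \<theta>' r"
  by (simp add: wedge2_def scaleR_right_distrib shuffle_add)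

lemma wedge2_scaleR: "wedge2 w (\<lambda>zs. c *\<^sub>R \<theta> zs) r = c *\<^sub>R wedge2 w \<theta> r"
  by (simp add: wedge2_def scaleR_left_commute[of _ c] shuffle_scaleR del: scaleR_scaleR)

text \<open>\<open>w\<close> pairs \<open>u\<close> and \<open>v\<close> with each other but with
  nothing in \<open>r\<close>. So either \<open>w\<close> takes both, with value 1, or \<theta>
  takes both; the mixed terms vanish.\<close>

lemma wedge2_pair:
  assumes w: "alternating 2 w" and uv: "w [u, v] = 1" and r: "\<And>x. x \<in> set r \<Longrightarrow> w [u, x] = 0 \<and> w [v, x] = 0"
  shows "wedge2 w \<theta> (u # v # r) = \<theta> r + wedge2 w (\<lambda>zs. \<theta> (u # v # zs)) r"
proof -
  have 1: "w (u # ys) = 0" "w (v # ys) = 0" if "set ys \<subseteq> set r" for ys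
  proof -
    have "w (u # ys) = 0 \<and> w (v # ys) = 0"
    proof (cases "length ys = 1")
      case True
      then obtain x where "ys = [x]" by (metis One_nat_def length_0_conv length_Suc_conv)
      then show ?thesis using r that by simp
    next
      case False
      then show ?thesis using alternating_length[OF w] by simp
    qed
    then show "w (u # ys) = 0" "w (v # ys) = 0" by auto
  qed
  have "shuffle (\<lambda>ys zs. w (u # v # ys) *\<^sub>R \<theta> zs) r = shuffle (\<lambda>ys zs. if ys = [] then \<theta> zs else 0) r"
    by (rule shuffle_cong) (auto simp: uv alternating_length[OF w])
  moreover have "shuffle (\<lambda>ys zs. (-1) ^ length ys *\<^sub>R w (u # ys) *\<^sub>R \<theta> (v # zs)) r = shuffle (\<lambda>_ _. 0) r"
    by (rule shuffle_cong) (simp add: 1)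
  moreover have "shuffle (\<lambda>ys zs. (-1) ^ length (v # ys) *\<^sub>R w (v # ys) *\<^sub>R \<theta> (u # zs)) r = shuffle (\<lambda>_ _. 0) r"
    by (rule shuffle_cong) (simp add: 1)
  moreover have "shuffle (\<lambda>ys zs. (-1) ^ length ys *\<^sub>R (-1) ^ length ys *\<^sub>R w ys *\<^sub>R \<theta> (u # v # zs)) r
      = shuffle (\<lambda>ys zs. w ys *\<^sub>R \<theta> (u # v # zs)) r"
    by (rule shuffle_cong) (simp flip: power_mult_distrib)
  ultimately show ?thesis
    unfolding wedge2_def shuffle.simps by (simp add: shuffle_Nil)
qed

text \<open>Here w = \<epsilon> + w', where \<epsilon> is the area form of the plane of
  \<open>u\<close> and \<open>v\<close> and \<epsilon>^2 = 0. Hence w^k = k \<epsilon> w'^(k-1) +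
  w'^k.\<close>

lemma wedge2_iter_pair:
  assumes w: "alternating 2 w" and uv: "w [u, v] = 1" and r: "\<And>x. x \<in> set r \<Longrightarrow> w [u, x] = 0 \<and> w [v, x] = 0"
  shows "(wedge2 w ^^ k) \<theta> (u # v # r) = real k *\<^sub>R (wedge2 w ^^ (k - 1)) \<theta> r + (wedge2 w ^^ k) (\<lambda>zs. \<theta> (u # v # zs)) r"
  using r
proof (induction k arbitrary: r)
  case (Suc k)
  have "(wedge2 w ^^ Suc k) \<theta> (u # v # r) = (wedge2 w ^^ k) \<theta> r + wedge2 w (\<lambda>zs. (wedge2 w ^^ k) \<theta> (u # v # zs)) r"
    using wedge2_pair[OF w uv, of r "(wedge2 w ^^ k) \<theta>"] Suc.prems by simp
  also have "wedge2 w (\<lambda>zs. (wedge2 w ^^ k) \<theta> (u # v # zs)) r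
      = wedge2 w (\<lambda>zs. real k *\<^sub>R (wedge2 w ^^ (k - 1)) \<theta> zs + (wedge2 w ^^ k) (\<lambda>zs. \<theta> (u # v # zs)) zs) r"
    by (rule wedge2_cong, rule Suc.IH) (use Suc.prems in blast)
  also have "\<dots> = real k *\<^sub>R wedge2 w ((wedge2 w ^^ (k - 1)) \<theta>) r + (wedge2 w ^^ Suc k) (\<lambda>zs. \<theta> (u # v # zs)) r"
    by (simp add: wedge2_add wedge2_scaleR)
  \<comment> \<open>For k = 0 the truncated exponent k - 1 does no harm, since the coefficient is
    0.\<close>
  also have "real k *\<^sub>R wedge2 w ((wedge2 w ^^ (k - 1)) \<theta>) r = real k *\<^sub>R (wedge2 w ^^ k) \<theta> r"
    by (cases k) auto
  finally show ?case by (simp add: scaleR_left_distrib)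
qed simp

fun flat :: "('v \<times> 'v) list \<Rightarrow> 'v list" where
  "flat [] = []"
| "flat ((u, v) # ps) = u # v # flat ps"

text \<open>Orthogonality is recorded towards later pairs only, in accordance with inductions that
  peel off the first pair.\<close>

fun symplectic_pairs :: "('v list \<Rightarrow> real) \<Rightarrow> ('v \<times> 'v) list \<Rightarrow> bool" where
  "symplectic_pairs w [] = True"
| "symplectic_pairs w ((u, v) # ps) \<longleftrightarrow> w [u, v] = 1 \<and>
     (\<forall>x\<in>set (flat ps). w [u, x] = 0 \<and> w [v, x] = 0) \<and> symplectic_pairs w ps"

text \<open>For a 4-form this is half of its double contraction: one term for each two distinct
  pairs.\<close>

fun pairs_sum :: "('v list \<Rightarrow> 'r::real_vector) \<Rightarrow> ('v \<times> 'v) list \<Rightarrow> 'r" where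
  "pairs_sum \<theta> [] = 0"
| "pairs_sum \<theta> ((u, v) # ps) = (\<Sum>(u', v')\<leftarrow>ps. \<theta> [u, v, u', v']) + pairs_sum \<theta> ps"

lemma length_flat [simp]: "length (flat ps) = 2 * length ps"
  by (induction ps rule: flat.induct) auto

definition unit_form :: "'v list \<Rightarrow> real" where
  "unit_form zs = (if zs = [] then 1 else 0)"

lemma wedge2_zero [simp]: "wedge2 w (\<lambda>zs. 0) = (\<lambda>r. 0)"
  by (simp add: wedge2_def fun_eq_iff)

lemma wedge2_iter_zero [simp]: "(wedge2 w ^^ k) (\<lambda>zs. 0) = (\<lambda>zs. 0)"
  by (induction k) auto

lemma wedge2_iter_scaleR: "(wedge2 w ^^ k) (\<lambda>zs. c *\<^sub>R \<theta> zs) = (\<lambda>zs. c *\<^sub>R (wedge2 w ^^ k) \<theta> zs)"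
proof (induction k)
  case (Suc k)
  have "(wedge2 w ^^ Suc k) (\<lambda>zs. c *\<^sub>R \<theta> zs) = wedge2 w (\<lambda>zs. c *\<^sub>R (wedge2 w ^^ k) \<theta> zs)"
    using Suc by simp
  then show ?case by (simp add: wedge2_scaleR fun_eq_iff)
qed simp

context
  fixes w :: "'v::real_vector list \<Rightarrow> real"
  assumes w: "alternating 2 w"
begin

lemma wedge2_iter_pairs_0:
  "symplectic_pairs w ps \<Longrightarrow> (wedge2 w ^^ length ps) unit_form (flat ps) = fact (length ps)"
proof (induction ps rule: flat.induct)
  case 1
  then show ?case by (simp add: unit_form_def)
next
  case (2 u v ps)
  have "(\<lambda>zs. unit_form (u # v # zs)) = (\<lambda>zs. 0)" by (simp add: unit_form_def)
  \<comment> \<open>The exponent in the instance is one more than the length of \<open>ps\<close>.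
    As \<open>unit_form\<close> cannot absorb a pair, only the first term of the recursion
    survives.\<close>
  then show ?case
    using 2 wedge2_iter_pair[OF w, of u v "flat ps" "length (u # [v]) + length ps - 1" unit_form] by simp
qed

text \<open>The first pair is absorbed either by \<theta>, which leaves a top power of
  \<open>w\<close> on the remaining pairs, or by one of the \<open>k\<close> factors
  \<open>w\<close>, which leaves a shorter instance of the same kind.\<close>

lemma wedge2_iter_pairs_2:
  fixes \<theta> :: "'v list \<Rightarrow> real"
  assumes "symplectic_pairs w ps" "length ps = Suc k" "\<And>vs. length vs \<noteq> 2 \<Longrightarrow> \<theta> vs = 0"
  shows "(wedge2 w ^^ k) \<theta> (flat ps) = fact k * (\<Sum>(u, v)\<leftarrow>ps. \<theta> [u, v])"
  using assms(1,2)
proof (induction ps arbitrary: k rule: flat.induct)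
  case (2 u v ps)
  have th: "(\<lambda>zs. \<theta> (u # v # zs)) = (\<lambda>zs. \<theta> [u, v] *\<^sub>R unit_form zs)"
    using assms(3) by (auto simp: unit_form_def fun_eq_iff)
  have "(wedge2 w ^^ k) (\<lambda>zs. \<theta> (u # v # zs)) (flat ps) = \<theta> [u, v] * fact k"
    unfolding th wedge2_iter_scaleR using wedge2_iter_pairs_0[of ps] 2 by simp
  moreover have "real k * (wedge2 w ^^ (k - 1)) \<theta> (flat ps) = fact k * (\<Sum>(u, v)\<leftarrow>ps. \<theta> [u, v])"
  proof (cases k)
    case 0
    then show ?thesis using 2 by simp
  next
    case (Suc l)
    then show ?thesis using 2 by simp
  qed
  ultimately show ?case
    using wedge2_iter_pair[OF w, of u v "flat ps" k \<theta>] 2 by (simp add: algebra_simps)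
qed simp

text \<open>The same peeling: if the first pair fills two slots of \<theta>, a 2-form remains and
  \<open>wedge2_iter_pairs_2\<close> applies.\<close>

lemma wedge2_iter_pairs_4:
  fixes \<theta> :: "'v list \<Rightarrow> real"
  assumes "symplectic_pairs w ps" "length ps = k + 2" "\<And>vs. length vs \<noteq> 4 \<Longrightarrow> \<theta> vs = 0"
  shows "(wedge2 w ^^ k) \<theta> (flat ps) = fact k * pairs_sum \<theta> ps"
  using assms(1,2)
proof (induction ps arbitrary: k rule: flat.induct)
  case (2 u v ps)
  have "(wedge2 w ^^ k) (\<lambda>zs. \<theta> (u # v # zs)) (flat ps) = fact k * (\<Sum>(u', v')\<leftarrow>ps. \<theta> [u, v, u', v'])"
    by (rule wedge2_iter_pairs_2) (use 2 assms(3) in auto)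
  moreover have "real k * (wedge2 w ^^ (k - 1)) \<theta> (flat ps) = fact k * pairs_sum \<theta> ps"
  proof (cases k)
    case 0
    then obtain q where "ps = [q]" using 2 by (metis One_nat_def Suc_1 add_0 length_0_conv length_Cons length_Suc_conv nat.inject)
    then show ?thesis using 0 by (cases q) simp
  next
    case (Suc l)
    then show ?thesis using 2 by simp
  qed
  ultimately show ?case
    using wedge2_iter_pair[OF w, of u v "flat ps" k \<theta>] 2 by (simp add: algebra_simps)
qed simp

text \<open>A form of even degree commutes with everything, so \<open>w\<close> moves to the front
  past the first slot of \<open>T\<close>; associativity does the rest.\<close>

lemma shuffle_wedge2_commute:
  fixes T :: "'v list \<Rightarrow> 'v list \<Rightarrow> real"
  shows "shuffle (\<lambda>ys us. wedge2 w (T ys) us) xs = wedge2 w (shuffle T) xs"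
proof -
  have "shuffle (\<lambda>ys us. wedge2 w (T ys) us) xs
      = shuffle (\<lambda>us ws. shuffle (\<lambda>ys zs. w zs *\<^sub>R T ys ws) us) xs"
    unfolding wedge2_def by (rule shuffle_assoc)
  also have "\<dots> = shuffle (\<lambda>us ws. shuffle (\<lambda>ys zs. w ys *\<^sub>R T zs ws) us) xs"
  proof (rule shuffle_cong)
    fix us ws
    have "shuffle (\<lambda>ys zs. w zs *\<^sub>R T ys ws) us = shuffle (\<lambda>ys zs. (-1) ^ (length ys * length zs) *\<^sub>R (w ys *\<^sub>R T zs ws)) us"
      by (rule shuffle_commute)
    also have "\<dots> = shuffle (\<lambda>ys zs. w ys *\<^sub>R T zs ws) us"
    proof (rule shuffle_cong)
      fix ys zs
      show "(-1) ^ (length ys * length zs) *\<^sub>R (w ys *\<^sub>R T zs ws) = w ys *\<^sub>R T zs ws"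
        using alternating_length[OF w, of ys] by (cases "length ys = 2") auto
    qed
    finally show "shuffle (\<lambda>ys zs. w zs *\<^sub>R T ys ws) us = shuffle (\<lambda>ys zs. w ys *\<^sub>R T zs ws) us" .
  qed
  also have "\<dots> = shuffle (\<lambda>ys us. shuffle (\<lambda>zs ws. w ys *\<^sub>R T zs ws) us) xs"
    by (rule shuffle_assoc[symmetric])
  also have "\<dots> = wedge2 w (shuffle T) xs"
    by (simp add: wedge2_def shuffle_mult)
  finally show ?thesis .
qed

lemma shuffle_wedge2_iter:
  fixes T :: "'v list \<Rightarrow> 'v list \<Rightarrow> real"
  shows "shuffle (\<lambda>ys us. (wedge2 w ^^ k) (T ys) us) = (wedge2 w ^^ k) (shuffle T)"
proof (induction k arbitrary: T)
  case (Suc k)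
  have "shuffle (\<lambda>ys us. (wedge2 w ^^ Suc k) (T ys) us) = shuffle (\<lambda>ys us. wedge2 w ((wedge2 w ^^ k) (T ys)) us)"
    by simp
  also have "\<dots> = wedge2 w (shuffle (\<lambda>ys us. (wedge2 w ^^ k) (T ys) us))"
    by (rule ext) (rule shuffle_wedge2_commute)
  finally show ?case using Suc.IH by simp
qed simp

lemma alternating_wedge2: "alternating k \<theta> \<Longrightarrow> alternating (2 + k) (wedge2 w \<theta>)"
  unfolding wedge2_def
  by (rule alternating_shuffle) (auto intro: alternating_scaleR_left[OF w] alternating_scaleR)

lemma alternating_wedge2_iter: "alternating l \<theta> \<Longrightarrow> alternating (2 * k + l) ((wedge2 w ^^ k) \<theta>)"
proof (induction k)
  case (Suc k)
  have "alternating (2 + (2 * k + l)) (wedge2 w ((wedge2 w ^^ k) \<theta>))"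
    by (rule alternating_wedge2) (use Suc in simp)
  then show ?case by simp
qed simp

lemma alternating_unit_form: "alternating 0 (unit_form :: 'v list \<Rightarrow> real)"
  by (simp add: alternating_def unit_form_def)

end

section \<open>The double contraction of a product of two 2-forms\<close>

lemma sum_lessThan_add_split:
  fixes f :: "nat \<Rightarrow> 'a::comm_monoid_add"
  shows "(\<Sum>i<n + m. f i) = (\<Sum>i<n. f i) + (\<Sum>i<m. f (n + i))"
  by (induction m) (auto simp: add.assoc)

lemma sum_pairs_symmetric:
  fixes h :: "nat \<Rightarrow> nat \<Rightarrow> real"
  shows "(\<Sum>j<n. \<Sum>i<n. h i j) = (\<Sum>j<n. \<Sum>i<j. h i j + h j i) + (\<Sum>j<n. h j j)"
proof (induction n)
  case (Suc n)
  have "(\<Sum>j<Suc n. \<Sum>i<Suc n. h i j) = (\<Sum>j<n. \<Sum>i<n. h i j) + (\<Sum>j<n. h n j) + (\<Sum>i<n. h i n) + h n n"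
    by (simp add: sum.distrib)
  then show ?case using Suc by (simp add: sum.distrib)
qed simp

lemma sum_card2:
  fixes g :: "nat list \<Rightarrow> real"
  shows "(\<Sum>I | I \<subseteq> {..<N} \<and> card I = 2. g (sorted_list_of_set I)) = (\<Sum>b<N. \<Sum>a<b. g [a, b])"
proof -
  have s: "sorted_list_of_set {a, b} = [a, b]" if "a < b" for a b :: nat
    using that sorted_list_of_set.idem_if_sorted_distinct[of "[a, b]"] by simp
  have "(\<Sum>b<N. \<Sum>a<b. g [a, b]) = (\<Sum>z\<in>Sigma {..<N} (\<lambda>b. {..<b}). g [snd z, fst z])"
    by (subst sum.Sigma) (auto simp: case_prod_beta)
  also have "\<dots> = (\<Sum>I | I \<subseteq> {..<N} \<and> card I = 2. g (sorted_list_of_set I))"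
  proof (rule sum.reindex_bij_witness[where j="\<lambda>z. {snd z, fst z}" and i="\<lambda>I. (Max I, Min I)"])
    fix z assume "z \<in> Sigma {..<N} (\<lambda>b. {..<b})"
    then show "(Max {snd z, fst z}, Min {snd z, fst z}) = z" "{snd z, fst z} \<in> {I. I \<subseteq> {..<N} \<and> card I = 2}"
      "g (sorted_list_of_set {snd z, fst z}) = g [snd z, fst z]"
      by (cases z; auto simp: s)+
  next
    fix I assume "I \<in> {I. I \<subseteq> {..<N} \<and> card I = 2}"
    then obtain x y where "I = {x, y}" "x \<noteq> y" "x < N" "y < N" by (auto simp: card_2_iff)
    then show "{snd (Max I, Min I), fst (Max I, Min I)} = I" "(Max I, Min I) \<in> Sigma {..<N} (\<lambda>b. {..<b})"
      by auto
  qed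
  finally show ?thesis ..
qed

lemma pairs_sum_snoc:
  "pairs_sum \<theta> (ps @ [(u', v')]) = pairs_sum \<theta> ps + (\<Sum>(u, v)\<leftarrow>ps. \<theta> [u, v, u', v'])"
  by (induction ps rule: flat.induct) (auto simp: algebra_simps)

lemma pairs_sum_upt:
  "pairs_sum \<theta> (map (\<lambda>i. (f i, g i)) [0..<n]) = (\<Sum>j<n. \<Sum>i<j. \<theta> [f i, g i, f j, g j])"
proof (induction n)
  case (Suc n)
  have "(\<Sum>(u, v)\<leftarrow>map (\<lambda>i. (f i, g i)) [0..<n]. \<theta> [u, v, f n, g n]) = (\<Sum>i<n. \<theta> [f i, g i, f n, g n])"
    by (simp add: comp_def interv_sum_list_conv_sum_set_nat atLeast0LessThan)
  then show ?case using Suc by (simp add: pairs_sum_snoc)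
qed simp

text \<open>Evaluated on a symplectic basis, \<open>\<alpha> \<and> \<beta> \<and> \<omega>\<^sup>(\<^sup>n\<^sup>-\<^sup>2\<^sup>)\<close> is \<open>\<Lambda>\<alpha> \<Lambda>\<beta> - \<langle>\<alpha>, \<beta>\<rangle>\<close>, where \<open>\<Lambda>\<close> is
  the contraction with \<open>\<omega>\<close>; here \<open>T\<close> stands for \<open>\<alpha> \<otimes> \<beta>\<close>.\<close>

lemma pairs_sum_shuffle:
  fixes T :: "'v::real_vector list \<Rightarrow> 'v list \<Rightarrow> real"
  assumes T1: "\<And>zs. alternating 2 (\<lambda>ys. T ys zs)" and T2: "\<And>ys. alternating 2 (T ys)"
  shows "pairs_sum (shuffle T) (map (\<lambda>i. (e i, e (n + i))) [0..<n]) =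
    (\<Sum>j<n. \<Sum>i<n. T [e i, e (n + i)] [e j, e (n + j)]) -
    (\<Sum>I | I \<subseteq> {..<2 * n} \<and> card I = 2. T (map e (sorted_list_of_set I)) (map (J_frame n e) (sorted_list_of_set I)))"
proof -
  have z1: "T ys zs = 0" if "length ys \<noteq> 2" for ys zs using alternating_length[OF T1 that] .
  have z2: "T ys zs = 0" if "length zs \<noteq> 2" for ys zs using alternating_length[OF T2 that] .
  have sw1: "T [x, y] zs = - T [y, x] zs" for x y zs
    using alternating_swap[OF T1, of "[]" x y "[]" zs] by simp
  have sw2: "T ys [x, y] = - T ys [y, x]" for x y ys
    using alternating_swap[OF T2, of ys "[]" x y "[]"] by simp
  have m1: "T ys [- x, y] = - T ys [x, y]" for x y ys
    using linear_neg[OF slot_linear_append[OF alternating_slot_linear[OF T2], of ys "[]" "[y]"], of x] by simp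
  have m2: "T ys [x, - y] = - T ys [x, y]" for x y ys
    using linear_neg[OF slot_linear_append[OF alternating_slot_linear[OF T2], of ys "[x]" "[]"], of y] by simp
  define g where "g a b = T [e a, e b] [J_frame n e a, J_frame n e b]" for a b
  define TT where "TT i j = T [e i, e (n + i)] [e j, e (n + j)]" for i j
  \<comment> \<open>Of the six ways to split four arguments into two pairs, two belong to the
    product of contractions and four, rewritten through \<open>J_frame\<close>, to the inner
    product.\<close>
  have F: "shuffle T [e i, e (n + i), e j, e (n + j)] =
      TT i j + TT j i - (g i j + g i (n + j) + g j (n + i) + g (n + i) (n + j))" if "i < n" "j < n" for i j
  proof -
    have "shuffle T [e i, e (n + i), e j, e (n + j)] =
      T [e i, e (n + i)] [e j, e (n + j)] - T [e i, e j] [e (n + i), e (n + j)] + T [e i, e (n + j)] [e (n + i), e j]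
      + T [e (n + i), e j] [e i, e (n + j)] - T [e (n + i), e (n + j)] [e i, e j] + T [e j, e (n + j)] [e i, e (n + i)]"
      by (simp add: z1 z2)
    moreover have "g i j = T [e i, e j] [e (n + i), e (n + j)]" "g i (n + j) = - T [e i, e (n + j)] [e (n + i), e j]"
      "g (n + i) (n + j) = T [e (n + i), e (n + j)] [e i, e j]"
      using that by (auto simp: g_def J_frame_def m1 m2)
    moreover have "g j (n + i) = - T [e (n + i), e j] [e i, e (n + j)]"
      using that sw1[of "e j" "e (n + i)"] sw2[of "[e (n + i), e j]" "e (n + j)" "e i"]
      by (simp add: g_def J_frame_def m2)
    ultimately show ?thesis by (simp add: TT_def)
  qed
  \<comment> \<open>The product of contractions also has terms with i = j, which
    \<open>pairs_sum\<close> lacks. They equal the summands of the inner product for the index sets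
    {j, n + j} and cancel in the difference.\<close>
  have D: "TT j j = g j (n + j)" if "j < n" for j
    using that sw2[of "[e j, e (n + j)]" "e (n + j)" "e j"] by (simp add: TT_def g_def J_frame_def m2)
  have "(\<Sum>I | I \<subseteq> {..<2 * n} \<and> card I = 2. T (map e (sorted_list_of_set I)) (map (J_frame n e) (sorted_list_of_set I)))
      = (\<Sum>b<2 * n. \<Sum>a<b. g a b)"
    unfolding g_def using sum_card2[of "\<lambda>xs. T (map e xs) (map (J_frame n e) xs)" "2 * n"] by simp
  also have "\<dots> = (\<Sum>b<n. \<Sum>a<b. g a b) + (\<Sum>j<n. \<Sum>a<n + j. g a (n + j))"
    by (simp only: mult_2 sum_lessThan_add_split[of _ n n])
  also have "(\<Sum>j<n. \<Sum>a<n + j. g a (n + j)) = (\<Sum>j<n. (\<Sum>i<n. g i (n + j)) + (\<Sum>i<j. g (n + i) (n + j)))"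
    by (simp add: sum_lessThan_add_split)
  also have "\<dots> = (\<Sum>j<n. \<Sum>i<n. g i (n + j)) + (\<Sum>j<n. \<Sum>i<j. g (n + i) (n + j))"
    by (simp add: sum.distrib)
  also have "(\<Sum>j<n. \<Sum>i<n. g i (n + j)) = (\<Sum>j<n. \<Sum>i<j. g i (n + j) + g j (n + i)) + (\<Sum>j<n. g j (n + j))"
    by (rule sum_pairs_symmetric)
  finally have P: "(\<Sum>I | I \<subseteq> {..<2 * n} \<and> card I = 2. T (map e (sorted_list_of_set I)) (map (J_frame n e) (sorted_list_of_set I)))
     = (\<Sum>j<n. \<Sum>i<j. g i j + g i (n + j) + g j (n + i) + g (n + i) (n + j)) + (\<Sum>j<n. g j (n + j))"
    by (simp add: sum.distrib)
  have L: "(\<Sum>j<n. \<Sum>i<n. TT i j) = (\<Sum>j<n. \<Sum>i<j. TT i j + TT j i) + (\<Sum>j<n. g j (n + j))"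
    using sum_pairs_symmetric[of TT n] D by simp
  have "pairs_sum (shuffle T) (map (\<lambda>i. (e i, e (n + i))) [0..<n])
      = (\<Sum>j<n. \<Sum>i<j. TT i j + TT j i - (g i j + g i (n + j) + g j (n + i) + g (n + i) (n + j)))"
    unfolding pairs_sum_upt by (intro sum.cong refl F) auto
  then show ?thesis
    unfolding P using L by (simp add: TT_def sum_subtractf)
qed

section \<open>Symplectic bases\<close>

lemma family_independentI:
  fixes e :: "nat \<Rightarrow> 'w::real_vector"
  assumes "\<And>c. (\<Sum>i<r. c i *\<^sub>R e i) = 0 \<Longrightarrow> \<forall>i<r. c i = 0"
  shows "inj_on e {..<r} \<and> independent (e ` {..<r})"
proof
  show inj: "inj_on e {..<r}"
  proof (rule inj_onI, rule ccontr)
    fix i j assume ij: "i \<in> {..<r}" "j \<in> {..<r}" "e i = e j" "i \<noteq> j"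
    let ?c = "\<lambda>k. (if k = i then 1 else 0) - (if k = j then 1 else 0) :: real"
    have "(\<Sum>k<r. ?c k *\<^sub>R e k) = (\<Sum>k<r. (if k = i then e i else 0) - (if k = j then e j else 0))"
      by (intro sum.cong) (auto simp: ij)
    also have "\<dots> = 0" using ij by (simp add: sum_subtractf)
    finally have "?c i = 0" using assms[of ?c] ij by blast
    then show False using ij by simp
  qed
  show "independent (e ` {..<r})"
  proof
    assume "dependent (e ` {..<r})"
    then obtain u where u: "\<exists>v\<in>e ` {..<r}. u v \<noteq> 0" "(\<Sum>v\<in>e ` {..<r}. u v *\<^sub>R v) = 0"
      by (auto simp: dependent_finite)
    have "(\<Sum>i<r. u (e i) *\<^sub>R e i) = 0" using u(2) by (simp add: sum.reindex[OF inj])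
    then show False using assms[of "\<lambda>i. u (e i)"] u(1) by auto
  qed
qed

lemma basis_family_coeff_zero:
  assumes "basis_family r V e" "(\<Sum>i<r. c i *\<^sub>R e i) = 0" "i < r"
  shows "c i = 0"
proof (rule ccontr)
  assume "c i \<noteq> 0"
  have inj: "inj_on e {..<r}" and ind: "independent (e ` {..<r})"
    using assms(1) by (auto simp: basis_family_def)
  define u where "u v = c (inv_into {..<r} e v)" for v
  have u: "u (e j) = c j" if "j < r" for j using that inj by (simp add: u_def)
  have "(\<Sum>v\<in>e ` {..<r}. u v *\<^sub>R v) = (\<Sum>i<r. c i *\<^sub>R e i)"
    by (simp add: sum.reindex[OF inj] u)
  then have "dependent (e ` {..<r})"
    using assms u \<open>c i \<noteq> 0\<close> by (auto simp: dependent_finite intro!: exI[of _ u])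
  then show False using ind by simp
qed

lemma basis_family_span:
  assumes "basis_family r V e" "x \<in> V"
  obtains c where "x = (\<Sum>i<r. c i *\<^sub>R e i)"
proof -
  have inj: "inj_on e {..<r}" and "x \<in> span (e ` {..<r})"
    using assms by (auto simp: basis_family_def)
  then obtain u where "x = (\<Sum>v\<in>e ` {..<r}. u v *\<^sub>R v)" by (auto simp: span_finite)
  then have "x = (\<Sum>i<r. u (e i) *\<^sub>R e i)" by (simp add: sum.reindex[OF inj])
  then show ?thesis using that[of "\<lambda>i. u (e i)"] by blast
qed

lemma basis_family_mem: "basis_family r V e \<Longrightarrow> i < r \<Longrightarrow> e i \<in> V"
  by (auto simp: basis_family_def intro: span_base)

section \<open>Construction of symplectic bases\<close>

text \<open>One setting for both symplectic spaces at a point: the tangent space, where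
  \<open>V\<close> is the whole type, and the fibre, a subspace outside of which nothing is known
  about \<beta>.\<close>

locale skew_space =
  fixes V :: "'w::real_vector set" and \<beta> :: "'w \<Rightarrow> 'w \<Rightarrow> real"
  assumes V: "subspace V"
    and skew: "x \<in> V \<Longrightarrow> y \<in> V \<Longrightarrow> \<beta> y x = - \<beta> x y"
    and lin: "x \<in> V \<Longrightarrow> y \<in> V \<Longrightarrow> z \<in> V \<Longrightarrow> \<beta> (s *\<^sub>R x + t *\<^sub>R y) z = s * \<beta> x z + t * \<beta> y z"
    and nondeg: "x \<in> V \<Longrightarrow> (\<And>y. y \<in> V \<Longrightarrow> \<beta> x y = 0) \<Longrightarrow> x = 0"
begin

lemma lin_right: "x \<in> V \<Longrightarrow> y \<in> V \<Longrightarrow> z \<in> V \<Longrightarrow> \<beta> z (s *\<^sub>R x + t *\<^sub>R y) = s * \<beta> z x + t * \<beta> z y"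
  using lin[of x y z s t] skew[of "s *\<^sub>R x + t *\<^sub>R y" z] skew[of x z] skew[of y z] V
  by (simp add: subspace_add subspace_mul)

lemma zero_left: "z \<in> V \<Longrightarrow> \<beta> 0 z = 0"
  using lin[of 0 0 z 0 0] V by (simp add: subspace_0)

lemma sum_left: "(\<And>i. i \<in> I \<Longrightarrow> g i \<in> V) \<Longrightarrow> z \<in> V \<Longrightarrow> \<beta> (\<Sum>i\<in>I. c i *\<^sub>R g i) z = (\<Sum>i\<in>I. c i * \<beta> (g i) z)"
proof (induction I rule: infinite_finite_induct)
  case (insert i I)
  have "(\<Sum>i\<in>I. c i *\<^sub>R g i) \<in> V" using insert V by (intro subspace_sum subspace_mul) auto
  then show ?case using insert lin[of "g i" "\<Sum>i\<in>I. c i *\<^sub>R g i" z "c i" 1] by simp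
qed (auto simp: zero_left)

lemma diff_left: "x \<in> V \<Longrightarrow> y \<in> V \<Longrightarrow> z \<in> V \<Longrightarrow> \<beta> (x - y) z = \<beta> x z - \<beta> y z"
  using lin[of x y z 1 "-1"] by simp

lemma add_left: "x \<in> V \<Longrightarrow> y \<in> V \<Longrightarrow> z \<in> V \<Longrightarrow> \<beta> (x + y) z = \<beta> x z + \<beta> y z"
  using lin[of x y z 1 1] by simp

lemma neg_left: "x \<in> V \<Longrightarrow> z \<in> V \<Longrightarrow> \<beta> (- x) z = - \<beta> x z"
  using lin[of x x z "-1" 0] by simp

definition partial_frame :: "nat \<Rightarrow> (nat \<Rightarrow> 'w) \<Rightarrow> (nat \<Rightarrow> 'w) \<Rightarrow> bool" where
  "partial_frame k u v \<longleftrightarrow> (\<forall>i<k. u i \<in> V \<and> v i \<in> V) \<and>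
     (\<forall>i<k. \<forall>j<k. \<beta> (u i) (u j) = 0 \<and> \<beta> (v i) (v j) = 0 \<and> \<beta> (u i) (v j) = (if i = j then 1 else 0))"

definition join :: "nat \<Rightarrow> (nat \<Rightarrow> 'w) \<Rightarrow> (nat \<Rightarrow> 'w) \<Rightarrow> nat \<Rightarrow> 'w" where
  "join k u v i = (if i < k then u i else v (i - k))"

lemma sum_join: "(\<Sum>i<2 * k. c i *\<^sub>R join k u v i) = (\<Sum>i<k. c i *\<^sub>R u i) + (\<Sum>i<k. c (k + i) *\<^sub>R v i)"
  unfolding mult_2 sum_lessThan_add_split by (simp add: join_def)

text \<open>Pairing a vanishing combination with \<open>v j\<close> isolates the coefficient of
  \<open>u j\<close>; pairing it with \<open>u j\<close> isolates that of \<open>v j\<close>, up to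
  sign.\<close>

lemma partial_frame_independent:
  assumes P: "partial_frame k u v"
  shows "inj_on (join k u v) {..<2 * k} \<and> independent (join k u v ` {..<2 * k})"
proof (rule family_independentI)
  fix c assume "(\<Sum>i<2 * k. c i *\<^sub>R join k u v i) = 0"
  then have 0: "(\<Sum>i<k. c i *\<^sub>R u i) + (\<Sum>i<k. c (k + i) *\<^sub>R v i) = 0" by (simp add: sum_join)
  have uv: "u i \<in> V" "v i \<in> V" if "i < k" for i using P that by (auto simp: partial_frame_def)
  have s: "(\<Sum>i<k. c i *\<^sub>R u i) \<in> V" "(\<Sum>i<k. c (k + i) *\<^sub>R v i) \<in> V"
    using V uv by (auto intro!: subspace_sum subspace_mul)
  have *: "\<beta> ((\<Sum>i<k. c i *\<^sub>R u i) + (\<Sum>i<k. c (k + i) *\<^sub>R v i)) z =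
      (\<Sum>i<k. c i * \<beta> (u i) z) + (\<Sum>i<k. c (k + i) * \<beta> (v i) z)" if "z \<in> V" for z
    using add_left[OF s that] sum_left[of "{..<k}" u z c] sum_left[of "{..<k}" v z "\<lambda>i. c (k + i)"] uv that by simp
  have "c j = 0" "c (k + j) = 0" if j: "j < k" for j
  proof -
    have "(\<Sum>i<k. c i * \<beta> (u i) (v j)) = (\<Sum>i<k. if i = j then c j else 0)"
      by (rule sum.cong[OF refl]) (use P j in \<open>auto simp: partial_frame_def\<close>)
    moreover have "(\<Sum>i<k. c (k + i) * \<beta> (v i) (v j)) = 0"
      by (rule sum.neutral) (use P j in \<open>auto simp: partial_frame_def\<close>)
    ultimately show "c j = 0" using *[of "v j"] uv[OF j] 0 j by (simp add: zero_left)
    have "\<beta> (v i) (u j) = - (if i = j then 1 else 0)" if "i < k" for i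
      using P j that skew[OF uv(1)[OF j] uv(2)[OF that]] by (auto simp: partial_frame_def)
    then have "(\<Sum>i<k. c (k + i) * \<beta> (v i) (u j)) = (\<Sum>i<k. if i = j then - c (k + j) else 0)"
      by (intro sum.cong[OF refl]) auto
    moreover have "(\<Sum>i<k. c i * \<beta> (u i) (u j)) = 0"
      by (rule sum.neutral) (use P j in \<open>auto simp: partial_frame_def\<close>)
    ultimately show "c (k + j) = 0" using *[of "u j"] uv[OF j] 0 j by (simp add: zero_left)
  qed
  then show "\<forall>i<2 * k. c i = 0"
    by (metis add_diff_inverse_nat mult_2 nat_add_left_cancel_less)
qed

text \<open>The projection to the symplectic complement of the frame: the subtracted vector lies in
  the span and has the same pairings with the frame as \<open>x\<close>.\<close>

definition orth_part :: "nat \<Rightarrow> (nat \<Rightarrow> 'w) \<Rightarrow> (nat \<Rightarrow> 'w) \<Rightarrow> 'w \<Rightarrow> 'w" where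
  "orth_part k u v x = x - ((\<Sum>i<k. \<beta> x (v i) *\<^sub>R u i) + (\<Sum>i<k. - \<beta> x (u i) *\<^sub>R v i))"

lemma orth_part:
  assumes P: "partial_frame k u v" and x: "x \<in> V"
  shows "orth_part k u v x \<in> V"
    and "z \<in> V \<Longrightarrow> \<beta> (orth_part k u v x) z = \<beta> x z - ((\<Sum>i<k. \<beta> x (v i) * \<beta> (u i) z) + (\<Sum>i<k. - \<beta> x (u i) * \<beta> (v i) z))"
    and "j < k \<Longrightarrow> \<beta> (orth_part k u v x) (u j) = 0"
    and "j < k \<Longrightarrow> \<beta> (orth_part k u v x) (v j) = 0"
proof -
  have uv: "u i \<in> V" "v i \<in> V" if "i < k" for i using P that by (auto simp: partial_frame_def)
  have s: "(\<Sum>i<k. \<beta> x (v i) *\<^sub>R u i) \<in> V" "(\<Sum>i<k. - \<beta> x (u i) *\<^sub>R v i) \<in> V"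
    using V uv by (auto intro!: subspace_sum subspace_mul subspace_neg)
  show "orth_part k u v x \<in> V"
    unfolding orth_part_def using V x s by (intro subspace_diff subspace_add)
  have *: "\<beta> (orth_part k u v x) z = \<beta> x z - ((\<Sum>i<k. \<beta> x (v i) * \<beta> (u i) z) + (\<Sum>i<k. - \<beta> x (u i) * \<beta> (v i) z))"
    if "z \<in> V" for z
    unfolding orth_part_def
    using diff_left[OF x _ that] add_left[OF s that] V s sum_left[of "{..<k}" u z "\<lambda>i. \<beta> x (v i)"]
      sum_left[of "{..<k}" v z "\<lambda>i. - \<beta> x (u i)"] uv that
    by (simp add: subspace_add)
  then show "z \<in> V \<Longrightarrow> \<beta> (orth_part k u v x) z = \<beta> x z - ((\<Sum>i<k. \<beta> x (v i) * \<beta> (u i) z) + (\<Sum>i<k. - \<beta> x (u i) * \<beta> (v i) z))" .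
  show "\<beta> (orth_part k u v x) (v j) = 0" if j: "j < k"
  proof -
    have "(\<Sum>i<k. \<beta> x (v i) * \<beta> (u i) (v j)) = (\<Sum>i<k. if i = j then \<beta> x (v j) else 0)"
      by (rule sum.cong[OF refl]) (use P j in \<open>auto simp: partial_frame_def\<close>)
    moreover have "(\<Sum>i<k. - \<beta> x (u i) * \<beta> (v i) (v j)) = 0"
      by (rule sum.neutral) (use P j in \<open>auto simp: partial_frame_def\<close>)
    ultimately show ?thesis using *[OF uv(2)[OF j]] j by simp
  qed
  show "\<beta> (orth_part k u v x) (u j) = 0" if j: "j < k"
  proof -
    have "\<beta> (v i) (u j) = - (if i = j then 1 else 0)" if "i < k" for i
      using P j that skew[OF uv(1)[OF j] uv(2)[OF that]] by (auto simp: partial_frame_def)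
    then have "(\<Sum>i<k. - \<beta> x (u i) * \<beta> (v i) (u j)) = (\<Sum>i<k. if i = j then \<beta> x (u j) else 0)"
      by (intro sum.cong[OF refl]) auto
    moreover have "(\<Sum>i<k. \<beta> x (v i) * \<beta> (u i) (u j)) = 0"
      by (rule sum.neutral) (use P j in \<open>auto simp: partial_frame_def\<close>)
    ultimately show ?thesis using *[OF uv(1)[OF j]] j by simp
  qed
qed

lemma independent_span_eq:
  assumes f: "basis_family r V f" and B: "independent B" "B \<subseteq> V" "card B = r" "finite B"
  shows "span B = V"
proof
  show "span B \<subseteq> V" using B(2) V by (metis span_mono span_eq_iff)
  show "V \<subseteq> span B"
  proof
    fix x assume x: "x \<in> V"
    show "x \<in> span B"
    proof (rule ccontr)
      assume nx: "x \<notin> span B"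
      then have "independent (insert x B)" using B(1) by (simp add: independent_insert)
      moreover have "insert x B \<subseteq> span (f ` {..<r})" using f B x by (auto simp: basis_family_def)
      ultimately have "card (insert x B) \<le> card (f ` {..<r})"
        using independent_span_bound[of "f ` {..<r}"] by blast
      also have "\<dots> \<le> r" using card_image_le[of "{..<r}" f] by simp
      finally show False using nx B by (metis card_insert_disjoint not_less_eq_eq order_refl span_base)
    qed
  qed
qed

text \<open>The symplectic Gram-Schmidt step. A dimension count gives \<open>x\<close> outside the
  span, so its projection \<open>y\<close> is not 0. Nondegeneracy gives a partner for
  \<open>y\<close>, which is rescaled and projected too; as \<open>y\<close> is orthogonal to the
  frame, the projection does not change their pairing.\<close>

lemma partial_frame_extend:
  assumes f: "basis_family (2 * n) V f" and P: "partial_frame k u v" and "k < n"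
  shows "\<exists>u v. partial_frame (Suc k) u v"
proof -
  let ?e = "join k u v ` {..<2 * k}"
  have "\<not> V \<subseteq> span ?e"
  proof
    assume "V \<subseteq> span ?e"
    then have "f ` {..<2 * n} \<subseteq> span ?e" using basis_family_mem[OF f] by auto
    then have "card (f ` {..<2 * n}) \<le> card ?e"
      using independent_span_bound[of ?e "f ` {..<2 * n}"] f by (auto simp: basis_family_def)
    also have "\<dots> \<le> 2 * k" using card_image_le[of "{..<2 * k}" "join k u v"] by simp
    finally show False using f \<open>k < n\<close> by (simp add: basis_family_def card_image)
  qed
  then obtain x where x: "x \<in> V" "x \<notin> span ?e" by blast
  have uv: "u i \<in> V" "v i \<in> V" if "i < k" for i using P that by (auto simp: partial_frame_def)
  define y where "y = orth_part k u v x"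
  note y = orth_part[OF P x(1), folded y_def]
  have "y \<noteq> 0"
  proof
    assume "y = 0"
    then have "x = (\<Sum>i<k. \<beta> x (v i) *\<^sub>R u i) + (\<Sum>i<k. - \<beta> x (u i) *\<^sub>R v i)"
      by (simp add: y_def orth_part_def)
    also have "\<dots> \<in> span ?e"
    proof (intro span_add span_sum span_scale span_base)
      fix i assume "i \<in> {..<k}"
      then have "u i = join k u v i" "i < 2 * k" "v i = join k u v (k + i)" "k + i < 2 * k" by (auto simp: join_def)
      then show "u i \<in> ?e" "v i \<in> ?e" by blast+
    qed
    finally show False using x by simp
  qed
  then obtain z0 where z0: "z0 \<in> V" "\<beta> y z0 \<noteq> 0" using nondeg y(1) by blast
  define z1 where "z1 = (1 / \<beta> y z0) *\<^sub>R z0"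
  have z1: "z1 \<in> V" using z0 V by (simp add: z1_def subspace_mul)
  have yz1: "\<beta> y z1 = 1" using lin_right[of z0 z0 y "1 / \<beta> y z0" 0] z0 y(1) by (simp add: z1_def)
  define z where "z = orth_part k u v z1"
  note z = orth_part[OF P z1, folded z_def]
  have uy: "\<beta> (u i) y = 0" "\<beta> (v i) y = 0" if "i < k" for i
    using skew[OF y(1) uv(1)[OF that]] skew[OF y(1) uv(2)[OF that]] y(3,4)[OF that] by auto
  have uz: "\<beta> (u i) z = 0" "\<beta> (v i) z = 0" if "i < k" for i
    using skew[OF z(1) uv(1)[OF that]] skew[OF z(1) uv(2)[OF that]] z(3,4)[OF that] by auto
  have "\<beta> z y = \<beta> z1 y" using z(2)[OF y(1)] uy by simp
  then have yz: "\<beta> y z = 1" using yz1 skew[OF y(1) z1] skew[OF z(1) y(1)] by simp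
  have self: "\<beta> y y = 0" "\<beta> z z = 0" using skew[OF y(1) y(1)] skew[OF z(1) z(1)] by auto
  have "partial_frame (Suc k) (u(k := y)) (v(k := z))"
    using P y z uy uz yz self uv
    unfolding partial_frame_def by (auto simp: less_Suc_eq)
  then show ?thesis by blast
qed

lemma symplectic_basis_exists:
  assumes f: "basis_family (2 * n) V f"
  shows "\<exists>e. symplectic_basis n V \<beta> e"
proof -
  have "\<exists>u v. partial_frame k u v" if "k \<le> n" for k
    using that
  proof (induction k)
    case 0
    then show ?case by (simp add: partial_frame_def)
  next
    case (Suc k)
    then show ?case using partial_frame_extend[OF f, of k] by auto
  qed
  then obtain u v where P: "partial_frame n u v" by blast
  let ?e = "join n u v"
  have i: "inj_on ?e {..<2 * n}" "independent (?e ` {..<2 * n})"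
    using partial_frame_independent[OF P] by auto
  have "?e ` {..<2 * n} \<subseteq> V" using P by (auto simp: partial_frame_def join_def)
  then have "span (?e ` {..<2 * n}) = V"
    using independent_span_eq[OF f i(2)] card_image[OF i(1)] by simp
  then have "basis_family (2 * n) V ?e" using i by (simp add: basis_family_def)
  then have "symplectic_basis n V \<beta> ?e"
    using P by (simp add: symplectic_basis_def partial_frame_def join_def)
  then show ?thesis by blast
qed

context
  fixes n e assumes e: "symplectic_basis n V \<beta> e"
begin

lemma symplectic_basis_mem: "i < 2 * n \<Longrightarrow> e i \<in> V"
  using e basis_family_mem by (auto simp: symplectic_basis_def)

lemma J_frame_mem: "i < 2 * n \<Longrightarrow> J_frame n e i \<in> V"
  using symplectic_basis_mem V by (auto simp: J_frame_def subspace_neg)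

text \<open>The vectors \<open>J_frame n e i\<close> form the \<beta>-dual basis. This explains the
  J in the frame sums and yields, through \<open>J_frame_dual\<close>, the covectors dual to the
  frame.\<close>

lemma symplectic_basis_J:
  assumes i: "i < 2 * n" and j: "j < 2 * n"
  shows "\<beta> (e j) (J_frame n e i) = (if i = j then 1 else 0)"
proof -
  note m = symplectic_basis_mem
  have E: "\<beta> (e a) (e c) = 0" "\<beta> (e (n + a)) (e (n + c)) = 0" "\<beta> (e a) (e (n + c)) = (if a = c then 1 else 0)"
    if "a < n" "c < n" for a c
    using e that by (auto simp: symplectic_basis_def)
  have neg: "\<beta> x (- y) = - \<beta> x y" if "x \<in> V" "y \<in> V" for x y
    using lin_right[of y y x "-1" 0] that by simp
  obtain a where a: "i = a \<and> a < n \<or> i = n + a \<and> a < n"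
    using i by (metis add_diff_inverse_nat mult_2 nat_add_left_cancel_less)
  obtain c where c: "j = c \<and> c < n \<or> j = n + c \<and> c < n"
    using j by (metis add_diff_inverse_nat mult_2 nat_add_left_cancel_less)
  have "\<beta> (e (n + c)) (e a) = - (if a = c then 1 else 0)" if "a < n" "c < n" for a c
    using skew[of "e a" "e (n + c)"] m E that by auto
  with a c show ?thesis
    using E m by (auto simp: J_frame_def neg)
qed

lemma J_frame_dual:
  assumes "i < 2 * n" "j < 2 * n"
  shows "\<beta> (- J_frame n e i) (e j) = (if i = j then 1 else 0)"
  using symplectic_basis_J[OF assms] skew[OF symplectic_basis_mem[OF assms(2)] J_frame_mem[OF assms(1)]]
    neg_left[OF J_frame_mem[OF assms(1)] symplectic_basis_mem[OF assms(2)]] by simp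

text \<open>Up to sign J permutes the frame, so a linear map is determined by its values on the
  J-images of the frame.\<close>

lemma J_frame_span:
  assumes "i < 2 * n"
  obtains j s where "j < 2 * n" "e i = s *\<^sub>R J_frame n e j"
proof (cases "i < n")
  case True
  then show ?thesis using that[of "n + i" "-1"] by (simp add: J_frame_def)
next
  case False
  then have "i - n < n" "n + (i - n) = i" using assms by auto
  then show ?thesis using that[of "i - n" 1] by (simp add: J_frame_def)
qed

end

end

lemma symplectic_pairs_basis:
  fixes w :: "'v::real_vector list \<Rightarrow> real"
  assumes w: "alternating 2 w" and e: "symplectic_basis n UNIV (\<lambda>u v. w [u, v]) e"
  shows "symplectic_pairs w (map (\<lambda>i. (e i, e (n + i))) [0..<n])"
proof -
  have E: "w [e a, e c] = 0" "w [e (n + a), e (n + c)] = 0" "w [e a, e (n + c)] = (if a = c then 1 else 0)"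
    if "a < n" "c < n" for a c
    using e that by (auto simp: symplectic_basis_def)
  have E': "w [e (n + a), e c] = - (if a = c then 1 else 0)" if "a < n" "c < n" for a c
    using alternating_swap[OF w, of "[]" "e (n + a)" "e c" "[]"] E that by auto
  have fl: "set (flat (map (\<lambda>i. (e i, e (n + i))) is)) = e ` set is \<union> (\<lambda>i. e (n + i)) ` set is" for "is"
    by (induction "is") auto
  \<comment> \<open>Generalised to distinct index lists, since a tail of \<open>[0..<n]\<close> no
    longer starts at 0.\<close>
  have "symplectic_pairs w (map (\<lambda>i. (e i, e (n + i))) is)" if "distinct is" "set is \<subseteq> {..<n}" for "is"
    using that
  proof (induction "is")
    case (Cons i "is")
    then show ?case using E E' by (auto simp: fl subset_iff)
  qed simp
  from this[of "[0..<n]"] show ?thesis by (simp add: atLeast0LessThan)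
qed

lemma flat_symplectic_basis:
  assumes e: "basis_family (2 * n) UNIV e"
  defines "es \<equiv> flat (map (\<lambda>i. (e i, e (n + i))) [0..<n])"
  shows "length es = 2 * n" "distinct es" "span (set es) = UNIV"
proof -
  have fl: "set (flat (map (\<lambda>i. (e i, e (n + i))) is)) = e ` set is \<union> (\<lambda>i. e (n + i)) ` set is" for "is"
    by (induction "is") auto
  have "{..<2 * n} = {..<n} \<union> (\<lambda>i. n + i) ` {..<n}"
    using image_add_atLeastLessThan[of n 0 n] by (simp add: lessThan_atLeast0 ivl_disj_un mult_2)
  then have s: "set es = e ` {..<2 * n}"
    by (simp only: es_def fl image_Un image_image set_upt lessThan_atLeast0)
  show l: "length es = 2 * n" by (simp add: es_def)
  show "distinct es"
    using e s l by (intro card_distinct) (simp add: basis_family_def card_image)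
  show "span (set es) = UNIV" using e s by (simp add: basis_family_def)
qed

lemma basis_family_Basis:
  assumes "DIM('v::euclidean_space) = r"
  shows "\<exists>f. basis_family r (UNIV :: 'v set) f"
proof -
  obtain f where "bij_betw f {0..<r} (Basis :: 'v set)"
    using ex_bij_betw_nat_finite[OF finite_Basis] assms by metis
  then have "inj_on f {..<r}" "f ` {..<r} = (Basis :: 'v set)"
    by (auto simp: bij_betw_def lessThan_atLeast0)
  then have "basis_family r (UNIV :: 'v set) f"
    by (simp add: basis_family_def independent_Basis)
  then show ?thesis by blast
qed

section \<open>Tensoriality and vector bundles\<close>

context smooth_manifold
begin

abbreviation smooth :: "('m \<Rightarrow> real) \<Rightarrow> bool" where "smooth \<equiv> smooth_fun_on A UNIV"

lemma smooth_const: "smooth (\<lambda>q. c)"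
  by (rule smooth_fun_on_const) simp

text \<open>Closure under C^\<infinity>(M)-combinations, so that the tensoriality argument is made
  once for vector fields and for sections of E.\<close>

definition smooth_module :: "('m \<Rightarrow> 'w::real_vector) set \<Rightarrow> bool" where
  "smooth_module S \<longleftrightarrow> (\<forall>X\<in>S. \<forall>Y\<in>S. (\<lambda>q. X q + Y q) \<in> S) \<and>
     (\<forall>h. \<forall>X\<in>S. smooth h \<longrightarrow> (\<lambda>q. h q *\<^sub>R X q) \<in> S)"

lemma smooth_module_add: "smooth_module S \<Longrightarrow> X \<in> S \<Longrightarrow> Y \<in> S \<Longrightarrow> (\<lambda>q. X q + Y q) \<in> S"
  by (simp add: smooth_module_def)

lemma smooth_module_scale: "smooth_module S \<Longrightarrow> smooth h \<Longrightarrow> X \<in> S \<Longrightarrow> (\<lambda>q. h q *\<^sub>R X q) \<in> S"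
  by (simp add: smooth_module_def)

lemma smooth_module_const_scale: "smooth_module S \<Longrightarrow> X \<in> S \<Longrightarrow> (\<lambda>q. c *\<^sub>R X q) \<in> S"
  using smooth_module_scale[OF _ smooth_const] .

lemma smooth_module_zero: "smooth_module S \<Longrightarrow> X \<in> S \<Longrightarrow> (\<lambda>q. 0) \<in> S"
  using smooth_module_const_scale[of S X 0] by simp

text \<open>If a field vanishes at \<open>p\<close>, so do its coefficients in a local frame. The
  factor \<rho>, equal to 1 at \<open>p\<close>, cuts off the local expansion and makes its
  coefficients and frame fields global.\<close>

definition vanishing_decomposition :: "('m \<Rightarrow> 'w::real_vector) set \<Rightarrow> 'm \<Rightarrow> ('m \<Rightarrow> 'w) \<Rightarrow> bool" where
  "vanishing_decomposition S p X \<longleftrightarrow> (\<exists>\<rho> cs. smooth \<rho> \<and> \<rho> p = 1 \<and>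
     (\<forall>(c, s)\<in>set cs. smooth c \<and> c p = 0 \<and> s \<in> S) \<and>
     (\<forall>q. \<rho> q *\<^sub>R X q = (\<Sum>(c, s)\<leftarrow>cs. c q *\<^sub>R s q)))"

definition tensorial_at :: "('m \<Rightarrow> 'w::real_vector) set \<Rightarrow> 'm \<Rightarrow> (('m \<Rightarrow> 'w) \<Rightarrow> 'z::real_vector) \<Rightarrow> bool" where
  "tensorial_at S p \<Phi> \<longleftrightarrow> (\<forall>X\<in>S. \<forall>Y\<in>S. \<Phi> (\<lambda>q. X q + Y q) = \<Phi> X + \<Phi> Y) \<and>
     (\<forall>h. \<forall>X\<in>S. smooth h \<longrightarrow> \<Phi> (\<lambda>q. h q *\<^sub>R X q) = h p *\<^sub>R \<Phi> X)"

lemma tensorial_at_add: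
  assumes "tensorial_at S p \<Phi>" "X \<in> S" "Y \<in> S"
  shows "\<Phi> (\<lambda>q. X q + Y q) = \<Phi> X + \<Phi> Y"
  by (rule assms(1)[unfolded tensorial_at_def, THEN conjunct1, rule_format, OF assms(2,3)])

lemma tensorial_at_scale:
  assumes "tensorial_at S p \<Phi>" "smooth h" "X \<in> S"
  shows "\<Phi> (\<lambda>q. h q *\<^sub>R X q) = h p *\<^sub>R \<Phi> X"
  by (rule assms(1)[unfolded tensorial_at_def, THEN conjunct2, rule_format, OF assms(3,2)])

text \<open>\<Phi>(X) = \<rho>(p) \<Phi>(X) = \<Phi>(\<rho> X), and the last is a sum of terms c(p)
  \<Phi>(s) with c(p) = 0.\<close>

lemma tensorial_at_zero:
  assumes S: "smooth_module S" and \<Phi>: "tensorial_at S p \<Phi>" and X: "X \<in> S"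
    and v: "vanishing_decomposition S p X"
  shows "\<Phi> X = 0"
proof -
  obtain \<rho> cs where dec: "smooth \<rho> \<and> \<rho> p = 1 \<and>
     (\<forall>(c, s)\<in>set cs. smooth c \<and> c p = 0 \<and> s \<in> S) \<and>
     (\<forall>q. \<rho> q *\<^sub>R X q = (\<Sum>(c, s)\<leftarrow>cs. c q *\<^sub>R s q))"
    using v unfolding vanishing_decomposition_def by (elim exE) (rule that)
  then have \<rho>: "smooth \<rho>" "\<rho> p = 1" "\<And>c s. (c, s) \<in> set cs \<Longrightarrow> smooth c \<and> c p = 0 \<and> s \<in> S"
    and \<rho>4: "\<rho> q *\<^sub>R X q = (\<Sum>(c, s)\<leftarrow>cs. c q *\<^sub>R s q)" for q
    by auto
  have zero: "\<Phi> (\<lambda>q. 0) = 0"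
  proof -
    have "\<Phi> (\<lambda>q. 0 *\<^sub>R X q) = 0 *\<^sub>R \<Phi> X"
      by (rule tensorial_at_scale[OF \<Phi> smooth_const X])
    then show ?thesis by simp
  qed
  have "(\<lambda>q. \<Sum>(c, s)\<leftarrow>cs. c q *\<^sub>R s q) \<in> S \<and> \<Phi> (\<lambda>q. \<Sum>(c, s)\<leftarrow>cs. c q *\<^sub>R s q) = 0"
    using \<rho>(3)
  proof (induction cs)
    case Nil
    then show ?case using smooth_module_zero[OF S X] zero by simp
  next
    case (Cons a cs)
    obtain c s where a: "a = (c, s)" by (cases a)
    then have cs: "smooth c" "c p = 0" "s \<in> S" using Cons.prems[of c s] by auto
    have 1: "(\<lambda>q. c q *\<^sub>R s q) \<in> S" by (rule smooth_module_scale[OF S cs(1,3)])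
    have 2: "\<Phi> (\<lambda>q. c q *\<^sub>R s q) = 0" using tensorial_at_scale[OF \<Phi> cs(1,3)] cs(2) by simp
    have IH: "(\<lambda>q. \<Sum>(c, s)\<leftarrow>cs. c q *\<^sub>R s q) \<in> S" "\<Phi> (\<lambda>q. \<Sum>(c, s)\<leftarrow>cs. c q *\<^sub>R s q) = 0"
      using Cons by auto
    have "\<Phi> (\<lambda>q. c q *\<^sub>R s q + (\<Sum>(c, s)\<leftarrow>cs. c q *\<^sub>R s q)) = 0"
      using tensorial_at_add[OF \<Phi> 1 IH(1)] 2 IH(2) by simp
    then show ?case using smooth_module_add[OF S 1 IH(1)] a by simp
  qed
  then have "\<Phi> (\<lambda>q. \<rho> q *\<^sub>R X q) = 0" by (simp add: \<rho>4)
  then show ?thesis using tensorial_at_scale[OF \<Phi> \<rho>(1) X] \<rho>(2) by simp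
qed

lemma tensorial_at_eq:
  assumes S: "smooth_module S" and \<Phi>: "tensorial_at S p \<Phi>" and XY: "X \<in> S" "Y \<in> S" "X p = Y p"
    and v: "\<And>Z. Z \<in> S \<Longrightarrow> Z p = 0 \<Longrightarrow> vanishing_decomposition S p Z"
  shows "\<Phi> X = \<Phi> Y"
proof -
  have m: "(\<lambda>q. (- 1) *\<^sub>R Y q) \<in> S" by (rule smooth_module_const_scale[OF S XY(2)])
  have "(\<lambda>q. X q + (- 1) *\<^sub>R Y q) \<in> S" by (rule smooth_module_add[OF S XY(1) m])
  then have "\<Phi> (\<lambda>q. X q + (- 1) *\<^sub>R Y q) = 0"
    using tensorial_at_zero[OF S \<Phi>] v XY by simp
  moreover have "\<Phi> (\<lambda>q. X q + (- 1) *\<^sub>R Y q) = \<Phi> X + \<Phi> (\<lambda>q. (- 1) *\<^sub>R Y q)"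
    by (rule tensorial_at_add[OF \<Phi> XY(1) m])
  moreover have "\<Phi> (\<lambda>q. (- 1) *\<^sub>R Y q) = (- 1) *\<^sub>R \<Phi> Y"
    by (rule tensorial_at_scale[OF \<Phi> smooth_const XY(2)])
  ultimately show ?thesis by simp
qed

lemma smooth_module_vector_fields: "smooth_module (vector_fields A)"
  by (simp add: smooth_module_def vector_fields_add vector_fields_scale)

text \<open>A field with constant components \<open>w\<close> in the chart, cut off by \<rho>. Its
  components in another chart are derivatives of the transition map in the fixed direction
  \<open>w\<close>, hence smooth.\<close>

lemma chart_field:
  assumes c: "(U, \<phi>) \<in> A" and \<rho>: "smooth \<rho>" "closed K" "K \<subseteq> U" "\<And>q. q \<notin> K \<Longrightarrow> \<rho> q = 0"
  shows "(\<lambda>q. if q \<in> U then \<rho> q *\<^sub>R chart_vec U \<phi> q w else 0) \<in> vector_fields A"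
proof (rule vector_fieldsI)
  fix V \<psi> assume d: "(V, \<psi>) \<in> A"
  let ?f = "\<lambda>q. tderiv A \<psi> q (chart_vec U \<phi> q w)"
  let ?S = "\<lambda>U'. U' \<inter> (U \<inter> V)"
  have UV: "open (U \<inter> V)" using chart_open c d by blast
  have \<psi>: "smooth_fun_on A (U \<inter> V) \<psi>" by (rule smooth_fun_on_subset[OF smooth_fun_on_chart[OF d]]) auto
  have g: "smooth_on (\<phi> ` (U \<inter> (U \<inter> V))) (\<lambda>x. frechet_derivative (\<lambda>x. \<psi> (chart_inv (U, \<phi>) x)) (at x) w)"
    by (rule smooth_on_frechet_derivative[OF smooth_fun_onD[OF c \<psi>]])
  have f: "?f q = frechet_derivative (\<lambda>x. \<psi> (chart_inv (U, \<phi>) x)) (at (\<phi> q)) w" if "q \<in> U \<inter> V" for q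
    using tderiv_chart[OF c _ that UV \<psi>, of "chart_vec U \<phi> q w"] that tderiv_chart_vec[OF c] by simp
  have "smooth_fun_on A (U \<inter> V) ?f"
  proof (rule smooth_fun_on_cong[OF _ UV])
    show "smooth_fun_on A (U \<inter> V) (\<lambda>q. frechet_derivative (\<lambda>x. \<psi> (chart_inv (U, \<phi>) x)) (at (\<phi> q)) w)"
    proof (rule smooth_fun_onI)
      fix U' \<phi>' assume c': "(U', \<phi>') \<in> A"
      show "smooth_on (\<phi>' ` (U' \<inter> (U \<inter> V)))
        (\<lambda>x. frechet_derivative (\<lambda>x. \<psi> (chart_inv (U, \<phi>) x)) (at (\<phi> (chart_inv (U', \<phi>') x))) w)"
        by (rule smooth_on_compose[OF open_chart_image[OF c' UV] open_chart_image[OF c UV] _ _ g])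
          (use c' in \<open>auto intro: smooth_fun_onD[OF c'] smooth_fun_on_subset[OF smooth_fun_on_chart[OF c]]\<close>)
    qed
  qed (simp add: f)
  from smooth_fun_on_cutoff[OF chart_open[OF c] chart_open[OF d] this \<rho>]
  show "smooth_fun_on A V (\<lambda>q. tderiv A \<psi> q (if q \<in> U then \<rho> q *\<^sub>R chart_vec U \<phi> q w else 0))"
  proof (rule smooth_fun_on_cong[OF _ chart_open[OF d]])
    fix q assume "q \<in> V"
    then have "linear (tderiv A \<psi> q)" by (rule linear_tderiv[OF smooth_fun_on_chart[OF d]])
    then show "(if q \<in> U then \<rho> q *\<^sub>R ?f q else 0) = tderiv A \<psi> q (if q \<in> U then \<rho> q *\<^sub>R chart_vec U \<phi> q w else 0)"
      by (simp add: linear_cmul linear_0)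
  qed
qed

lemma vector_field_extension: obtains X where "X \<in> vector_fields A" "X p = v"
proof (rule chart_exists[of p])
  fix U \<phi> assume c: "(U, \<phi>) \<in> A" "p \<in> U"
  obtain \<rho> :: "'m \<Rightarrow> real" and K where \<rho>: "smooth \<rho>" "\<rho> p = 1" "closed K" "K \<subseteq> U" "\<And>q. q \<notin> K \<Longrightarrow> \<rho> q = 0"
    by (rule bump_function[OF chart_open[OF c(1)] c(2)]) blast
  show ?thesis
    by (rule that[OF chart_field[OF c(1) \<rho>(1,3-), of "tderiv A \<phi> p v"]])
      (use c \<rho> chart_vec_tderiv[OF c] in simp_all)
qed

lemma vector_fields_vanishing_decomposition:
  assumes X: "X \<in> vector_fields A" "X p = 0"
  shows "vanishing_decomposition (vector_fields A) p X"
proof (rule chart_exists[of p])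
  fix U \<phi> assume c: "(U, \<phi>) \<in> A" "p \<in> U"
  obtain \<rho> :: "'m \<Rightarrow> real" and K where \<rho>: "smooth \<rho>" "\<rho> p = 1" "closed K" "K \<subseteq> U" "\<And>q. q \<notin> K \<Longrightarrow> \<rho> q = 0"
    by (rule bump_function[OF chart_open[OF c(1)] c(2)]) blast
  define s where "s w q = (if q \<in> U then \<rho> q *\<^sub>R chart_vec U \<phi> q w else 0)" for w q
  define k where "k w q = (if q \<in> U then \<rho> q *\<^sub>R (tderiv A \<phi> q (X q) \<bullet> w) else 0)" for w q
  obtain bs where bs: "set bs = (Basis :: 'v set)" "distinct bs"
    using finite_distinct_list[OF finite_Basis] by blast
  have s: "s w \<in> vector_fields A" for w
    unfolding s_def[abs_def] by (rule chart_field[OF c(1) \<rho>(1,3-)])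
  have k: "smooth (k w)" for w
    unfolding k_def[abs_def]
  proof (rule smooth_fun_on_cutoff[OF chart_open[OF c(1)] open_UNIV _ \<rho>(1,3-)])
    have "smooth_fun_on A U (\<lambda>q. tderiv A \<phi> q (X q) \<bullet> w)"
      by (rule smooth_fun_on_linear[OF bounded_linear_inner_left chart_open[OF c(1)] vector_fieldsD[OF X(1) c(1)]])
    then show "smooth_fun_on A (U \<inter> UNIV) (\<lambda>q. tderiv A \<phi> q (X q) \<bullet> w)" by simp
  qed
  have kp: "k w p = 0" for w
    using X(2) linear_0[OF linear_tderiv[OF smooth_fun_on_chart[OF c(1)] c(2)]] by (simp add: k_def)
  \<comment> \<open>Of the two factors \<rho> one cuts off the coefficients \<open>k\<close> and the
    other the coordinate fields \<open>s\<close>.\<close>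
  have eq: "(\<rho> q * \<rho> q) *\<^sub>R X q = (\<Sum>w\<leftarrow>bs. k w q *\<^sub>R s w q)" for q
  proof (cases "q \<in> U")
    case True
    have lin: "linear (tderiv A \<phi> q)" by (rule linear_tderiv[OF smooth_fun_on_chart[OF c(1)] True])
    have inj: "u = v" if "tderiv A \<phi> q u = tderiv A \<phi> q v" for u v
      using that chart_vec_tderiv[OF c(1) True] by metis
    have "tderiv A \<phi> q (\<Sum>w\<in>Basis. k w q *\<^sub>R s w q) =
        (\<Sum>w\<in>Basis. (\<rho> q * \<rho> q) *\<^sub>R (tderiv A \<phi> q (X q) \<bullet> w) *\<^sub>R w)"
      using True tderiv_chart_vec[OF c(1) True]
      by (simp add: linear_sum[OF lin] linear_cmul[OF lin] k_def s_def mult_ac)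
    also have "\<dots> = (\<rho> q * \<rho> q) *\<^sub>R tderiv A \<phi> q (X q)"
      by (simp only: scaleR_sum_right[symmetric] euclidean_representation)
    also have "\<dots> = tderiv A \<phi> q ((\<rho> q * \<rho> q) *\<^sub>R X q)"
      by (simp only: linear_cmul[OF lin])
    finally have "(\<Sum>w\<in>Basis. k w q *\<^sub>R s w q) = (\<rho> q * \<rho> q) *\<^sub>R X q" by (rule inj)
    then show ?thesis using bs by (simp add: sum_list_distinct_conv_sum_set)
  next
    case False
    then show ?thesis using \<rho>(4,5) by (auto simp: k_def s_def sum_list_0)
  qed
  have "smooth (\<lambda>q. \<rho> q * \<rho> q)" by (rule smooth_fun_on_mult[OF open_UNIV \<rho>(1) \<rho>(1)])
  then show ?thesis
    unfolding vanishing_decomposition_def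
    using s k kp eq \<rho>(2)
    by (intro exI[of _ "\<lambda>q. \<rho> q * \<rho> q"] exI[of _ "map (\<lambda>w. (k w, s w)) bs"] conjI)
      (auto simp: comp_def)
qed

end

section \<open>Sections of a vector bundle\<close>

locale smooth_bundle = smooth_manifold A
  for A :: "('m::{t2_space,second_countable_topology}, 'v::euclidean_space) chart set" +
  fixes E :: "('m, 'e::real_vector) vbundle"
  assumes vb: "vector_bundle A E"
begin

abbreviation "r \<equiv> vb_rank E"

lemma subspace_fibre: "subspace (fibre E p)"
  using vb by (simp add: vector_bundle_def)

lemma frame_exists:
  obtains U f where "(U, f) \<in> frames E" "p \<in> U"
proof -
  have "p \<in> (\<Union>c\<in>frames E. fst c)"
    using vb by (simp add: vector_bundle_def)
  then show ?thesis using that by (metis UN_E surjective_pairing)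
qed

lemma frame_open: "(U, f) \<in> frames E \<Longrightarrow> open U"
  using vb by (auto simp: vector_bundle_def)

lemma frame_basis: "(U, f) \<in> frames E \<Longrightarrow> p \<in> U \<Longrightarrow> basis_family r (fibre E p) (\<lambda>i. f i p)"
  using vb by (auto simp: vector_bundle_def)

lemma frame_transition:
  assumes "(U, f) \<in> frames E" "(V, g) \<in> frames E"
  obtains c :: "nat \<Rightarrow> nat \<Rightarrow> 'm \<Rightarrow> real" where "\<And>i j. i < r \<Longrightarrow> j < r \<Longrightarrow> smooth_fun_on A (U \<inter> V) (c i j)"
    "\<And>p j. p \<in> U \<inter> V \<Longrightarrow> j < r \<Longrightarrow> g j p = (\<Sum>i<r. c i j p *\<^sub>R f i p)"
proof -
  have "\<forall>(U, f)\<in>frames E. \<forall>(V, g)\<in>frames E. \<exists>c :: nat \<Rightarrow> nat \<Rightarrow> 'm \<Rightarrow> real.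
        (\<forall>i<r. \<forall>j<r. smooth_fun_on A (U \<inter> V) (c i j)) \<and>
        (\<forall>p\<in>U \<inter> V. \<forall>j<r. g j p = (\<Sum>i<r. c i j p *\<^sub>R f i p))"
    using vb unfolding vector_bundle_def by (elim conjE)
  then have "\<exists>c :: nat \<Rightarrow> nat \<Rightarrow> 'm \<Rightarrow> real.
        (\<forall>i<r. \<forall>j<r. smooth_fun_on A (U \<inter> V) (c i j)) \<and>
        (\<forall>p\<in>U \<inter> V. \<forall>j<r. g j p = (\<Sum>i<r. c i j p *\<^sub>R f i p))"
    using assms by fast
  then show ?thesis using that by blast
qed

lemma sectionsI:
  assumes "\<And>p. \<xi> p \<in> fibre E p"
    and "\<And>U f. (U, f) \<in> frames E \<Longrightarrow> \<exists>c :: nat \<Rightarrow> 'm \<Rightarrow> real.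
        (\<forall>i<r. smooth_fun_on A U (c i)) \<and> (\<forall>p\<in>U. \<xi> p = (\<Sum>i<r. c i p *\<^sub>R f i p))"
  shows "\<xi> \<in> sections A E"
  using assms by (auto simp: sections_def)

lemma sections_fibre: "\<xi> \<in> sections A E \<Longrightarrow> \<xi> p \<in> fibre E p"
  by (simp add: sections_def)

lemma sections_coeff:
  assumes "\<xi> \<in> sections A E" "(U, f) \<in> frames E"
  obtains c :: "nat \<Rightarrow> 'm \<Rightarrow> real" where "\<And>i. i < r \<Longrightarrow> smooth_fun_on A U (c i)"
    "\<And>p. p \<in> U \<Longrightarrow> \<xi> p = (\<Sum>i<r. c i p *\<^sub>R f i p)"
proof -
  have "\<forall>(U, f)\<in>frames E. \<exists>c :: nat \<Rightarrow> 'm \<Rightarrow> real. (\<forall>i<r. smooth_fun_on A U (c i)) \<and>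
      (\<forall>p\<in>U. \<xi> p = (\<Sum>i<r. c i p *\<^sub>R f i p))"
    using assms(1) by (simp add: sections_def)
  then have "\<exists>c :: nat \<Rightarrow> 'm \<Rightarrow> real. (\<forall>i<r. smooth_fun_on A U (c i)) \<and> (\<forall>p\<in>U. \<xi> p = (\<Sum>i<r. c i p *\<^sub>R f i p))"
    using assms(2) by fast
  then show ?thesis using that by blast
qed

lemma sections_add:
  assumes "\<xi> \<in> sections A E" "\<eta> \<in> sections A E"
  shows "(\<lambda>p. \<xi> p + \<eta> p) \<in> sections A E"
proof (rule sectionsI)
  show "\<xi> p + \<eta> p \<in> fibre E p" for p
    using subspace_fibre assms sections_fibre subspace_add by blast
  fix U f assume f: "(U, f) \<in> frames E"
  obtain c where c: "\<And>i. i < r \<Longrightarrow> smooth_fun_on A U (c i)" "\<And>p. p \<in> U \<Longrightarrow> \<xi> p = (\<Sum>i<r. c i p *\<^sub>R f i p)"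
    by (rule sections_coeff[OF assms(1) f]) blast
  obtain d where d: "\<And>i. i < r \<Longrightarrow> smooth_fun_on A U (d i)" "\<And>p. p \<in> U \<Longrightarrow> \<eta> p = (\<Sum>i<r. d i p *\<^sub>R f i p)"
    by (rule sections_coeff[OF assms(2) f]) blast
  show "\<exists>c. (\<forall>i<r. smooth_fun_on A U (c i)) \<and> (\<forall>p\<in>U. \<xi> p + \<eta> p = (\<Sum>i<r. c i p *\<^sub>R f i p))"
    by (rule exI[of _ "\<lambda>i p. c i p + d i p"])
      (auto simp: c d scaleR_left_distrib sum.distrib intro!: smooth_fun_on_add[OF frame_open[OF f]])
qed

lemma sections_scale:
  assumes "smooth h" "\<xi> \<in> sections A E"
  shows "(\<lambda>p. h p *\<^sub>R \<xi> p) \<in> sections A E"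
proof (rule sectionsI)
  show "h p *\<^sub>R \<xi> p \<in> fibre E p" for p
    using subspace_fibre assms sections_fibre subspace_mul by blast
  fix U f assume f: "(U, f) \<in> frames E"
  obtain c where c: "\<And>i. i < r \<Longrightarrow> smooth_fun_on A U (c i)" "\<And>p. p \<in> U \<Longrightarrow> \<xi> p = (\<Sum>i<r. c i p *\<^sub>R f i p)"
    by (rule sections_coeff[OF assms(2) f]) blast
  have h: "smooth_fun_on A U h" by (rule smooth_fun_on_subset[OF assms(1)]) simp
  show "\<exists>c. (\<forall>i<r. smooth_fun_on A U (c i)) \<and> (\<forall>p\<in>U. h p *\<^sub>R \<xi> p = (\<Sum>i<r. c i p *\<^sub>R f i p))"
    by (rule exI[of _ "\<lambda>i p. h p * c i p"])
      (auto simp: c scaleR_sum_right intro!: smooth_fun_on_mult[OF frame_open[OF f] h])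
qed

lemma smooth_module_sections: "smooth_module (sections A E)"
  by (simp add: smooth_module_def sections_add sections_scale)

lemma sections_zero: "(\<lambda>p. 0) \<in> sections A E"
proof (rule sectionsI)
  show "0 \<in> fibre E p" for p using subspace_fibre subspace_0 by blast
  fix U f assume f: "(U, f) \<in> frames E"
  show "\<exists>c :: nat \<Rightarrow> 'm \<Rightarrow> real. (\<forall>i<r. smooth_fun_on A U (c i)) \<and> (\<forall>p\<in>U. 0 = (\<Sum>i<r. c i p *\<^sub>R f i p))"
    by (rule exI[of _ "\<lambda>i p. 0"]) (auto intro: smooth_fun_on_const frame_open[OF f])
qed

lemma sections_sum: "(\<And>i. i \<in> I \<Longrightarrow> g i \<in> sections A E) \<Longrightarrow> (\<lambda>p. \<Sum>i\<in>I. g i p) \<in> sections A E"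
  by (induction I rule: infinite_finite_induct) (auto intro: sections_zero sections_add)

lemma frame_section:
  assumes f: "(U, f) \<in> frames E" and i: "i < r"
    and \<rho>: "smooth \<rho>" "closed K" "K \<subseteq> U" "\<And>q. q \<notin> K \<Longrightarrow> \<rho> q = 0"
  shows "(\<lambda>q. if q \<in> U then \<rho> q *\<^sub>R f i q else 0) \<in> sections A E"
proof (rule sectionsI)
  show "(if q \<in> U then \<rho> q *\<^sub>R f i q else 0) \<in> fibre E q" for q
    using subspace_fibre basis_family_mem[OF frame_basis[OF f] i] by (auto intro: subspace_mul subspace_0)
  fix V g assume g: "(V, g) \<in> frames E"
  obtain c :: "nat \<Rightarrow> nat \<Rightarrow> 'm \<Rightarrow> real" where c: "\<And>i j. i < r \<Longrightarrow> j < r \<Longrightarrow> smooth_fun_on A (V \<inter> U) (c i j)"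
    "\<And>p j. p \<in> V \<inter> U \<Longrightarrow> j < r \<Longrightarrow> f j p = (\<Sum>i<r. c i j p *\<^sub>R g i p)"
    by (rule frame_transition[OF g f]) blast
  show "\<exists>c. (\<forall>j<r. smooth_fun_on A V (c j)) \<and> (\<forall>q\<in>V. (if q \<in> U then \<rho> q *\<^sub>R f i q else 0) = (\<Sum>j<r. c j q *\<^sub>R g j q))"
  proof (intro exI[of _ "\<lambda>j q. if q \<in> U then \<rho> q *\<^sub>R c j i q else 0"] conjI allI impI ballI)
    fix j assume "j < r"
    show "smooth_fun_on A V (\<lambda>q. if q \<in> U then \<rho> q *\<^sub>R c j i q else 0)"
      by (rule smooth_fun_on_cutoff[OF frame_open[OF f] frame_open[OF g] _ \<rho>])
        (use c(1)[OF \<open>j < r\<close> i] in \<open>simp add: Int_commute\<close>)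
  next
    fix q assume "q \<in> V"
    then show "(if q \<in> U then \<rho> q *\<^sub>R f i q else 0) = (\<Sum>j<r. (if q \<in> U then \<rho> q *\<^sub>R c j i q else 0) *\<^sub>R g j q)"
      using c(2)[of q i] i by (simp add: scaleR_sum_right)
  qed
qed

lemma section_extension:
  assumes "x \<in> fibre E p"
  obtains \<xi> where "\<xi> \<in> sections A E" "\<xi> p = x"
proof (rule frame_exists[of p])
  fix U f assume f: "(U, f) \<in> frames E" "p \<in> U"
  obtain \<rho> :: "'m \<Rightarrow> real" and K where \<rho>: "smooth \<rho>" "\<rho> p = 1" "closed K" "K \<subseteq> U" "\<And>q. q \<notin> K \<Longrightarrow> \<rho> q = 0"
    by (rule bump_function[OF frame_open[OF f(1)] f(2)]) blast
  obtain c where c: "x = (\<Sum>i<r. c i *\<^sub>R f i p)"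
    by (rule basis_family_span[OF frame_basis[OF f] assms])
  define \<xi> where "\<xi> q = (\<Sum>i<r. c i *\<^sub>R (if q \<in> U then \<rho> q *\<^sub>R f i q else 0))" for q
  have "\<xi> \<in> sections A E"
    unfolding \<xi>_def[abs_def]
    by (intro sections_sum sections_scale[OF smooth_const] frame_section[OF f(1) _ \<rho>(1,3-)]) auto
  moreover have "\<xi> p = x" using f \<rho> c by (simp add: \<xi>_def)
  ultimately show ?thesis using that by blast
qed

lemma sections_vanishing_decomposition:
  assumes X: "X \<in> sections A E" "X p = 0"
  shows "vanishing_decomposition (sections A E) p X"
proof (rule frame_exists[of p])
  fix U f assume f: "(U, f) \<in> frames E" "p \<in> U"
  obtain \<rho> :: "'m \<Rightarrow> real" and K where \<rho>: "smooth \<rho>" "\<rho> p = 1" "closed K" "K \<subseteq> U" "\<And>q. q \<notin> K \<Longrightarrow> \<rho> q = 0"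
    by (rule bump_function[OF frame_open[OF f(1)] f(2)]) blast
  obtain c where c: "\<And>i. i < r \<Longrightarrow> smooth_fun_on A U (c i)" "\<And>q. q \<in> U \<Longrightarrow> X q = (\<Sum>i<r. c i q *\<^sub>R f i q)"
    by (rule sections_coeff[OF X(1) f(1)]) blast
  define s where "s i q = (if q \<in> U then \<rho> q *\<^sub>R f i q else 0)" for i q
  define k where "k i q = (if q \<in> U then \<rho> q *\<^sub>R c i q else 0)" for i q
  have s: "s i \<in> sections A E" if "i < r" for i
    unfolding s_def[abs_def] by (rule frame_section[OF f(1) that \<rho>(1,3-)])
  have k: "smooth (k i)" if "i < r" for i
    unfolding k_def[abs_def]
    by (rule smooth_fun_on_cutoff[OF frame_open[OF f(1)] open_UNIV _ \<rho>(1,3-)]) (use c(1)[OF that] in simp)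
  have kp: "k i p = 0" if "i < r" for i
    using basis_family_coeff_zero[OF frame_basis[OF f] _ that, of "\<lambda>i. c i p"] c(2)[OF f(2)] X(2) by (simp add: k_def)
  have eq: "(\<rho> q * \<rho> q) *\<^sub>R X q = (\<Sum>i\<leftarrow>[0..<r]. k i q *\<^sub>R s i q)" for q
  proof (cases "q \<in> U")
    case True
    then show ?thesis
      by (simp add: c(2) k_def s_def scaleR_sum_right interv_sum_list_conv_sum_set_nat lessThan_atLeast0 mult_ac)
  next
    case False
    then show ?thesis using \<rho>(4,5) by (auto simp: k_def s_def)
  qed
  have "smooth (\<lambda>q. \<rho> q * \<rho> q)" by (rule smooth_fun_on_mult[OF open_UNIV \<rho>(1) \<rho>(1)])
  then show ?thesis
    unfolding vanishing_decomposition_def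
    using s k kp eq \<rho>(2)
    by (intro exI[of _ "\<lambda>q. \<rho> q * \<rho> q"] exI[of _ "map (\<lambda>i. (k i, s i)) [0..<r]"] conjI)
      (auto simp: comp_def)
qed

end

section \<open>Cartan calculus on lists of fields\<close>

text \<open>Cartan calculus on functions of lists of fields: \<open>lieD\<close> is the Lie derivative, and the recursion
  for \<open>extD\<close> is Cartan's formula \<open>\<iota>\<^sub>X d = L\<^sub>X - d \<iota>\<^sub>X\<close>.\<close>

fun lieD :: "('x \<Rightarrow> 'x \<Rightarrow> 'x) \<Rightarrow> ('x \<Rightarrow> ('i \<Rightarrow> 'r) \<Rightarrow> 'i \<Rightarrow> 'r) \<Rightarrow> 'x \<Rightarrow> ('x list \<Rightarrow> 'i \<Rightarrow> 'r::real_vector) \<Rightarrow> 'x list \<Rightarrow> 'i \<Rightarrow> 'r" where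
  "lieD br act X F [] i = act X (F []) i"
| "lieD br act X F (Y # Ys) i = lieD br act X (\<lambda>Zs. F (Y # Zs)) Ys i - F (br X Y # Ys) i"

fun extD :: "('x \<Rightarrow> 'x \<Rightarrow> 'x) \<Rightarrow> ('x \<Rightarrow> ('i \<Rightarrow> 'r) \<Rightarrow> 'i \<Rightarrow> 'r) \<Rightarrow> ('x list \<Rightarrow> 'i \<Rightarrow> 'r::real_vector) \<Rightarrow> 'x list \<Rightarrow> 'i \<Rightarrow> 'r" where
  "extD br act F [] i = 0"
| "extD br act F (X # Xs) i = lieD br act X F Xs i - extD br act (\<lambda>Zs. F (X # Zs)) Xs i"

lemma lieD_Cons: "lieD br act X F (Y # Ys) = (\<lambda>i. lieD br act X (\<lambda>Zs. F (Y # Zs)) Ys i - F (br X Y # Ys) i)"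
  by auto

lemma extD_Cons: "extD br act F (X # Xs) = (\<lambda>i. lieD br act X F Xs i - extD br act (\<lambda>Zs. F (X # Zs)) Xs i)"
  by auto

lemma omit_0 [simp]: "omit 0 (x # xs) = xs"
  by (simp add: omit_def)

lemma omit_Suc [simp]: "omit (Suc i) (x # xs) = x # omit i xs"
  by (simp add: omit_def)

lemma list_update_insert_at: "a < length Ys \<Longrightarrow> Ys[a := Z] = insert_at a Z (omit a Ys)"
  by (simp add: insert_at_def omit_def upd_conv_take_nth_drop min_absorb2)

lemma lieD_eq_sum: "lieD br act X F Ys i = act X (F Ys) i - (\<Sum>a<length Ys. F (Ys[a := br X (Ys ! a)]) i)"
proof (induction Ys arbitrary: F)
  case (Cons Y Ys)
  have "(\<Sum>a<length (Y # Ys). F ((Y # Ys)[a := br X ((Y # Ys) ! a)]) i) =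
      F (br X Y # Ys) i + (\<Sum>a<length Ys. F (Y # Ys[a := br X (Ys ! a)]) i)"
    by (simp only: length_Cons sum.lessThan_Suc_shift) simp
  then show ?case using Cons.IH[of "\<lambda>Zs. F (Y # Zs)"] by simp
qed simp

text \<open>Ties the sums in \<open>ext_deriv\<close> and \<open>cov_ext_deriv\<close> to the
  recursion. With the first field X split off, the terms that differentiate along X or bracket with
  X form the Lie derivative, and the others are minus the formula for the contraction with X.
  Antisymmetry moves a bracket from the front to its slot.\<close>

lemma Koszul_formula:
  assumes "\<And>i. antisym_list (\<lambda>Zs. F Zs i)"
  shows "(\<Sum>a<length Xs. (-1) ^ a *\<^sub>R act (Xs ! a) (F (omit a Xs)) i) +
    (\<Sum>b<length Xs. \<Sum>a<b. (-1) ^ (a + b) *\<^sub>R F (br (Xs ! a) (Xs ! b) # omit a (omit b Xs)) i) = extD br act F Xs i"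
  using assms
proof (induction Xs arbitrary: F)
  case (Cons X Xs)
  let ?n = "length Xs"
  let ?G = "\<lambda>Zs. F (X # Zs)"
  have swap: "F (Z # X # Zs) i = - F (X # Z # Zs) i" for Z Zs
    using Cons.prems[of i, unfolded antisym_list_def, rule_format, of 1 "X # Zs" Z] by (simp add: insert_at_def)
  have "(\<Sum>a<length (X # Xs). (-1) ^ a *\<^sub>R act ((X # Xs) ! a) (F (omit a (X # Xs))) i) =
      act X (F Xs) i - (\<Sum>a<?n. (-1) ^ a *\<^sub>R act (Xs ! a) (?G (omit a Xs)) i)"
    by (simp only: length_Cons sum.lessThan_Suc_shift) (simp add: sum_negf)
  moreover have "(\<Sum>b<length (X # Xs). \<Sum>a<b. (-1) ^ (a + b) *\<^sub>R F (br ((X # Xs) ! a) ((X # Xs) ! b) # omit a (omit b (X # Xs))) i) =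
      - (\<Sum>b<?n. F (Xs[b := br X (Xs ! b)]) i) -
      (\<Sum>b<?n. \<Sum>a<b. (-1) ^ (a + b) *\<^sub>R ?G (br (Xs ! a) (Xs ! b) # omit a (omit b Xs)) i)"
  proof -
    have 1: "(\<Sum>a<Suc b. (-1) ^ (a + Suc b) *\<^sub>R F (br ((X # Xs) ! a) ((X # Xs) ! Suc b) # omit a (omit (Suc b) (X # Xs))) i) =
       - F (Xs[b := br X (Xs ! b)]) i - (\<Sum>a<b. (-1) ^ (a + b) *\<^sub>R ?G (br (Xs ! a) (Xs ! b) # omit a (omit b Xs)) i)"
      if "b < ?n" for b
    proof -
      have "F (Xs[b := br X (Xs ! b)]) i = (-1) ^ b *\<^sub>R F (br X (Xs ! b) # omit b Xs) i"
        using Cons.prems[of i, unfolded antisym_list_def, rule_format, of b "omit b Xs"] that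
        by (simp add: list_update_insert_at omit_def)
      then show ?thesis
        by (simp only: sum.lessThan_Suc_shift) (simp add: swap sum_negf)
    qed
    have "(\<Sum>b<length (X # Xs). \<Sum>a<b. (-1) ^ (a + b) *\<^sub>R F (br ((X # Xs) ! a) ((X # Xs) ! b) # omit a (omit b (X # Xs))) i) =
      (\<Sum>b<?n. \<Sum>a<Suc b. (-1) ^ (a + Suc b) *\<^sub>R F (br ((X # Xs) ! a) ((X # Xs) ! Suc b) # omit a (omit (Suc b) (X # Xs))) i)"
      by (simp only: length_Cons sum.lessThan_Suc_shift[of _ ?n]) (simp del: sum.lessThan_Suc)
    also have "\<dots> = (\<Sum>b<?n. - F (Xs[b := br X (Xs ! b)]) i - (\<Sum>a<b. (-1) ^ (a + b) *\<^sub>R ?G (br (Xs ! a) (Xs ! b) # omit a (omit b Xs)) i))"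
      by (rule sum.cong[OF refl], rule 1) simp
    finally show ?thesis by (simp add: sum_subtractf sum_negf)
  qed
  moreover have "extD br act ?G Xs i = (\<Sum>a<?n. (-1) ^ a *\<^sub>R act (Xs ! a) (?G (omit a Xs)) i) +
     (\<Sum>b<?n. \<Sum>a<b. (-1) ^ (a + b) *\<^sub>R ?G (br (Xs ! a) (Xs ! b) # omit a (omit b Xs)) i)"
    by (rule Cons.IH[symmetric]) (rule antisym_list_Cons, rule Cons.prems)
  ultimately show ?case
    by (simp add: lieD_eq_sum)
qed simp

section \<open>The Leibniz rule for the exterior derivative\<close>

text \<open>Linearity is asked on admissible functions \<open>C\<close> and at indices
  \<open>I\<close> only: a connection is controlled on smooth sections alone, and a function of a
  section and a point is evaluated at smooth sections alone.\<close>

locale linear_action =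
  fixes XX :: "'x set" and br :: "'x \<Rightarrow> 'x \<Rightarrow> 'x" and act :: "'x \<Rightarrow> ('i \<Rightarrow> 'r::real_vector) \<Rightarrow> 'i \<Rightarrow> 'r"
    and C :: "('i \<Rightarrow> 'r) set" and I :: "'i set"
  assumes br: "X \<in> XX \<Longrightarrow> Y \<in> XX \<Longrightarrow> br X Y \<in> XX"
    and C_add: "g \<in> C \<Longrightarrow> h \<in> C \<Longrightarrow> (\<lambda>i. g i + h i) \<in> C"
    and C_scale: "g \<in> C \<Longrightarrow> (\<lambda>i. c *\<^sub>R g i) \<in> C"
    and act_add: "X \<in> XX \<Longrightarrow> g \<in> C \<Longrightarrow> h \<in> C \<Longrightarrow> i \<in> I \<Longrightarrow> act X (\<lambda>i. g i + h i) i = act X g i + act X h i"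
    and act_scale: "X \<in> XX \<Longrightarrow> g \<in> C \<Longrightarrow> i \<in> I \<Longrightarrow> act X (\<lambda>i. c *\<^sub>R g i) i = c *\<^sub>R act X g i"
begin

definition adm :: "('x list \<Rightarrow> 'i \<Rightarrow> 'r) \<Rightarrow> bool" where
  "adm F \<longleftrightarrow> (\<forall>Xs. set Xs \<subseteq> XX \<longrightarrow> F Xs \<in> C)"

lemma adm_Cons: "adm F \<Longrightarrow> X \<in> XX \<Longrightarrow> adm (\<lambda>Zs. F (X # Zs))"
  by (simp add: adm_def)

lemma adm_scale: "adm F \<Longrightarrow> adm (\<lambda>Zs i. c (length Zs) *\<^sub>R F Zs i)"
  by (simp add: adm_def C_scale)

context
  fixes i assumes i: "i \<in> I"
begin

lemma lieD_add:
  "X \<in> XX \<Longrightarrow> set Ys \<subseteq> XX \<Longrightarrow> adm F \<Longrightarrow> adm G \<Longrightarrow>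
    lieD br act X (\<lambda>Zs i. F Zs i + G Zs i) Ys i = lieD br act X F Ys i + lieD br act X G Ys i"
proof (induction Ys arbitrary: F G)
  case Nil
  then show ?case using act_add[of X "F []" "G []"] i by (simp add: adm_def)
next
  case (Cons Y Ys)
  then show ?case using Cons.IH[of "\<lambda>Zs. F (Y # Zs)" "\<lambda>Zs. G (Y # Zs)"] by (simp add: adm_Cons)
qed

lemma lieD_scale:
  "X \<in> XX \<Longrightarrow> set Ys \<subseteq> XX \<Longrightarrow> adm F \<Longrightarrow>
    lieD br act X (\<lambda>Zs i. c *\<^sub>R F Zs i) Ys i = c *\<^sub>R lieD br act X F Ys i"
proof (induction Ys arbitrary: F)
  case Nil
  then show ?case using act_scale[of X "F []"] i by (simp add: adm_def)
next
  case (Cons Y Ys)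
  then show ?case using Cons.IH[of "\<lambda>Zs. F (Y # Zs)"] by (simp add: adm_Cons scaleR_right_diff_distrib)
qed

lemma lieD_sign:
  "X \<in> XX \<Longrightarrow> set Ys \<subseteq> XX \<Longrightarrow> adm F \<Longrightarrow>
    lieD br act X (\<lambda>Zs i. (-1) ^ length Zs *\<^sub>R F Zs i) Ys i = (-1) ^ length Ys *\<^sub>R lieD br act X F Ys i"
proof (induction Ys arbitrary: F)
  case (Cons Y Ys)
  have a: "adm (\<lambda>Zs. F (Y # Zs))" using Cons.prems adm_Cons by simp
  have "lieD br act X (\<lambda>Zs i. (-1) ^ length (Y # Zs) *\<^sub>R F (Y # Zs) i) Ys i
      = lieD br act X (\<lambda>Zs i. (-1) *\<^sub>R ((-1) ^ length Zs *\<^sub>R F (Y # Zs) i)) Ys i" by simp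
  also have "\<dots> = (-1) *\<^sub>R lieD br act X (\<lambda>Zs i. (-1) ^ length Zs *\<^sub>R F (Y # Zs) i) Ys i"
    by (rule lieD_scale) (use Cons.prems a adm_scale[OF a, of "\<lambda>n. (-1) ^ n"] in auto)
  finally show ?case using Cons.IH[OF _ _ a] Cons.prems by (simp add: scaleR_right_diff_distrib)
qed simp

lemma extD_add:
  "set Xs \<subseteq> XX \<Longrightarrow> adm F \<Longrightarrow> adm G \<Longrightarrow>
    extD br act (\<lambda>Zs i. F Zs i + G Zs i) Xs i = extD br act F Xs i + extD br act G Xs i"
proof (induction Xs arbitrary: F G)
  case (Cons X Xs)
  then show ?case
    using Cons.IH[of "\<lambda>Zs. F (X # Zs)" "\<lambda>Zs. G (X # Zs)"] lieD_add[of X Xs F G] by (simp add: adm_Cons)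
qed simp

lemma extD_scale:
  "set Xs \<subseteq> XX \<Longrightarrow> adm F \<Longrightarrow> extD br act (\<lambda>Zs i. c *\<^sub>R F Zs i) Xs i = c *\<^sub>R extD br act F Xs i"
proof (induction Xs arbitrary: F)
  case (Cons X Xs)
  then show ?case
    using Cons.IH[of "\<lambda>Zs. F (X # Zs)"] lieD_scale[of X Xs F c] by (simp add: adm_Cons scaleR_right_diff_distrib)
qed simp

text \<open>The exterior derivative raises the degree by one, so (-1)^deg passes through it with an
  extra minus.\<close>

lemma extD_sign:
  "set Xs \<subseteq> XX \<Longrightarrow> adm F \<Longrightarrow>
    extD br act (\<lambda>Zs i. (-1) ^ length Zs *\<^sub>R F Zs i) Xs i = - ((-1) ^ length Xs *\<^sub>R extD br act F Xs i)"
proof (induction Xs arbitrary: F)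
  case (Cons X Xs)
  have a: "adm (\<lambda>Zs. F (X # Zs))" using Cons.prems adm_Cons by simp
  have "extD br act (\<lambda>Zs i. (-1) ^ length (X # Zs) *\<^sub>R F (X # Zs) i) Xs i
      = extD br act (\<lambda>Zs i. (-1) *\<^sub>R ((-1) ^ length Zs *\<^sub>R F (X # Zs) i)) Xs i" by simp
  also have "\<dots> = (-1) *\<^sub>R extD br act (\<lambda>Zs i. (-1) ^ length Zs *\<^sub>R F (X # Zs) i) Xs i"
    by (rule extD_scale) (use Cons.prems a adm_scale[OF a, of "\<lambda>n. (-1) ^ n"] in auto)
  finally show ?case
    using Cons.IH[OF _ a] Cons.prems lieD_sign[of X Xs F] by (simp add: scaleR_right_diff_distrib)
qed simp

text \<open>On a given list the recursion only consults \<open>F\<close> on lists shorter by one.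
  This settles the lists whose length does not fit the degree of a form.\<close>

lemma extD_zero:
  assumes F: "adm F" and Xs: "set Xs \<subseteq> XX" and "\<And>Zs. Suc (length Zs) = length Xs \<Longrightarrow> F Zs = (\<lambda>i. 0)"
  shows "extD br act F Xs i = 0"
proof -
  have l: "lieD br act X F Ys i = 0" if "X \<in> XX" "set Ys \<subseteq> XX" "adm F" "\<And>Zs. length Zs = length Ys \<Longrightarrow> F Zs = (\<lambda>i. 0)" for X Ys F
    using that
  proof (induction Ys arbitrary: F)
    case Nil
    have "F [] \<in> C" using Nil(3) by (simp add: adm_def)
    then have "act X (\<lambda>i. 0) i = 0" using act_scale[OF Nil(1) _ i, of "F []" 0] by simp
    then show ?case using Nil by simp
  next
    case (Cons Y Ys)
    have "lieD br act X (\<lambda>Zs. F (Y # Zs)) Ys i = 0"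
      by (rule Cons.IH) (use Cons.prems adm_Cons in auto)
    then show ?case using Cons.prems by simp
  qed
  show ?thesis
    using assms
  proof (induction Xs arbitrary: F)
    case (Cons X Xs)
    have "extD br act (\<lambda>Zs. F (X # Zs)) Xs i = 0"
      by (rule Cons.IH) (use Cons.prems adm_Cons in auto)
    then show ?case using Cons.prems l[of X Xs F] by simp
  qed simp
qed

end

lemma shuffle_closed:
  "(\<And>ys zs. set ys \<subseteq> XX \<Longrightarrow> set zs \<subseteq> XX \<Longrightarrow> f ys zs \<in> C) \<Longrightarrow> set Xs \<subseteq> XX \<Longrightarrow>
    (\<lambda>i. shuffle (\<lambda>ys zs. f ys zs i) Xs) \<in> C"
proof (induction Xs arbitrary: f)
  case (Cons X Xs)
  have "(\<lambda>i. shuffle (\<lambda>ys zs. f (X # ys) zs i) Xs) \<in> C"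
    by (rule Cons.IH) (use Cons.prems in auto)
  moreover have "(\<lambda>i. shuffle (\<lambda>ys zs. (-1) ^ length ys *\<^sub>R f ys (X # zs) i) Xs) \<in> C"
    by (rule Cons.IH) (use Cons.prems in \<open>auto intro: C_scale\<close>)
  ultimately show ?case by (simp add: C_add)
qed simp

end

text \<open>\<open>act2\<close> is a derivation over \<open>act1\<close>. An index of the second
  kind will be a section together with a point, and \<open>pr\<close> extracts the point, at which
  the scalar factor is evaluated.\<close>

locale derivation_action = a1: linear_action XX br act1 C1 I1 + a2: linear_action XX br act2 C2 I2
  for XX :: "'x set" and br and act1 :: "'x \<Rightarrow> ('i \<Rightarrow> real) \<Rightarrow> 'i \<Rightarrow> real" and C1 I1
    and act2 :: "'x \<Rightarrow> ('j \<Rightarrow> 'r::real_vector) \<Rightarrow> 'j \<Rightarrow> 'r" and C2 I2 +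
  fixes pr :: "'j \<Rightarrow> 'i"
  assumes pr: "j \<in> I2 \<Longrightarrow> pr j \<in> I1"
    and prod_closed: "f \<in> C1 \<Longrightarrow> g \<in> C2 \<Longrightarrow> (\<lambda>j. f (pr j) *\<^sub>R g j) \<in> C2"
    and leibniz: "X \<in> XX \<Longrightarrow> f \<in> C1 \<Longrightarrow> g \<in> C2 \<Longrightarrow> j \<in> I2 \<Longrightarrow>
      act2 X (\<lambda>j. f (pr j) *\<^sub>R g j) j = act1 X f (pr j) *\<^sub>R g j + f (pr j) *\<^sub>R act2 X g j"
begin

definition prod :: "('x list \<Rightarrow> 'i \<Rightarrow> real) \<Rightarrow> ('x list \<Rightarrow> 'j \<Rightarrow> 'r) \<Rightarrow> 'x list \<Rightarrow> 'j \<Rightarrow> 'r" where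
  "prod F G Xs j = shuffle (\<lambda>ys zs. F ys (pr j) *\<^sub>R G zs j) Xs"

text \<open>The grading sign (-1)^deg, which enters both the contraction rule
  \<open>prod_Cons\<close> and the Leibniz rule.\<close>

definition sgn1 :: "('x list \<Rightarrow> 'i \<Rightarrow> real) \<Rightarrow> 'x list \<Rightarrow> 'i \<Rightarrow> real" where
  "sgn1 F Zs i = (-1) ^ length Zs *\<^sub>R F Zs i"

lemma adm_sgn1: "a1.adm F \<Longrightarrow> a1.adm (sgn1 F)"
  unfolding sgn1_def[abs_def] using a1.adm_scale[of F "\<lambda>n. (-1) ^ n"] by simp

lemma adm_prod:
  assumes "a1.adm F" "a2.adm G"
  shows "a2.adm (prod F G)"
  unfolding a2.adm_def prod_def[abs_def]
  by (intro allI impI a2.shuffle_closed prod_closed) (use assms in \<open>auto simp: a1.adm_def a2.adm_def\<close>)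

lemma prod_Cons: "prod F G (X # Xs) j = prod (\<lambda>ys. F (X # ys)) G Xs j + prod (sgn1 F) (\<lambda>zs. G (X # zs)) Xs j"
  by (simp add: prod_def sgn1_def)

lemma prod_cong:
  assumes "set Xs \<subseteq> XX" "\<And>ys. set ys \<subseteq> XX \<Longrightarrow> F ys (pr j) = F' ys (pr j)" "\<And>ys. set ys \<subseteq> XX \<Longrightarrow> G ys j = G' ys j"
  shows "prod F G Xs j = prod F' G' Xs j"
  unfolding prod_def by (rule shuffle_cong) (use assms in auto)

lemma prod_diff_left: "prod (\<lambda>ys i. F ys i - F' ys i) G Xs j = prod F G Xs j - prod F' G Xs j"
proof -
  have "shuffle (\<lambda>ys zs. (F ys (pr j) - F' ys (pr j)) *\<^sub>R G zs j) Xs =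
      shuffle (\<lambda>ys zs. F ys (pr j) *\<^sub>R G zs j + - (F' ys (pr j) *\<^sub>R G zs j)) Xs"
    by (simp add: scaleR_left_diff_distrib)
  then show ?thesis unfolding prod_def shuffle_add shuffle_uminus by simp
qed

lemma prod_diff_right: "prod F (\<lambda>ys j. G ys j - G' ys j) Xs j = prod F G Xs j - prod F G' Xs j"
proof -
  have "shuffle (\<lambda>ys zs. F ys (pr j) *\<^sub>R (G zs j - G' zs j)) Xs =
      shuffle (\<lambda>ys zs. F ys (pr j) *\<^sub>R G zs j + - (F ys (pr j) *\<^sub>R G' zs j)) Xs"
    by (simp add: scaleR_right_diff_distrib)
  then show ?thesis unfolding prod_def shuffle_add shuffle_uminus by simp
qed

lemma prod_uminus_left: "prod (\<lambda>ys i. - F ys i) G Xs j = - prod F G Xs j"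
  unfolding prod_def by (simp add: shuffle_uminus)

text \<open>Contract with the first field: by its recursion the Lie derivative commutes with this up
  to a bracket term, and \<open>prod_Cons\<close> splits the contracted product into two products
  that fall under the induction hypothesis.\<close>

lemma lieD_prod:
  assumes "X \<in> XX" "set Ys \<subseteq> XX" "a1.adm F" "a2.adm G" and j: "j \<in> I2"
  shows "lieD br act2 X (prod F G) Ys j = prod (lieD br act1 X F) G Ys j + prod F (lieD br act2 X G) Ys j"
  using assms(2-4)
proof (induction Ys arbitrary: F G)
  case Nil
  then show ?case
    using leibniz[OF assms(1) _ _ j, of "F []" "G []"] by (simp add: prod_def a1.adm_def a2.adm_def)
next
  case (Cons Y Ys)
  let ?FY = "\<lambda>ys. F (Y # ys)" and ?GY = "\<lambda>ys. G (Y # ys)"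
  let ?L1 = "lieD br act1 X" and ?L2 = "lieD br act2 X"
  have Y: "Y \<in> XX" and Ys: "set Ys \<subseteq> XX" using Cons.prems by auto
  have a: "a1.adm ?FY" "a2.adm ?GY" using Cons.prems Y a1.adm_Cons a2.adm_Cons by auto
  have sg: "prod (?L1 (sgn1 F)) K Ys j = prod (sgn1 (?L1 F)) K Ys j" for K
    by (rule prod_cong[OF Ys])
      (use a1.lieD_sign[OF pr[OF j] assms(1) _ Cons.prems(2)] in \<open>auto simp: sgn1_def[abs_def]\<close>)
  have "?L2 (prod F G) (Y # Ys) j = ?L2 (\<lambda>Zs j. prod ?FY G Zs j + prod (sgn1 F) ?GY Zs j) Ys j
      - (prod (\<lambda>ys. F (br X Y # ys)) G Ys j + prod (sgn1 F) (\<lambda>zs. G (br X Y # zs)) Ys j)"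
    by (simp add: prod_Cons[abs_def])
  also have "?L2 (\<lambda>Zs j. prod ?FY G Zs j + prod (sgn1 F) ?GY Zs j) Ys j
      = ?L2 (prod ?FY G) Ys j + ?L2 (prod (sgn1 F) ?GY) Ys j"
    by (rule a2.lieD_add[OF j assms(1) Ys]) (use Cons.prems a in \<open>auto intro: adm_prod adm_sgn1\<close>)
  also have "?L2 (prod ?FY G) Ys j = prod (?L1 ?FY) G Ys j + prod ?FY (?L2 G) Ys j"
    by (rule Cons.IH) (use Ys a Cons.prems in auto)
  also have "?L2 (prod (sgn1 F) ?GY) Ys j = prod (sgn1 (?L1 F)) ?GY Ys j + prod (sgn1 F) (?L2 ?GY) Ys j"
    using Cons.IH[OF Ys adm_sgn1[OF Cons.prems(2)] a(2)] by (simp add: sg)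
  finally have "?L2 (prod F G) (Y # Ys) j = (prod (?L1 ?FY) G Ys j - prod (\<lambda>ys. F (br X Y # ys)) G Ys j) + prod ?FY (?L2 G) Ys j
      + prod (sgn1 (?L1 F)) ?GY Ys j + (prod (sgn1 F) (?L2 ?GY) Ys j - prod (sgn1 F) (\<lambda>zs. G (br X Y # zs)) Ys j)"
    by simp
  also have "\<dots> = prod (?L1 F) G (Y # Ys) j + prod F (?L2 G) (Y # Ys) j"
    unfolding prod_diff_left[symmetric] prod_diff_right[symmetric] prod_Cons by (simp add: add_ac lieD_Cons)
  finally show ?case .
qed

text \<open>Contract with the first field. Cartan's formula and \<open>lieD_prod\<close> treat the
  product, the induction hypothesis its two contractions; the extra minus from
  \<open>extD_sign\<close> makes the terms match \<open>prod_Cons\<close> for the right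
  side.\<close>

lemma extD_prod:
  assumes "set Xs \<subseteq> XX" "a1.adm F" "a2.adm G" and j: "j \<in> I2"
  shows "extD br act2 (prod F G) Xs j = prod (extD br act1 F) G Xs j + prod (sgn1 F) (extD br act2 G) Xs j"
  using assms(1-3)
proof (induction Xs arbitrary: F G)
  case Nil
  then show ?case by (simp add: prod_def)
next
  case (Cons X Xs)
  let ?FX = "\<lambda>ys. F (X # ys)" and ?GX = "\<lambda>ys. G (X # ys)"
  let ?L1 = "lieD br act1 X" and ?L2 = "lieD br act2 X" and ?d1 = "extD br act1" and ?d2 = "extD br act2"
  have X: "X \<in> XX" and Xs: "set Xs \<subseteq> XX" using Cons.prems by auto
  have a: "a1.adm ?FX" "a2.adm ?GX" using Cons.prems X a1.adm_Cons a2.adm_Cons by auto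
  have "?d2 (prod F G) (X # Xs) j = ?L2 (prod F G) Xs j - ?d2 (\<lambda>Zs j. prod ?FX G Zs j + prod (sgn1 F) ?GX Zs j) Xs j"
    by (simp add: prod_Cons[abs_def])
  also have "?L2 (prod F G) Xs j = prod (?L1 F) G Xs j + prod F (?L2 G) Xs j"
    by (rule lieD_prod[OF X Xs Cons.prems(2,3) j])
  also have "?d2 (\<lambda>Zs j. prod ?FX G Zs j + prod (sgn1 F) ?GX Zs j) Xs j = ?d2 (prod ?FX G) Xs j + ?d2 (prod (sgn1 F) ?GX) Xs j"
    by (rule a2.extD_add[OF j Xs]) (use Cons.prems a in \<open>auto intro: adm_prod adm_sgn1\<close>)
  also have "?d2 (prod ?FX G) Xs j = prod (?d1 ?FX) G Xs j + prod (sgn1 ?FX) (?d2 G) Xs j"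
    by (rule Cons.IH[OF Xs a(1) Cons.prems(3)])
  also have "?d2 (prod (sgn1 F) ?GX) Xs j = prod (?d1 (sgn1 F)) ?GX Xs j + prod (sgn1 (sgn1 F)) (?d2 ?GX) Xs j"
    by (rule Cons.IH[OF Xs adm_sgn1[OF Cons.prems(2)] a(2)])
  also have "sgn1 (sgn1 F) = F"
    by (simp add: sgn1_def fun_eq_iff flip: mult.assoc power_mult_distrib)
  also have "prod (?d1 (sgn1 F)) ?GX Xs j = - prod (sgn1 (?d1 F)) ?GX Xs j"
    unfolding prod_uminus_left[symmetric]
    by (rule prod_cong[OF Xs])
      (use a1.extD_sign[OF pr[OF j] _ Cons.prems(2)] in \<open>auto simp: sgn1_def[abs_def]\<close>)
  finally have "?d2 (prod F G) (X # Xs) j = (prod (?L1 F) G Xs j - prod (?d1 ?FX) G Xs j) + prod (sgn1 (?d1 F)) ?GX Xs j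
      + (- prod (sgn1 ?FX) (?d2 G) Xs j) + (prod F (?L2 G) Xs j - prod F (?d2 ?GX) Xs j)"
    by simp
  also have "- prod (sgn1 ?FX) (?d2 G) Xs j = prod (\<lambda>ys. sgn1 F (X # ys)) (?d2 G) Xs j"
    unfolding prod_uminus_left[symmetric] by (simp add: sgn1_def[abs_def])
  also have "prod F (?L2 G) Xs j - prod F (?d2 ?GX) Xs j = prod (sgn1 (sgn1 F)) (\<lambda>zs. ?d2 G (X # zs)) Xs j"
    unfolding prod_diff_right[symmetric] by (simp add: \<open>sgn1 (sgn1 F) = F\<close> extD_Cons)
  finally show ?case
    unfolding prod_diff_left[symmetric] prod_Cons by (simp add: add_ac extD_Cons)
qed

end

section \<open>Curvature as a form\<close>

lemma at_point_Cons [simp]: "at_point (X # Xs) p = X p # at_point Xs p"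
  by (simp add: at_point_def)

lemma at_point_Nil [simp]: "at_point [] p = []"
  by (simp add: at_point_def)

lemma length_at_point [simp]: "length (at_point Xs p) = length Xs"
  by (simp add: at_point_def)

section \<open>Algebra of the Lie bracket\<close>

context smooth_manifold
begin

lemma lie_bracket_skew: "lie_bracket A X Y p = - lie_bracket A Y X p"
  by (simp add: lie_bracket_def Let_def)

lemma tderiv_diff:
  fixes f :: "'m \<Rightarrow> 'b::real_normed_vector"
  assumes "open W" "smooth_fun_on A W f" "smooth_fun_on A W g" "p \<in> W"
  shows "tderiv A (\<lambda>q. f q - g q) p v = tderiv A f p v - tderiv A g p v"
proof -
  have m: "bounded_linear (\<lambda>x::'b. - x)" by (rule bounded_linear_minus[OF bounded_linear_ident])
  have "tderiv A (\<lambda>q. f q + - g q) p v = tderiv A f p v + tderiv A (\<lambda>q. - g q) p v"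
    by (rule tderiv_add[OF assms(2) smooth_fun_on_linear[OF m assms(1,3)] assms(4)])
  also have "tderiv A (\<lambda>q. - g q) p v = - tderiv A g p v"
    by (rule tderiv_linear[OF m assms(3,4)])
  finally show ?thesis by simp
qed

lemma lie_bracket_add_left:
  assumes "X \<in> vector_fields A" "X' \<in> vector_fields A" "Y \<in> vector_fields A"
  shows "lie_bracket A (\<lambda>q. X q + X' q) Y p = lie_bracket A X Y p + lie_bracket A X' Y p"
proof (rule chart_at_obtain[of p])
  fix U \<phi> assume d: "chart_at A p = (U, \<phi>)" and c: "(U, \<phi>) \<in> A" and p: "p \<in> U"
  have l1: "linear (tderiv A (\<lambda>q. tderiv A \<phi> q (Y q)) p)"
    by (rule linear_tderiv[OF vector_fieldsD[OF assms(3) c] p])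
  have "tderiv A (\<lambda>q. tderiv A \<phi> q (X q + X' q)) p = tderiv A (\<lambda>q. tderiv A \<phi> q (X q) + tderiv A \<phi> q (X' q)) p"
    by (rule tderiv_cong[OF chart_open[OF c] p]) (simp add: linear_add[OF linear_tderiv[OF smooth_fun_on_chart[OF c]]])
  then show ?thesis
    using tderiv_add[OF vector_fieldsD[OF assms(1) c] vector_fieldsD[OF assms(2) c] p]
    by (simp add: lie_bracket_def d linear_add[OF l1])
qed

lemma lie_bracket_scale_left:
  assumes h: "smooth h" and X: "X \<in> vector_fields A" and Y: "Y \<in> vector_fields A"
  shows "lie_bracket A (\<lambda>q. h q *\<^sub>R X q) Y p = h p *\<^sub>R lie_bracket A X Y p + (- tderiv A h p (Y p)) *\<^sub>R X p"
proof (rule chart_at_obtain[of p])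
  fix U \<phi> assume d: "chart_at A p = (U, \<phi>)" and c: "(U, \<phi>) \<in> A" and p: "p \<in> U"
  have l1: "linear (tderiv A (\<lambda>q. tderiv A \<phi> q (Y q)) p)"
    by (rule linear_tderiv[OF vector_fieldsD[OF Y c] p])
  have "tderiv A (\<lambda>q. tderiv A \<phi> q (h q *\<^sub>R X q)) p = tderiv A (\<lambda>q. h q *\<^sub>R tderiv A \<phi> q (X q)) p"
    by (rule tderiv_cong[OF chart_open[OF c] p]) (simp add: linear_cmul[OF linear_tderiv[OF smooth_fun_on_chart[OF c]]])
  moreover have "tderiv A (\<lambda>q. h q *\<^sub>R tderiv A \<phi> q (X q)) p (Y p)
      = h p *\<^sub>R tderiv A (\<lambda>q. tderiv A \<phi> q (X q)) p (Y p) + tderiv A h p (Y p) *\<^sub>R tderiv A \<phi> p (X p)"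
    by (rule tderiv_bilinear[OF bounded_bilinear_scaleR smooth_fun_on_subset[OF h] vector_fieldsD[OF X c] p]) simp
  ultimately show ?thesis
    by (simp add: lie_bracket_def d linear_cmul[OF l1] tderiv_chart_at[OF d] scaleR_right_diff_distrib)
qed

text \<open>In the preferred chart at \<open>p\<close> a tangent vector is its own derivative of the
  chart map. The identity thus becomes one between third derivatives of \<phi>, where all brackets
  are commutators and everything cancels.\<close>

lemma lie_bracket_jacobi:
  assumes X: "X \<in> vector_fields A" and Y: "Y \<in> vector_fields A" and Z: "Z \<in> vector_fields A"
  shows "lie_bracket A X (lie_bracket A Y Z) p = lie_bracket A (lie_bracket A X Y) Z p + lie_bracket A Y (lie_bracket A X Z) p"
proof (rule chart_at_obtain[of p])
  fix U \<phi> assume d: "chart_at A p = (U, \<phi>)" and c: "(U, \<phi>) \<in> A" and p: "p \<in> U"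
  have U: "open U" by (rule chart_open[OF c])
  define L where "L X f q = tderiv A f q (X q)" for X and f :: "'m \<Rightarrow> 'v" and q
  have sL: "smooth_fun_on A U (L X f)" if "X \<in> vector_fields A" "smooth_fun_on A U f" for X f
    unfolding L_def[abs_def] by (rule smooth_fun_on_tderiv_field[OF that(1) U that(2)])
  have s\<phi>: "smooth_fun_on A U \<phi>" by (rule smooth_fun_on_chart[OF c])
  have br: "L (lie_bracket A X Y) f q = L X (L Y f) q - L Y (L X f) q"
    if "X \<in> vector_fields A" "Y \<in> vector_fields A" "smooth_fun_on A U f" "q \<in> U" for X Y f q
    using tderiv_lie_bracket[OF that(1,2) U that(4,3)] by (simp add: L_def[abs_def])
  have br2: "L X (L (lie_bracket A Y Z) \<phi>) p = L X (L Y (L Z \<phi>)) p - L X (L Z (L Y \<phi>)) p"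
    if "X \<in> vector_fields A" "Y \<in> vector_fields A" "Z \<in> vector_fields A" for X Y Z
  proof -
    have "tderiv A (L (lie_bracket A Y Z) \<phi>) p = tderiv A (\<lambda>q. L Y (L Z \<phi>) q - L Z (L Y \<phi>) q) p"
      by (rule tderiv_cong[OF U p]) (rule br[OF that(2,3) s\<phi>])
    then show ?thesis
      using tderiv_diff[OF U sL[OF that(2) sL[OF that(3) s\<phi>]] sL[OF that(3) sL[OF that(2) s\<phi>]] p, of "X p"]
      by (simp add: L_def)
  qed
  have v: "V p = L V \<phi> p" for V by (simp add: L_def tderiv_chart_at[OF d])
  note b = lie_bracket_vector_fields
  show ?thesis
    unfolding v[of "lie_bracket A X (lie_bracket A Y Z)"] v[of "lie_bracket A (lie_bracket A X Y) Z"]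
      v[of "lie_bracket A Y (lie_bracket A X Z)"]
      br[OF X b[OF Y Z] s\<phi> p] br[OF b[OF X Y] Z s\<phi> p] br[OF Y b[OF X Z] s\<phi> p]
      br2[OF X Y Z] br2[OF Z X Y] br2[OF Y X Z]
      br[OF Y Z sL[OF X s\<phi>] p] br[OF X Y sL[OF Z s\<phi>] p] br[OF X Z sL[OF Y s\<phi>] p]
    by simp
qed

lemma vector_field_list_extension:
  obtains Xs where "set Xs \<subseteq> vector_fields A" "at_point Xs p = vs"
proof -
  have "\<exists>Xs. set Xs \<subseteq> vector_fields A \<and> at_point Xs p = vs"
  proof (induction vs)
    case Nil
    show ?case by (rule exI[of _ "[]"]) simp
  next
    case (Cons v vs)
    then obtain Xs where "set Xs \<subseteq> vector_fields A" "at_point Xs p = vs" by blast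
    moreover obtain X where "X \<in> vector_fields A" "X p = v" by (rule vector_field_extension)
    ultimately show ?case by (intro exI[of _ "X # Xs"]) simp
  qed
  then show ?thesis using that by blast
qed

end

context smooth_bundle
begin

lemma end_formsD:
  assumes "\<alpha> \<in> end_forms A E k"
  shows "\<alpha> p vs \<in> fibre_end (fibre E p)" "alternating k (\<lambda>vs. \<alpha> p vs x)"
    "\<xi> \<in> sections A E \<Longrightarrow> length Xs = k \<Longrightarrow> set Xs \<subseteq> vector_fields A \<Longrightarrow> (\<lambda>p. \<alpha> p (at_point Xs p) (\<xi> p)) \<in> sections A E"
  using assms by (auto simp: end_forms_def)

lemma end_form_outside: "\<alpha> \<in> end_forms A E k \<Longrightarrow> x \<notin> fibre E p \<Longrightarrow> \<alpha> p vs x = 0"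
  using end_formsD(1) by (auto simp: fibre_end_def)

lemma end_form_fibre: "\<alpha> \<in> end_forms A E k \<Longrightarrow> x \<in> fibre E p \<Longrightarrow> \<alpha> p vs x \<in> fibre E p"
  using end_formsD(1) by (auto simp: fibre_end_def)

lemma end_form_linear:
  "\<alpha> \<in> end_forms A E k \<Longrightarrow> x \<in> fibre E p \<Longrightarrow> y \<in> fibre E p \<Longrightarrow> \<alpha> p vs (s *\<^sub>R x + t *\<^sub>R y) = s *\<^sub>R \<alpha> p vs x + t *\<^sub>R \<alpha> p vs y"
  using end_formsD(1)[of \<alpha> k p vs] by (auto simp: fibre_end_def)

lemma end_form_eqI:
  assumes "\<alpha> \<in> end_forms A E k" "\<alpha>' \<in> end_forms A E k"
    and "\<And>p vs x. length vs = k \<Longrightarrow> x \<in> fibre E p \<Longrightarrow> \<alpha> p vs x = \<alpha>' p vs x"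
  shows "\<alpha> = \<alpha>'"
proof (intro ext)
  fix p vs x
  show "\<alpha> p vs x = \<alpha>' p vs x"
  proof (cases "length vs = k \<and> x \<in> fibre E p")
    case False
    then show ?thesis
      using end_form_outside[OF assms(1)] end_form_outside[OF assms(2)]
        alternating_length[OF end_formsD(2)[OF assms(1)]] alternating_length[OF end_formsD(2)[OF assms(2)]] by metis
  qed (use assms(3) in blast)
qed

text \<open>The description has at most one solution, because every tangent vector and every fibre
  element extends to a global field or section, on which the values are prescribed.\<close>

lemma end_form_of_eqI:
  assumes \<alpha>: "\<alpha> \<in> end_forms A E k"
    and eq: "\<And>Xs \<xi> p. \<xi> \<in> sections A E \<Longrightarrow> length Xs = k \<Longrightarrow> set Xs \<subseteq> vector_fields A \<Longrightarrow> \<alpha> p (at_point Xs p) (\<xi> p) = \<Phi> Xs \<xi> p"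
  shows "end_form_of A E k \<Phi> = \<alpha>"
  unfolding end_form_of_def
proof (rule the_equality)
  show "\<alpha> \<in> end_forms A E k \<and> (\<forall>Xs. \<forall>\<xi>\<in>sections A E. \<forall>p. length Xs = k \<and> set Xs \<subseteq> vector_fields A \<longrightarrow>
      \<alpha> p (at_point Xs p) (\<xi> p) = \<Phi> Xs \<xi> p)"
    using \<alpha> eq by blast
  fix \<alpha>' assume \<alpha>': "\<alpha>' \<in> end_forms A E k \<and> (\<forall>Xs. \<forall>\<xi>\<in>sections A E. \<forall>p. length Xs = k \<and> set Xs \<subseteq> vector_fields A \<longrightarrow>
      \<alpha>' p (at_point Xs p) (\<xi> p) = \<Phi> Xs \<xi> p)"
  show "\<alpha>' = \<alpha>"
  proof (rule end_form_eqI[OF _ \<alpha>])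
    fix p and vs :: "'v list" and x assume "length vs = k" "x \<in> fibre E p"
    obtain Xs where Xs: "set Xs \<subseteq> vector_fields A" "at_point Xs p = vs" by (rule vector_field_list_extension)
    obtain \<xi> where \<xi>: "\<xi> \<in> sections A E" "\<xi> p = x" by (rule section_extension[OF \<open>x \<in> fibre E p\<close>])
    have "length Xs = k" using Xs(2) \<open>length vs = k\<close> length_at_point by metis
    then show "\<alpha>' p vs x = \<alpha> p vs x" using \<alpha>' eq Xs \<xi> by metis
  qed (use \<alpha>' in blast)
qed

lemma end_forms_zero: "(\<lambda>p vs x. 0) \<in> end_forms A E k"
  by (auto simp: end_forms_def fibre_end_def alternating_zero sections_zero subspace_0[OF subspace_fibre])

end

section \<open>The curvature of a connection\<close>

locale bundle_connection = smooth_bundle A E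
  for A :: "('m::{t2_space,second_countable_topology}, 'v::euclidean_space) chart set" and E :: "('m, 'e::real_vector) vbundle" +
  fixes D assumes conn: "connection A E D"
begin

abbreviation "VF \<equiv> vector_fields A"
abbreviation "SE \<equiv> sections A E"

lemma conn_section: "X \<in> VF \<Longrightarrow> \<xi> \<in> SE \<Longrightarrow> D X \<xi> \<in> SE"
  using conn by (simp add: connection_def)

lemma conn_add_field: "X \<in> VF \<Longrightarrow> Y \<in> VF \<Longrightarrow> \<xi> \<in> SE \<Longrightarrow> D (\<lambda>p. X p + Y p) \<xi> = (\<lambda>p. D X \<xi> p + D Y \<xi> p)"
  by (rule conn[unfolded connection_def, THEN conjunct2, THEN conjunct1, rule_format])

lemma conn_scale_field: "smooth h \<Longrightarrow> X \<in> VF \<Longrightarrow> \<xi> \<in> SE \<Longrightarrow> D (\<lambda>p. h p *\<^sub>R X p) \<xi> = (\<lambda>p. h p *\<^sub>R D X \<xi> p)"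
  by (rule conn[unfolded connection_def, THEN conjunct2, THEN conjunct2, THEN conjunct1, rule_format])

lemma conn_add: "X \<in> VF \<Longrightarrow> \<xi> \<in> SE \<Longrightarrow> \<eta> \<in> SE \<Longrightarrow> D X (\<lambda>p. \<xi> p + \<eta> p) = (\<lambda>p. D X \<xi> p + D X \<eta> p)"
  by (rule conn[unfolded connection_def, THEN conjunct2, THEN conjunct2, THEN conjunct2, THEN conjunct1, rule_format])

lemma conn_leibniz: "smooth h \<Longrightarrow> X \<in> VF \<Longrightarrow> \<xi> \<in> SE \<Longrightarrow>
    D X (\<lambda>p. h p *\<^sub>R \<xi> p) = (\<lambda>p. tderiv A h p (X p) *\<^sub>R \<xi> p + h p *\<^sub>R D X \<xi> p)"
  by (rule conn[unfolded connection_def, THEN conjunct2, THEN conjunct2, THEN conjunct2, THEN conjunct2, rule_format])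

lemma conn_const_scale: "X \<in> VF \<Longrightarrow> \<xi> \<in> SE \<Longrightarrow> D X (\<lambda>p. c *\<^sub>R \<xi> p) = (\<lambda>p. c *\<^sub>R D X \<xi> p)"
  using conn_leibniz[OF smooth_const[of c]] by (simp add: tderiv_const)

lemma sections_diff: "\<xi> \<in> SE \<Longrightarrow> \<eta> \<in> SE \<Longrightarrow> (\<lambda>p. \<xi> p - \<eta> p) \<in> SE"
  using sections_add[of \<xi> "\<lambda>p. (-1) *\<^sub>R \<eta> p"] sections_scale[OF smooth_const[of "-1"]] by simp

lemma conn_diff:
  assumes "X \<in> VF" "\<xi> \<in> SE" "\<eta> \<in> SE"
  shows "D X (\<lambda>p. \<xi> p - \<eta> p) = (\<lambda>p. D X \<xi> p - D X \<eta> p)"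
  using conn_add[OF assms(1,2) sections_scale[OF smooth_const[of "-1"] assms(3)]]
    conn_const_scale[OF assms(1,3), of "-1"] by simp

definition curv :: "('m \<Rightarrow> 'v) \<Rightarrow> ('m \<Rightarrow> 'v) \<Rightarrow> ('m \<Rightarrow> 'e) \<Rightarrow> 'm \<Rightarrow> 'e" where
  "curv X Y \<xi> p = D X (D Y \<xi>) p - D Y (D X \<xi>) p - D (lie_bracket A X Y) \<xi> p"

lemmas br = lie_bracket_vector_fields

lemma curv_section: "X \<in> VF \<Longrightarrow> Y \<in> VF \<Longrightarrow> \<xi> \<in> SE \<Longrightarrow> curv X Y \<xi> \<in> SE"
  unfolding curv_def[abs_def] by (intro sections_diff conn_section br)

lemma curv_skew:
  assumes "X \<in> VF" "Y \<in> VF" "\<xi> \<in> SE"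
  shows "curv X Y \<xi> p = - curv Y X \<xi> p"
proof -
  have "lie_bracket A X Y = (\<lambda>p. (-1) *\<^sub>R lie_bracket A Y X p)"
    by (rule ext) (simp add: lie_bracket_skew[of X Y])
  then have "D (lie_bracket A X Y) \<xi> = (\<lambda>p. (-1) *\<^sub>R D (lie_bracket A Y X) \<xi> p)"
    using conn_scale_field[OF smooth_const br[OF assms(2,1)] assms(3), of "-1"] by simp
  then show ?thesis by (simp add: curv_def)
qed

text \<open>The derivative of h occurs twice and cancels: once from \<nabla>_Y applied to h
  \<nabla>_X \<xi>, and once from the summand - (Y h) X of the bracket of h X with Y.\<close>

lemma curv_tensorial_left:
  assumes Y: "Y \<in> VF" and \<xi>: "\<xi> \<in> SE"
  shows "tensorial_at VF p (\<lambda>X. curv X Y \<xi> p)"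
  unfolding tensorial_at_def
proof (intro conjI allI ballI impI)
  fix X X' assume X: "X \<in> VF" "X' \<in> VF"
  have "lie_bracket A (\<lambda>q. X q + X' q) Y = (\<lambda>q. lie_bracket A X Y q + lie_bracket A X' Y q)"
    using lie_bracket_add_left[OF X Y] by auto
  then show "curv (\<lambda>q. X q + X' q) Y \<xi> p = curv X Y \<xi> p + curv X' Y \<xi> p"
    unfolding curv_def using X Y \<xi>
    by (simp add: conn_add_field conn_section conn_add br)
next
  fix h X assume h: "smooth h" and X: "X \<in> VF"
  have Yh: "smooth (\<lambda>q. - tderiv A h q (Y q))"
    by (rule smooth_fun_on_linear[OF bounded_linear_minus[OF bounded_linear_ident] open_UNIV
          smooth_fun_on_tderiv_field[OF Y open_UNIV h]])
  have "lie_bracket A (\<lambda>q. h q *\<^sub>R X q) Y = (\<lambda>q. h q *\<^sub>R lie_bracket A X Y q + (- tderiv A h q (Y q)) *\<^sub>R X q)"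
    using lie_bracket_scale_left[OF h X Y] by auto
  then have "D (lie_bracket A (\<lambda>q. h q *\<^sub>R X q) Y) \<xi> p = h p *\<^sub>R D (lie_bracket A X Y) \<xi> p + (- tderiv A h p (Y p)) *\<^sub>R D X \<xi> p"
    using conn_add_field[OF vector_fields_scale[OF h br[OF X Y]] vector_fields_scale[OF Yh X] \<xi>]
      conn_scale_field[OF h br[OF X Y] \<xi>] conn_scale_field[OF Yh X \<xi>] by simp
  then show "curv (\<lambda>q. h q *\<^sub>R X q) Y \<xi> p = h p *\<^sub>R curv X Y \<xi> p"
    unfolding curv_def conn_scale_field[OF h X \<xi>] conn_scale_field[OF h X conn_section[OF Y \<xi>]]
      conn_leibniz[OF h Y conn_section[OF X \<xi>]]
    by (simp add: algebra_simps)
qed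

lemma curv_tensorial_right:
  assumes X: "X \<in> VF" and \<xi>: "\<xi> \<in> SE"
  shows "tensorial_at VF p (\<lambda>Y. curv X Y \<xi> p)"
  unfolding tensorial_at_def
proof (intro conjI allI ballI impI)
  note t = curv_tensorial_left[OF X \<xi>, of p]
  fix Y Y' assume Y: "Y \<in> VF" "Y' \<in> VF"
  show "curv X (\<lambda>q. Y q + Y' q) \<xi> p = curv X Y \<xi> p + curv X Y' \<xi> p"
    using tensorial_at_add[OF t Y] curv_skew[OF X Y(1) \<xi>, of p] curv_skew[OF X Y(2) \<xi>, of p]
      curv_skew[OF X vector_fields_add[OF Y] \<xi>, of p] by simp
next
  note t = curv_tensorial_left[OF X \<xi>, of p]
  fix h Y assume h: "smooth h" and Y: "Y \<in> VF"
  show "curv X (\<lambda>q. h q *\<^sub>R Y q) \<xi> p = h p *\<^sub>R curv X Y \<xi> p"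
    using tensorial_at_scale[OF t h Y] curv_skew[OF X Y \<xi>, of p]
      curv_skew[OF X vector_fields_scale[OF h Y] \<xi>, of p] by simp
qed

text \<open>Terms with one derivative of h are symmetric in X and Y and drop out of the commutator.
  Those with two derivatives are cancelled by the bracket, which acts on h as a commutator.\<close>

lemma curv_tensorial_section:
  assumes X: "X \<in> VF" and Y: "Y \<in> VF"
  shows "tensorial_at SE p (\<lambda>\<xi>. curv X Y \<xi> p)"
  unfolding tensorial_at_def
proof (intro conjI allI ballI impI)
  fix \<xi> \<eta> assume "\<xi> \<in> SE" "\<eta> \<in> SE"
  then show "curv X Y (\<lambda>q. \<xi> q + \<eta> q) p = curv X Y \<xi> p + curv X Y \<eta> p"
    unfolding curv_def using X Y by (simp add: conn_add conn_section br)
next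
  fix h \<xi> assume h: "smooth h" and \<xi>: "\<xi> \<in> SE"
  have Z: "smooth (\<lambda>q. tderiv A h q (Z q))" if "Z \<in> VF" for Z
    by (rule smooth_fun_on_tderiv_field[OF that open_UNIV h])
  have 2: "D X (D Y (\<lambda>q. h q *\<^sub>R \<xi> q)) p = tderiv A (\<lambda>q. tderiv A h q (Y q)) p (X p) *\<^sub>R \<xi> p
      + tderiv A h p (Y p) *\<^sub>R D X \<xi> p + tderiv A h p (X p) *\<^sub>R D Y \<xi> p + h p *\<^sub>R D X (D Y \<xi>) p"
    if X: "X \<in> VF" and Y: "Y \<in> VF" for X Y
    unfolding conn_leibniz[OF h Y \<xi>]
      conn_add[OF X sections_scale[OF Z[OF Y] \<xi>] sections_scale[OF h conn_section[OF Y \<xi>]]]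
      conn_leibniz[OF Z[OF Y] X \<xi>] conn_leibniz[OF h X conn_section[OF Y \<xi>]] by simp
  show "curv X Y (\<lambda>q. h q *\<^sub>R \<xi> q) p = h p *\<^sub>R curv X Y \<xi> p"
    unfolding curv_def 2[OF X Y] 2[OF Y X] conn_leibniz[OF h br[OF X Y] \<xi>]
      tderiv_lie_bracket[OF X Y open_UNIV UNIV_I h]
    by (simp add: algebra_simps)
qed

lemma curv_cong:
  assumes X: "X \<in> VF" "X' \<in> VF" "X p = X' p" and Y: "Y \<in> VF" "Y' \<in> VF" "Y p = Y' p"
    and \<xi>: "\<xi> \<in> SE" "\<xi>' \<in> SE" "\<xi> p = \<xi>' p"
  shows "curv X Y \<xi> p = curv X' Y' \<xi>' p"
proof -
  have "curv X Y \<xi> p = curv X' Y \<xi> p"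
    by (rule tensorial_at_eq[OF smooth_module_vector_fields curv_tensorial_left[OF Y(1) \<xi>(1)] X
          vector_fields_vanishing_decomposition])
  also have "\<dots> = curv X' Y' \<xi> p"
    by (rule tensorial_at_eq[OF smooth_module_vector_fields curv_tensorial_right[OF X(2) \<xi>(1)] Y
          vector_fields_vanishing_decomposition])
  also have "\<dots> = curv X' Y' \<xi>' p"
    by (rule tensorial_at_eq[OF smooth_module_sections curv_tensorial_section[OF X(2) Y(2)] \<xi>
          sections_vanishing_decomposition])
  finally show ?thesis .
qed

definition field_ext :: "'m \<Rightarrow> 'v \<Rightarrow> 'm \<Rightarrow> 'v" where
  "field_ext p v = (SOME X. X \<in> VF \<and> X p = v)"

lemma field_ext: "field_ext p v \<in> VF" "field_ext p v p = v"
proof -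
  have "\<exists>X. X \<in> VF \<and> X p = v" using vector_field_extension by metis
  then have "field_ext p v \<in> VF \<and> field_ext p v p = v"
    unfolding field_ext_def by (rule someI_ex)
  then show "field_ext p v \<in> VF" "field_ext p v p = v" by auto
qed

definition section_ext :: "'m \<Rightarrow> 'e \<Rightarrow> 'm \<Rightarrow> 'e" where
  "section_ext p x = (SOME \<xi>. \<xi> \<in> SE \<and> \<xi> p = x)"

lemma section_ext: assumes "x \<in> fibre E p" shows "section_ext p x \<in> SE" "section_ext p x p = x"
proof -
  have "\<exists>\<xi>. \<xi> \<in> SE \<and> \<xi> p = x" using section_extension[OF assms] by metis
  then have "section_ext p x \<in> SE \<and> section_ext p x p = x"
    unfolding section_ext_def by (rule someI_ex)
  then show "section_ext p x \<in> SE" "section_ext p x p = x" by auto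
qed

text \<open>The extensions of the arguments to fields and sections are arbitrary choices;
  \<open>curv_cong\<close> shows that the value does not depend on them.\<close>

definition curv_form :: "'m \<Rightarrow> 'v list \<Rightarrow> 'e \<Rightarrow> 'e" where
  "curv_form p vs x = (if length vs = 2 \<and> x \<in> fibre E p
     then curv (field_ext p (vs ! 0)) (field_ext p (vs ! 1)) (section_ext p x) p else 0)"

lemma curv_form_apply:
  assumes "X \<in> VF" "Y \<in> VF" "\<xi> \<in> SE"
  shows "curv_form p [X p, Y p] (\<xi> p) = curv X Y \<xi> p"
proof -
  note f = sections_fibre[OF assms(3), of p]
  have "curv (field_ext p (X p)) (field_ext p (Y p)) (section_ext p (\<xi> p)) p = curv X Y \<xi> p"
    by (rule curv_cong) (simp_all add: field_ext section_ext[OF f] assms)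
  then show ?thesis using f by (simp add: curv_form_def)
qed

lemma curv_form_end_form: "curv_form \<in> end_forms A E 2"
  unfolding end_forms_def
proof (intro CollectI conjI allI ballI impI)
  fix p vs
  show "curv_form p vs \<in> fibre_end (fibre E p)"
    unfolding fibre_end_def
  proof (intro CollectI conjI allI ballI impI)
    fix x assume "x \<in> fibre E p"
    then show "curv_form p vs x \<in> fibre E p"
      using sections_fibre[OF curv_section[OF field_ext(1)[of p "vs ! 0"] field_ext(1)[of p "vs ! 1"] section_ext(1)], of x p p]
        subspace_0[OF subspace_fibre, of p]
      by (simp add: curv_form_def)
  next
    fix x assume "x \<notin> fibre E p"
    then show "curv_form p vs x = 0" by (simp add: curv_form_def)
  next
    fix x y s t assume xy: "x \<in> fibre E p" "y \<in> fibre E p"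
    then have m: "s *\<^sub>R x + t *\<^sub>R y \<in> fibre E p"
      using subspace_fibre by (simp add: subspace_add subspace_mul)
    let ?X = "field_ext p (vs ! 0)" and ?Y = "field_ext p (vs ! 1)"
    note tn = curv_tensorial_section[OF field_ext(1)[of p "vs ! 0"] field_ext(1)[of p "vs ! 1"], of p]
    note e = section_ext[OF xy(1)] section_ext[OF xy(2)] section_ext[OF m]
    note sc = sections_scale[OF smooth_const[of s] e(1)] sections_scale[OF smooth_const[of t] e(3)]
    have "curv ?X ?Y (section_ext p (s *\<^sub>R x + t *\<^sub>R y)) p
        = curv ?X ?Y (\<lambda>q. s *\<^sub>R section_ext p x q + t *\<^sub>R section_ext p y q) p"
      by (rule curv_cong) (use e sc field_ext in \<open>auto intro: sections_add\<close>)
    also have "\<dots> = s *\<^sub>R curv ?X ?Y (section_ext p x) p + t *\<^sub>R curv ?X ?Y (section_ext p y) p"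
      using tensorial_at_add[OF tn sc] tensorial_at_scale[OF tn smooth_const e(1), of s]
        tensorial_at_scale[OF tn smooth_const e(3), of t] by simp
    finally show "curv_form p vs (s *\<^sub>R x + t *\<^sub>R y) = s *\<^sub>R curv_form p vs x + t *\<^sub>R curv_form p vs y"
      using xy m by (simp add: curv_form_def)
  qed
next
  fix p x
  show "alternating 2 (\<lambda>vs. curv_form p vs x)"
  proof (cases "x \<in> fibre E p")
    case False
    then have "(\<lambda>vs. curv_form p vs x) = (\<lambda>vs. 0)" by (simp add: curv_form_def)
    then show ?thesis using alternating_zero by metis
  next
    case True
    note e = section_ext[OF True]
    define C where "C u v = curv (field_ext p u) (field_ext p v) (section_ext p x) p" for u v
    have form: "curv_form p vs x = (if length vs = 2 then C (vs ! 0) (vs ! 1) else 0)" for vs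
      using True by (simp add: curv_form_def C_def)
    note tl = curv_tensorial_left[OF field_ext(1) e(1)]
    have skew: "C u v = - C v u" for u v
      unfolding C_def by (rule curv_skew[OF field_ext(1) field_ext(1) e(1)])
    have add: "C (u + u') v = C u v + C u' v" for u u' v
    proof -
      have "C (u + u') v = curv (\<lambda>q. field_ext p u q + field_ext p u' q) (field_ext p v) (section_ext p x) p"
        unfolding C_def by (rule curv_cong) (use e field_ext in \<open>auto intro: vector_fields_add\<close>)
      then show ?thesis unfolding C_def using tensorial_at_add[OF tl field_ext(1) field_ext(1)] by simp
    qed
    have scale: "C (c *\<^sub>R u) v = c *\<^sub>R C u v" for c u v
    proof -
      have "C (c *\<^sub>R u) v = curv (\<lambda>q. c *\<^sub>R field_ext p u q) (field_ext p v) (section_ext p x) p"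
        unfolding C_def by (rule curv_cong) (use e field_ext vector_fields_scale[OF smooth_const] in auto)
      then show ?thesis unfolding C_def using tensorial_at_scale[OF tl smooth_const field_ext(1)] by simp
    qed
    have l1: "linear (\<lambda>u. C u v)" for v by (rule linearI) (simp_all add: add scale)
    have l2: "linear (C u)" for u
      by (rule linearI) (metis skew add minus_add_distrib, metis skew scale scaleR_minus_right)
    have diag: "C u u = 0" for u
    proof -
      have "2 *\<^sub>R C u u = 0" using skew[of u u] by (simp add: scaleR_2 eq_neg_iff_add_eq_0)
      then show ?thesis by simp
    qed
    show ?thesis
      unfolding alternating_def
    proof (intro conjI allI impI)
      fix vs :: "'v list" and i :: nat assume a: "length vs = 2 \<and> i < 2"
      then have "i = 0 \<or> i = 1" by auto
      moreover obtain u v where "vs = [u, v]"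
        using a by (auto simp: numeral_2_eq_2 length_Suc_conv)
      ultimately show "linear (\<lambda>v. curv_form p (vs[i := v]) x)"
        using l1 l2 by (auto simp: form)
    next
      fix vs :: "'v list" and i j assume a: "length vs = 2 \<and> i < j \<and> j < 2 \<and> vs ! i = vs ! j"
      then have "i = 0 \<and> j = 1" by linarith
      then have "vs ! 0 = vs ! 1" using a by blast
      then show "curv_form p vs x = 0" by (simp add: form diag)
    qed (simp add: form)
  qed
next
  fix Xs \<xi> assume \<xi>: "\<xi> \<in> SE" and Xs: "length Xs = 2 \<and> set Xs \<subseteq> VF"
  then obtain X Y where "Xs = [X, Y]" by (auto simp: numeral_2_eq_2 length_Suc_conv)
  then show "(\<lambda>p. curv_form p (at_point Xs p) (\<xi> p)) \<in> SE"
    using Xs \<xi> curv_section by (simp add: curv_form_apply)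
qed

lemma curvature_eq: "curvature A E D = curv_form"
  unfolding curvature_def
proof (rule end_form_of_eqI[OF curv_form_end_form])
  fix Xs \<xi> p assume \<xi>: "\<xi> \<in> SE" and Xs: "length Xs = 2" "set Xs \<subseteq> VF"
  then obtain X Y where "Xs = [X, Y]" by (auto simp: numeral_2_eq_2 length_Suc_conv)
  then show "curv_form p (at_point Xs p) (\<xi> p) =
      (let X = Xs ! 0; Y = Xs ! 1 in D X (D Y \<xi>) p - D Y (D X \<xi>) p - D (lie_bracket A X Y) \<xi> p)"
    using Xs \<xi> by (simp add: curv_form_apply curv_def)
qed

end

section \<open>The Bianchi identity and the symplectic Hodge operator\<close>

lemma antisym_list_map: "antisym_list a \<Longrightarrow> antisym_list (\<lambda>Zs. a (map g Zs))"
  unfolding antisym_list_def insert_at_def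
  by (metis (no_types, lifting) drop_map length_map list.simps(9) map_append take_map)

lemma shuffle_subspace: "subspace V \<Longrightarrow> (\<And>ys zs. f ys zs \<in> V) \<Longrightarrow> shuffle f xs \<in> V"
  by (induction xs arbitrary: f) (simp_all add: subspace_add subspace_mul)

lemma wedge2_subspace: "subspace V \<Longrightarrow> (\<And>zs. \<theta> zs \<in> V) \<Longrightarrow> wedge2 w \<theta> xs \<in> V"
  unfolding wedge2_def by (intro shuffle_subspace subspace_mul)

lemma wedge2_iter_subspace: "subspace V \<Longrightarrow> (\<And>zs. \<theta> zs \<in> V) \<Longrightarrow> (wedge2 w ^^ k) \<theta> xs \<in> V"
  by (induction k arbitrary: xs) (auto intro: wedge2_subspace)

lemma shuffle_hom:
  assumes V: "subspace V" and h: "\<And>x y s t. x \<in> V \<Longrightarrow> y \<in> V \<Longrightarrow> h (s *\<^sub>R x + t *\<^sub>R y) = s *\<^sub>R h x + t *\<^sub>R h y"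
    and f: "\<And>ys zs. f ys zs \<in> V"
  shows "h (shuffle f xs) = shuffle (\<lambda>ys zs. h (f ys zs)) xs"
  using f
proof (induction xs arbitrary: f)
  case (Cons x xs)
  have a: "h (u + v) = h u + h v" if "u \<in> V" "v \<in> V" for u v using h[OF that, of 1 1] by simp
  have s: "h (c *\<^sub>R u) = c *\<^sub>R h u" if "u \<in> V" for u c using h[OF that that, of c 0] by simp
  have 1: "shuffle (\<lambda>ys zs. f (x # ys) zs) xs \<in> V" "shuffle (\<lambda>ys zs. (-1) ^ length ys *\<^sub>R f ys (x # zs)) xs \<in> V"
    using V Cons.prems by (auto intro!: shuffle_subspace subspace_mul)
  have 2: "h (shuffle (\<lambda>ys zs. (-1) ^ length ys *\<^sub>R f ys (x # zs)) xs) = shuffle (\<lambda>ys zs. h ((-1) ^ length ys *\<^sub>R f ys (x # zs))) xs"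
    by (rule Cons.IH) (use V Cons.prems in \<open>auto intro: subspace_mul\<close>)
  show ?case
    using Cons.IH[of "\<lambda>ys. f (x # ys)", OF Cons.prems] 2 by (simp add: a[OF 1] s[OF Cons.prems])
qed simp

lemma wedge2_iter_hom:
  assumes V: "subspace V" and h: "\<And>x y s t. x \<in> V \<Longrightarrow> y \<in> V \<Longrightarrow> h (s *\<^sub>R x + t *\<^sub>R y) = s *\<^sub>R h x + t *\<^sub>R h y"
    and \<theta>: "\<And>zs. \<theta> zs \<in> V"
  shows "h ((wedge2 w ^^ k) \<theta> xs) = (wedge2 w ^^ k) (\<lambda>zs. h (\<theta> zs)) xs"
proof (induction k arbitrary: xs)
  case (Suc k)
  let ?\<theta> = "(wedge2 w ^^ k) \<theta>"
  have m: "?\<theta> zs \<in> V" for zs by (rule wedge2_iter_subspace[OF V \<theta>])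
  have s: "h (c *\<^sub>R u) = c *\<^sub>R h u" if "u \<in> V" for u c using h[OF that that, of c 0] by simp
  have "h (wedge2 w ?\<theta> xs) = shuffle (\<lambda>ys zs. h (w ys *\<^sub>R ?\<theta> zs)) xs"
    unfolding wedge2_def by (rule shuffle_hom[OF V h]) (use V m[unfolded wedge2_def] in \<open>auto intro: subspace_mul\<close>)
  also have "\<dots> = wedge2 w (\<lambda>zs. h (?\<theta> zs)) xs"
    by (simp add: s m) (simp add: wedge2_def)
  finally show ?case using Suc.IH by simp
qed simp

section \<open>The covariant exterior derivative and the Bianchi identity\<close>

context bundle_connection
begin

definition actR :: "('m \<Rightarrow> 'v) \<Rightarrow> ('m \<Rightarrow> real) \<Rightarrow> 'm \<Rightarrow> real" where
  "actR X g p = tderiv A g p (X p)"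

text \<open>An \<open>End(E)\<close>-valued function is evaluated on a pair of a section and a point.\<close>

definition actE :: "('m \<Rightarrow> 'v) \<Rightarrow> (('m \<Rightarrow> 'e) \<times> 'm \<Rightarrow> 'e) \<Rightarrow> ('m \<Rightarrow> 'e) \<times> 'm \<Rightarrow> 'e" where
  "actE X g j = D X (\<lambda>q. g (fst j, q)) (snd j) - g (D X (fst j), snd j)"

definition endos :: "(('m \<Rightarrow> 'e) \<times> 'm \<Rightarrow> 'e) set" where
  "endos = {g. \<forall>\<xi>\<in>SE. (\<lambda>p. g (\<xi>, p)) \<in> SE}"

sublocale da: derivation_action VF "lie_bracket A" actR "Collect smooth" UNIV actE endos "SE \<times> UNIV" snd
proof unfold_locales
  fix X Y assume "X \<in> VF" "Y \<in> VF"
  then show "lie_bracket A X Y \<in> VF" by (rule br)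
next
  fix g h assume "g \<in> Collect smooth" "h \<in> Collect smooth"
  then show "(\<lambda>i. g i + h i) \<in> Collect smooth" using smooth_fun_on_add[OF open_UNIV, of g h] by simp
next
  fix g c assume "g \<in> Collect smooth"
  then show "(\<lambda>i. c *\<^sub>R g i) \<in> Collect smooth"
    using smooth_fun_on_scaleR[OF open_UNIV smooth_const, of g c] by simp
next
  fix X g h i assume "g \<in> Collect smooth" "h \<in> Collect smooth"
  then show "actR X (\<lambda>i. g i + h i) i = actR X g i + actR X h i"
    using tderiv_add[of UNIV g h] by (simp add: actR_def)
next
  fix X g i c assume "g \<in> Collect smooth"
  then show "actR X (\<lambda>i. c *\<^sub>R g i) i = c *\<^sub>R actR X g i"
    using tderiv_linear[OF bounded_linear_scaleR_right[of c], of UNIV g] by (simp add: actR_def)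
next
  fix g h assume "g \<in> endos" "h \<in> endos"
  then show "(\<lambda>i. g i + h i) \<in> endos" by (simp add: endos_def sections_add)
next
  fix g c assume "g \<in> endos"
  then show "(\<lambda>i. c *\<^sub>R g i) \<in> endos" by (simp add: endos_def sections_scale[OF smooth_const])
next
  fix X g h j assume "X \<in> VF" "g \<in> endos" "h \<in> endos" "j \<in> SE \<times> (UNIV :: 'm set)"
  then show "actE X (\<lambda>i. g i + h i) j = actE X g j + actE X h j"
    using conn_add[of X "\<lambda>q. g (fst j, q)" "\<lambda>q. h (fst j, q)"] by (auto simp: actE_def endos_def)
next
  fix X g j c assume "X \<in> VF" "g \<in> endos" "j \<in> SE \<times> (UNIV :: 'm set)"
  then show "actE X (\<lambda>i. c *\<^sub>R g i) j = c *\<^sub>R actE X g j"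
    using conn_const_scale[of X "\<lambda>q. g (fst j, q)" c] by (auto simp: actE_def endos_def scaleR_right_diff_distrib)
next
  fix f g assume "f \<in> Collect smooth" "g \<in> endos"
  then show "(\<lambda>j. f (snd j) *\<^sub>R g j) \<in> endos" by (simp add: endos_def sections_scale)
next
  fix X f g j assume "X \<in> VF" "f \<in> Collect smooth" "g \<in> endos" "j \<in> SE \<times> (UNIV :: 'm set)"
  then show "actE X (\<lambda>j. f (snd j) *\<^sub>R g j) j = actR X f (snd j) *\<^sub>R g j + f (snd j) *\<^sub>R actE X g j"
    using conn_leibniz[of f X "\<lambda>q. g (fst j, q)"]
    by (auto simp: actE_def actR_def endos_def scaleR_right_diff_distrib)
qed auto

definition on_fields :: "('m \<Rightarrow> 'v list \<Rightarrow> 'e \<Rightarrow> 'e) \<Rightarrow> ('m \<Rightarrow> 'v) list \<Rightarrow> ('m \<Rightarrow> 'e) \<times> 'm \<Rightarrow> 'e" where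
  "on_fields \<alpha> Xs j = \<alpha> (snd j) (at_point Xs (snd j)) (fst j (snd j))"

lemma adm_on_fields:
  assumes \<alpha>: "\<alpha> \<in> end_forms A E k"
  shows "da.a2.adm (on_fields \<alpha>)"
  unfolding da.a2.adm_def
proof (intro allI impI)
  fix Xs assume Xs: "set Xs \<subseteq> VF"
  have "(\<lambda>p. on_fields \<alpha> Xs (\<xi>, p)) \<in> SE" if \<xi>: "\<xi> \<in> SE" for \<xi>
  proof (cases "length Xs = k")
    case True
    then show ?thesis using end_formsD(3)[OF \<alpha> \<xi> True Xs] by (simp add: on_fields_def)
  next
    case False
    then show ?thesis
      using alternating_length[OF end_formsD(2)[OF \<alpha>]] sections_zero by (simp add: on_fields_def)
  qed
  then show "on_fields \<alpha> Xs \<in> endos" by (simp add: endos_def)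
qed

text \<open>By \<open>Koszul_formula\<close> the zero form satisfies the description, so vanishing
  can be checked on the recursion \<open>extD\<close>, for which the Leibniz rule is
  available.\<close>

lemma cov_ext_deriv_zero:
  assumes \<alpha>: "\<alpha> \<in> end_forms A E k"
    and 0: "\<And>Xs j. set Xs \<subseteq> VF \<Longrightarrow> j \<in> SE \<times> UNIV \<Longrightarrow> extD (lie_bracket A) actE (on_fields \<alpha>) Xs j = 0"
  shows "cov_ext_deriv A E D k \<alpha> = (\<lambda>p vs x. 0)"
  unfolding cov_ext_deriv_def
proof (rule end_form_of_eqI[OF end_forms_zero])
  fix Xs \<xi> p assume \<xi>: "\<xi> \<in> SE" and Xs: "length Xs = Suc k" "set Xs \<subseteq> VF"
  have as: "antisym_list (\<lambda>Zs. on_fields \<alpha> Zs j)" for j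
    unfolding on_fields_def at_point_def
    by (rule antisym_list_map) (rule alternating_antisym_list[OF end_formsD(2)[OF \<alpha>]])
  have "extD (lie_bracket A) actE (on_fields \<alpha>) Xs (\<xi>, p) = 0"
    using 0 Xs \<xi> by simp
  then show "0 = (\<Sum>i\<le>k. (-1) ^ i *\<^sub>R end_connection D (Xs ! i) (\<lambda>q. \<alpha> q (at_point (omit i Xs) q)) \<xi> p) +
      (\<Sum>j\<le>k. \<Sum>i<j. (-1) ^ (i + j) *\<^sub>R
        \<alpha> p (lie_bracket A (Xs ! i) (Xs ! j) p # at_point (omit i (omit j Xs)) p) (\<xi> p))"
    unfolding Koszul_formula[OF as, symmetric]
    by (simp add: Xs(1) lessThan_Suc_atMost actE_def end_connection_def on_fields_def)
qed

text \<open>Only lists of three fields matter. Triple derivatives cancel among the three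
  arrangements, terms with one bracket cancel against those of the curvature on a bracket, and
  nested brackets vanish by Jacobi.\<close>

lemma bianchi:
  assumes Xs: "set Xs \<subseteq> VF" and j: "j \<in> SE \<times> UNIV"
  shows "extD (lie_bracket A) actE (on_fields curv_form) Xs j = 0"
proof (cases "length Xs = 3")
  case False
  show ?thesis
    by (rule da.a2.extD_zero[OF j adm_on_fields[OF curv_form_end_form] Xs])
      (use False in \<open>auto simp: on_fields_def curv_form_def fun_eq_iff\<close>)
next
  case True
  then obtain X Y Z where XYZ: "Xs = [X, Y, Z]"
    by (auto simp: numeral_3_eq_3 length_Suc_conv)
  then have X: "X \<in> VF" "Y \<in> VF" "Z \<in> VF" using Xs by auto
  obtain \<xi> p where jp: "j = (\<xi>, p)" "\<xi> \<in> SE" using j by auto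
  have R: "on_fields curv_form [X, Y] (\<xi>, p) = curv X Y \<xi> p" if "X \<in> VF" "Y \<in> VF" "\<xi> \<in> SE" for X Y \<xi> p
    using curv_form_apply[OF that] by (simp add: on_fields_def)
  have a: "actE X (on_fields curv_form [Y, Z]) (\<xi>, p) =
      D X (D Y (D Z \<xi>)) p - D X (D Z (D Y \<xi>)) p - D X (D (lie_bracket A Y Z) \<xi>) p
      - (D Y (D Z (D X \<xi>)) p - D Z (D Y (D X \<xi>)) p - D (lie_bracket A Y Z) (D X \<xi>) p)"
    if X: "X \<in> VF" "Y \<in> VF" "Z \<in> VF" for X Y Z
  proof -
    have s: "D Y (D Z \<xi>) \<in> SE" "D Z (D Y \<xi>) \<in> SE" "D (lie_bracket A Y Z) \<xi> \<in> SE"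
      using X jp br by (auto intro: conn_section)
    have "actE X (on_fields curv_form [Y, Z]) (\<xi>, p) = D X (\<lambda>q. curv Y Z \<xi> q) p - curv Y Z (D X \<xi>) p"
      using X jp by (simp add: actE_def R conn_section)
    also have "(\<lambda>q. curv Y Z \<xi> q) = (\<lambda>q. (D Y (D Z \<xi>) q - D Z (D Y \<xi>) q) - D (lie_bracket A Y Z) \<xi> q)"
      by (simp add: curv_def)
    also have "D X \<dots> p = D X (D Y (D Z \<xi>)) p - D X (D Z (D Y \<xi>)) p - D X (D (lie_bracket A Y Z) \<xi>) p"
      unfolding conn_diff[OF X(1) sections_diff[OF s(1,2)] s(3)] conn_diff[OF X(1) s(1,2)] ..
    finally show ?thesis by (simp add: curv_def)
  qed
  have "lie_bracket A X (lie_bracket A Y Z) = (\<lambda>q. lie_bracket A (lie_bracket A X Y) Z q + lie_bracket A Y (lie_bracket A X Z) q)"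
    using lie_bracket_jacobi[OF X] by auto
  then have jac: "D (lie_bracket A X (lie_bracket A Y Z)) \<xi> p = D (lie_bracket A (lie_bracket A X Y) Z) \<xi> p + D (lie_bracket A Y (lie_bracket A X Z)) \<xi> p"
    using conn_add_field[OF br[OF br[OF X(1,2)] X(3)] br[OF X(2) br[OF X(1,3)]] jp(2)] by simp
  show ?thesis
    unfolding XYZ jp
    by (simp add: a[OF X] a[OF X(2,1,3)] a[OF X(3,1,2)] R X br jp(2) curv_def jac)
qed

end

section \<open>Characterisation of the Hodge dual of a 2-form\<close>

locale symplectic_setting = smooth_bundle A E
  for A :: "('m::{t2_space,second_countable_topology}, 'v::euclidean_space) chart set" and E :: "('m, 'e::real_vector) vbundle" +
  fixes \<omega> :: "'m \<Rightarrow> 'v list \<Rightarrow> real" and b :: "'m \<Rightarrow> 'e \<Rightarrow> 'e \<Rightarrow> real" and n m :: nat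
  assumes dim: "DIM('v) = 2 * n" and omega: "almost_symplectic_form A \<omega>"
    and rank: "vb_rank E = 2 * m" and b: "almost_symplectic_bundle A E b"
begin

lemma alternating_omega: "alternating 2 (\<omega> p)"
  using omega by (simp add: almost_symplectic_form_def forms_def)

lemma smooth_omega: "length Xs = 2 \<Longrightarrow> set Xs \<subseteq> vector_fields A \<Longrightarrow> smooth (\<lambda>p. \<omega> p (at_point Xs p))"
  using omega by (simp add: almost_symplectic_form_def forms_def)

lemma smooth_b: "\<xi> \<in> sections A E \<Longrightarrow> \<eta> \<in> sections A E \<Longrightarrow> smooth (\<lambda>p. b p (\<xi> p) (\<eta> p))"
  using b by (simp add: almost_symplectic_bundle_def)

lemma n_pos: "n > 0"
proof -
  have "DIM('v) > 0" by simp
  then show ?thesis using dim by simp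
qed

sublocale tan: skew_space UNIV "\<lambda>u v. \<omega> p [u, v]" for p
proof
  show "subspace UNIV" by simp
  note sl = alternating_slot_linear[OF alternating_omega[of p]]
  show "\<omega> p [y, x] = - \<omega> p [x, y]" for x y
    using alternating_swap[OF alternating_omega, of p "[]" y x "[]"] by simp
  show "\<omega> p [s *\<^sub>R x + t *\<^sub>R y, z] = s * \<omega> p [x, z] + t * \<omega> p [y, z]" for x y z s t
  proof -
    have l: "linear (\<lambda>u. \<omega> p [u, z])"
      using slot_linear_append[OF sl, of "[]" "[z]"] by simp
    show ?thesis using linear_add[OF l, of "s *\<^sub>R x" "t *\<^sub>R y"] linear_cmul[OF l] by simp
  qed
  show "x = 0" if "\<And>y. y \<in> UNIV \<Longrightarrow> \<omega> p [x, y] = 0" for x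
    using omega that unfolding almost_symplectic_form_def by blast
qed

sublocale fib: skew_space "fibre E p" "b p" for p
proof
  note b' = b[unfolded almost_symplectic_bundle_def]
  show "subspace (fibre E p)" by (rule subspace_fibre)
  show "b p y x = - b p x y" if "x \<in> fibre E p" "y \<in> fibre E p" for x y
    by (rule b'[THEN conjunct1, rule_format, OF that])
  show "b p (s *\<^sub>R x + t *\<^sub>R y) z = s * b p x z + t * b p y z"
    if "x \<in> fibre E p" "y \<in> fibre E p" "z \<in> fibre E p" for x y z s t
    by (rule b'[THEN conjunct2, THEN conjunct1, rule_format, OF that])
  show "x = 0" if "x \<in> fibre E p" "\<And>y. y \<in> fibre E p \<Longrightarrow> b p x y = 0" for x
    by (rule b'[THEN conjunct2, THEN conjunct2, THEN conjunct1, rule_format, OF that])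
qed

abbreviation "te \<equiv> tangent_basis n \<omega>"
abbreviation "fe \<equiv> fibre_basis m E b"

lemma te: "symplectic_basis n UNIV (\<lambda>u v. \<omega> p [u, v]) (te p)"
proof -
  obtain f where f: "basis_family (2 * n) (UNIV :: 'v set) f" using basis_family_Basis[OF dim] by blast
  show ?thesis unfolding tangent_basis_def by (rule someI_ex[OF tan.symplectic_basis_exists[OF f]])
qed

lemma fe: "symplectic_basis m (fibre E p) (b p) (fe p)"
proof (rule frame_exists[of p])
  fix U f assume "(U, f) \<in> frames E" "p \<in> U"
  then have f: "basis_family (2 * m) (fibre E p) (\<lambda>i. f i p)" using frame_basis rank by metis
  show ?thesis unfolding fibre_basis_def by (rule someI_ex[OF fib.symplectic_basis_exists[OF f]])
qed

lemma te_basis: "basis_family (2 * n) UNIV (te p)"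
  using te by (simp add: symplectic_basis_def)

lemma fe_basis: "basis_family (2 * m) (fibre E p) (fe p)"
  using fe by (simp add: symplectic_basis_def)

lemma fe_fibre: "i < 2 * m \<Longrightarrow> fe p i \<in> fibre E p"
  by (rule fib.symplectic_basis_mem[OF fe])

lemma J_fe_fibre: "i < 2 * m \<Longrightarrow> J_frame m (fe p) i \<in> fibre E p"
  by (rule fib.J_frame_mem[OF fe])

definition es :: "'m \<Rightarrow> 'v list" where
  "es p = flat (map (\<lambda>i. (te p i, te p (n + i))) [0..<n])"

lemmas es = flat_symplectic_basis[OF te_basis, folded es_def]

lemma alternating_eqI:
  fixes a a' :: "'v list \<Rightarrow> real"
  assumes "alternating (2 * n) a" "alternating (2 * n) a'" "a (es p) = a' (es p)"
  shows "a = a'"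
proof
  fix vs
  have "alternating (length (es p)) (\<lambda>vs. a vs + (-1) * a' vs)"
    using assms(1,2) es(1) by (intro alternating_add alternating_mult_left) simp_all
  then have "a vs + (-1) * a' vs = 0"
    by (rule alternating_top_zero[OF _ es(2,3)]) (use assms(3) in simp)
  then show "a vs = a' vs" by simp
qed

lemma two_form_power_eq: "two_form_power \<omega> k p = (wedge2 (\<omega> p) ^^ k) unit_form"
proof (induction k)
  case 0
  show ?case by (auto simp: unit_form_def)
next
  case (Suc k)
  have alt: "alternating (2 * k) ((wedge2 (\<omega> p) ^^ k) unit_form)"
    using alternating_wedge2_iter[OF alternating_omega alternating_unit_form[OF alternating_omega]] by simp
  have "two_form_power \<omega> (Suc k) p = shuffle (\<lambda>ys zs. \<omega> p ys * two_form_power \<omega> k p zs)"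
    unfolding two_form_power.simps wedge_def
  proof (rule wedge_with_eq_shuffle)
    show "alternating 2 (\<lambda>ys. \<omega> p ys * two_form_power \<omega> k p zs)" for zs
      using alternating_scaleR_left[OF alternating_omega, of p "two_form_power \<omega> k p zs"] by simp
    show "alternating (2 * k) (\<lambda>zs. \<omega> p ys * two_form_power \<omega> k p zs)" for ys
      unfolding Suc.IH by (rule alternating_mult_left[OF alt])
  qed
  then show ?case by (simp add: Suc.IH wedge2_def)
qed

lemma alternating_divided_power: "alternating (2 * n) (divided_power \<omega> n p)"
proof -
  have "alternating (2 * n) ((wedge2 (\<omega> p) ^^ n) unit_form)"
    using alternating_wedge2_iter[OF alternating_omega alternating_unit_form[OF alternating_omega], of n p] by simp
  from alternating_mult_left[OF this, of "1 / fact n"] show ?thesis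
    by (simp add: divided_power_def[abs_def] two_form_power_eq)
qed

lemma divided_power_es: "divided_power \<omega> n p (es p) = 1"
  using wedge2_iter_pairs_0[OF alternating_omega symplectic_pairs_basis[OF alternating_omega te]]
  by (simp add: divided_power_def two_form_power_eq es_def)

lemma end_pairing_summand:
  assumes \<alpha>: "\<alpha> \<in> end_forms A E k" and \<gamma>: "\<gamma> \<in> end_forms A E l" and i: "i < 2 * m"
  shows "alternating k (\<lambda>ys. b p (\<alpha> p ys (fe p i)) (\<gamma> p zs (J_frame m (fe p) i)))"
    and "alternating l (\<lambda>zs. b p (\<alpha> p ys (fe p i)) (\<gamma> p zs (J_frame m (fe p) i)))"
proof -
  note m = end_form_fibre[OF \<alpha> fe_fibre[OF i]] end_form_fibre[OF \<gamma> J_fe_fibre[OF i]]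
  show "alternating k (\<lambda>ys. b p (\<alpha> p ys (fe p i)) (\<gamma> p zs (J_frame m (fe p) i)))"
    by (rule alternating_compose[OF end_formsD(2)[OF \<alpha>], of _ _ "fibre E p"]) (simp_all add: m fib.lin)
  show "alternating l (\<lambda>zs. b p (\<alpha> p ys (fe p i)) (\<gamma> p zs (J_frame m (fe p) i)))"
    by (rule alternating_compose[OF end_formsD(2)[OF \<gamma>], of _ _ "fibre E p"]) (simp_all add: m fib.lin_right)
qed

lemma end_wedge_eq:
  assumes \<alpha>: "\<alpha> \<in> end_forms A E k" and \<gamma>: "\<gamma> \<in> end_forms A E l"
  shows "end_wedge m E b k l \<alpha> \<gamma> p =
    (\<lambda>vs. \<Sum>i<2 * m. shuffle (\<lambda>ys zs. b p (\<alpha> p ys (fe p i)) (\<gamma> p zs (J_frame m (fe p) i))) vs)"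
proof -
  have "end_wedge m E b k l \<alpha> \<gamma> p = shuffle (\<lambda>ys zs. end_pairing m E b p (\<alpha> p ys) (\<gamma> p zs))"
    unfolding end_wedge_def
  proof (rule wedge_with_eq_shuffle)
    show "alternating k (\<lambda>ys. end_pairing m E b p (\<alpha> p ys) (\<gamma> p zs))" for zs
      unfolding end_pairing_def Let_def
      by (rule alternating_sum) (use end_pairing_summand(1)[OF \<alpha> \<gamma>] in simp)
    show "alternating l (\<lambda>zs. end_pairing m E b p (\<alpha> p ys) (\<gamma> p zs))" for ys
      unfolding end_pairing_def Let_def
      by (rule alternating_sum) (use end_pairing_summand(2)[OF \<alpha> \<gamma>] in simp)
  qed
  then show ?thesis by (auto simp: end_pairing_def Let_def shuffle_sum)
qed

lemma alternating_end_wedge: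
  assumes \<alpha>: "\<alpha> \<in> end_forms A E k" and \<gamma>: "\<gamma> \<in> end_forms A E l"
  shows "alternating (k + l) (end_wedge m E b k l \<alpha> \<gamma> p)"
  unfolding end_wedge_eq[OF assms]
  by (intro alternating_sum alternating_shuffle) (use end_pairing_summand[OF \<alpha> \<gamma>] in auto)

text \<open>Test forms \<open>(\<iota>\<^sub>Y \<omega> \<and> \<iota>\<^sub>Z \<omega>) \<otimes> s \<otimes> b(t, \<cdot>)\<close>: at a point they exhaust the \<open>End(E)\<close>-valued \<open>2\<close>-forms.\<close>

definition test2 :: "('m \<Rightarrow> 'v) \<Rightarrow> ('m \<Rightarrow> 'v) \<Rightarrow> 'm \<Rightarrow> 'v list \<Rightarrow> real" where
  "test2 Y Z q = shuffle (\<lambda>ys zs. \<omega> q (Y q # ys) * \<omega> q (Z q # zs))"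

definition test_form :: "('m \<Rightarrow> 'v) \<Rightarrow> ('m \<Rightarrow> 'v) \<Rightarrow> ('m \<Rightarrow> 'e) \<Rightarrow> ('m \<Rightarrow> 'e) \<Rightarrow> 'm \<Rightarrow> 'v list \<Rightarrow> 'e \<Rightarrow> 'e" where
  "test_form Y Z s t q vs x = (if x \<in> fibre E q then (test2 Y Z q vs * b q (t q) x) *\<^sub>R s q else 0)"

lemma alternating_test2: "alternating 2 (test2 Y Z q)"
proof -
  have 1: "alternating 1 (\<lambda>ys. \<omega> q (u # ys))" for u
    unfolding alternating_def
  proof (intro conjI allI impI)
    fix vs :: "'v list" and i :: nat assume "length vs = 1 \<and> i < 1"
    then show "linear (\<lambda>v. \<omega> q (u # vs[i := v]))"
      using slot_linearD[OF alternating_slot_linear[OF alternating_omega], of "Suc i" "u # vs" q] by simp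
  qed (use alternating_length[OF alternating_omega] in auto)
  have "alternating (1 + 1) (test2 Y Z q)"
    unfolding test2_def
  proof (rule alternating_shuffle)
    show "alternating 1 (\<lambda>ys. \<omega> q (Y q # ys) * \<omega> q (Z q # zs))" for zs
      using alternating_scaleR_left[OF 1[of "Y q"], of "\<omega> q (Z q # zs)"] by simp
    show "alternating 1 (\<lambda>zs. \<omega> q (Y q # ys) * \<omega> q (Z q # zs))" for ys
      by (rule alternating_mult_left[OF 1])
  qed
  then show ?thesis by (simp add: numeral_2_eq_2)
qed

lemma test2_pair: "test2 Y Z q [u, v] = \<omega> q [Y q, u] * \<omega> q [Z q, v] - \<omega> q [Y q, v] * \<omega> q [Z q, u]"
  by (simp add: test2_def alternating_length[OF alternating_omega])

lemma test_form:
  assumes Y: "Y \<in> vector_fields A" and Z: "Z \<in> vector_fields A" and s: "s \<in> sections A E" and t: "t \<in> sections A E"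
  shows "test_form Y Z s t \<in> end_forms A E 2"
  unfolding end_forms_def
proof (intro CollectI conjI allI ballI impI)
  fix p vs
  show "test_form Y Z s t p vs \<in> fibre_end (fibre E p)"
    unfolding fibre_end_def
  proof (intro CollectI conjI allI ballI impI)
    fix x y c d assume xy: "x \<in> fibre E p" "y \<in> fibre E p"
    then have "c *\<^sub>R x + d *\<^sub>R y \<in> fibre E p" using subspace_fibre by (simp add: subspace_add subspace_mul)
    then show "test_form Y Z s t p vs (c *\<^sub>R x + d *\<^sub>R y) = c *\<^sub>R test_form Y Z s t p vs x + d *\<^sub>R test_form Y Z s t p vs y"
      using xy sections_fibre[OF t] by (simp add: test_form_def fib.lin_right algebra_simps)
  qed (use subspace_fibre sections_fibre[OF s] in \<open>auto simp: test_form_def intro: subspace_mul\<close>)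
next
  fix p x
  show "alternating 2 (\<lambda>vs. test_form Y Z s t p vs x)"
  proof (cases "x \<in> fibre E p")
    case True
    then show ?thesis
      using alternating_scaleR_left[OF alternating_test2, of Y Z p "b p (t p) x *\<^sub>R s p"] by (simp add: test_form_def)
  next
    case False
    then show ?thesis by (simp add: test_form_def alternating_zero)
  qed
next
  fix Xs \<xi> assume \<xi>: "\<xi> \<in> sections A E" and Xs: "length Xs = 2 \<and> set Xs \<subseteq> vector_fields A"
  then obtain X X' where XX: "Xs = [X, X']" by (auto simp: numeral_2_eq_2 length_Suc_conv)
  have w: "smooth (\<lambda>p. \<omega> p [V p, W p])" if "V \<in> vector_fields A" "W \<in> vector_fields A" for V W
    using smooth_omega[of "[V, W]"] that by simp
  have X: "X \<in> vector_fields A" "X' \<in> vector_fields A" using Xs XX by auto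
  have "smooth (\<lambda>p. (\<omega> p [Y p, X p] * \<omega> p [Z p, X' p] - \<omega> p [Y p, X' p] * \<omega> p [Z p, X p]) * b p (t p) (\<xi> p))"
    by (intro smooth_fun_on_mult[OF open_UNIV] smooth_fun_on_diff[OF open_UNIV] w smooth_b X Y Z t \<xi>)
  from sections_scale[OF this s] show "(\<lambda>p. test_form Y Z s t p (at_point Xs p) (\<xi> p)) \<in> sections A E"
    using sections_fibre[OF \<xi>] by (simp add: test_form_def XX test2_pair)
qed

text \<open>Uniqueness of the star. A test form dual to two basis vectors u, v and to the frame
  vector f_i, with value y, has a wedge with \<gamma> whose value on \<open>u # v # r\<close>, with
  r free of u and v, is b(y, \<gamma>(r) J f_i). By \<open>alternating_codim2_zero\<close> and
  nondegeneracy this fixes \<gamma> on the vectors J f_i, which span the fibre.\<close>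

lemma end_wedge_nondegenerate:
  assumes \<gamma>: "\<gamma> \<in> end_forms A E (2 * n - 2)" and \<gamma>': "\<gamma>' \<in> end_forms A E (2 * n - 2)"
    and eq: "\<And>\<alpha>. \<alpha> \<in> end_forms A E 2 \<Longrightarrow> end_wedge m E b 2 (2 * n - 2) \<alpha> \<gamma> = end_wedge m E b 2 (2 * n - 2) \<alpha> \<gamma>'"
  shows "\<gamma> = \<gamma>'"
proof (rule end_form_eqI[OF \<gamma> \<gamma>'])
  fix p and vs :: "'v list" and x assume x: "x \<in> fibre E p"
  let ?f = "fe p" and ?J = "J_frame m (fe p)"
  have J: "\<gamma> p vs (?J i) = \<gamma>' p vs (?J i)" if i: "i < 2 * m" for i
  proof -
    have "b p y (\<gamma> p vs (?J i)) + (-1) * b p y (\<gamma>' p vs (?J i)) = 0" if y: "y \<in> fibre E p" for y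
    proof (rule alternating_codim2_zero[where a="\<lambda>vs. b p y (\<gamma> p vs (?J i)) + (-1) * b p y (\<gamma>' p vs (?J i))" and k="2 * n - 2"])
      have alt: "alternating (2 * n - 2) (\<lambda>vs. b p y (\<gamma> p vs (?J i)))" if "\<gamma> \<in> end_forms A E (2 * n - 2)" for \<gamma>
        by (rule alternating_compose[OF end_formsD(2)[OF that], of _ _ "fibre E p"])
          (simp_all add: end_form_fibre[OF that J_fe_fibre[OF i]] fib.lin_right y)
      show "alternating (2 * n - 2) (\<lambda>vs. b p y (\<gamma> p vs (?J i)) + (-1) * b p y (\<gamma>' p vs (?J i)))"
        by (intro alternating_add alternating_mult_left alt \<gamma> \<gamma>')
      let ?B = "te p ` {..<2 * n}"
      have inj: "inj_on (te p) {..<2 * n}" using te_basis by (simp add: basis_family_def)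
      show "finite ?B" by simp
      show "card ?B = 2 * n - 2 + 2" using n_pos by (simp add: card_image[OF inj])
      show "span ?B = UNIV" using te_basis by (simp add: basis_family_def)
      fix u v and r assume "u \<in> ?B" "v \<in> ?B" and uv: "u \<noteq> v" and r: "set r \<subseteq> ?B - {u, v}"
      then obtain c d where cd: "u = te p c" "v = te p d" "c < 2 * n" "d < 2 * n" by auto
      \<comment> \<open>By \<open>J_frame_dual\<close> this makes \<omega>(Y, .) at \<open>p\<close>
        the covector dual to the basis vector with index \<open>c\<close>; Z serves \<open>d\<close>
        in the same way.\<close>
      obtain Y where Y: "Y \<in> vector_fields A" "Y p = - J_frame n (te p) c" by (rule vector_field_extension)
      obtain Z where Z: "Z \<in> vector_fields A" "Z p = - J_frame n (te p) d" by (rule vector_field_extension)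
      obtain s where s: "s \<in> sections A E" "s p = y" by (rule section_extension[OF y])
      have nJ: "- ?J i \<in> fibre E p" using J_fe_fibre[OF i] subspace_fibre subspace_neg by blast
      \<comment> \<open>Likewise b(t, .) at \<open>p\<close> is dual to the frame vector with index
        \<open>i\<close>.\<close>
      obtain t where t: "t \<in> sections A E" "t p = - ?J i" by (rule section_extension[OF nJ])
      have wY: "\<omega> p [Y p, te p i] = (if i = c then 1 else 0)" "\<omega> p [Z p, te p i] = (if i = d then 1 else 0)"
        if "i < 2 * n" for i
        using tan.J_frame_dual[OF te cd(3) that] tan.J_frame_dual[OF te cd(4) that] Y Z by auto
      define T where "T = test2 Y Z p"
      have Tuv: "T [u, v] = 1" using wY cd uv by (auto simp: T_def test2_pair)
      have Yr: "\<omega> p [Y p, x] = 0" "\<omega> p [Z p, x] = 0" if "x \<in> set r" for x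
      proof -
        obtain k where "x = te p k" "k < 2 * n" "k \<noteq> c" "k \<noteq> d" using r \<open>x \<in> set r\<close> cd by auto
        then show "\<omega> p [Y p, x] = 0" "\<omega> p [Z p, x] = 0" using wY by auto
      qed
      have Tr: "T [u, x] = 0 \<and> T [v, x] = 0" "T [x', x] = 0" if "x \<in> set r" for x x'
        using Yr that wY cd by (auto simp: T_def test2_pair)
      have T2: "T ys = 0" if "set ys \<subseteq> set r" for ys
      proof (cases "length ys = 2")
        case True
        then obtain x x' where "ys = [x', x]" by (auto simp: numeral_2_eq_2 length_Suc_conv)
        then show ?thesis using Tr that by simp
      next
        case False
        then show ?thesis unfolding T_def using alternating_length[OF alternating_test2] by blast
      qed
      have ev: "end_wedge m E b 2 (2 * n - 2) (test_form Y Z s t) \<gamma> p (u # v # r) = b p y (\<gamma> p r (?J i))"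
        if \<gamma>: "\<gamma> \<in> end_forms A E (2 * n - 2)" for \<gamma>
      proof -
        let ?\<theta> = "\<lambda>zs. b p y (\<gamma> p zs (?J i))"
        have tf: "b p (test_form Y Z s t p ys (?f k)) (\<gamma> p zs (?J k)) = (if k = i then T ys *\<^sub>R ?\<theta> zs else 0)"
          if k: "k < 2 * m" for k ys zs
        proof -
          have "b p (t p) (?f k) = (if k = i then 1 else 0)"
            using fib.J_frame_dual[OF fe i k] t by auto
          then have "test_form Y Z s t p ys (?f k) = (if k = i then T ys *\<^sub>R y else 0)"
            using fe_fibre[OF k] s by (simp add: test_form_def T_def)
          moreover have g: "\<gamma> p zs (?J k) \<in> fibre E p"
            by (rule end_form_fibre[OF \<gamma> J_fe_fibre[OF k]])
          ultimately show ?thesis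
            using fib.lin[OF y y g, of "T ys" 0] fib.zero_left[OF g] by (cases "k = i") simp_all
        qed
        have "end_wedge m E b 2 (2 * n - 2) (test_form Y Z s t) \<gamma> p (u # v # r) =
            (\<Sum>k<2 * m. shuffle (\<lambda>ys zs. if k = i then T ys *\<^sub>R ?\<theta> zs else 0) (u # v # r))"
          unfolding end_wedge_eq[OF test_form[OF Y(1) Z(1) s(1) t(1)] \<gamma>]
          by (intro sum.cong refl arg_cong[where f="\<lambda>f. shuffle f _"]) (auto simp: tf fun_eq_iff)
        also have "\<dots> = (\<Sum>k<2 * m. if k = i then wedge2 T ?\<theta> (u # v # r) else 0)"
          by (intro sum.cong refl) (auto simp: wedge2_def)
        also have "\<dots> = wedge2 T ?\<theta> (u # v # r)" using i by simp
        also have "\<dots> = ?\<theta> r + wedge2 T (\<lambda>zs. ?\<theta> (u # v # zs)) r"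
          by (rule wedge2_pair[OF _ Tuv Tr(1)]) (simp_all add: T_def alternating_test2)
        \<comment> \<open>In this term \<gamma> takes both u and v, so \<open>T\<close> is left with
          entries of \<open>r\<close>, on which it vanishes.\<close>
        also have "wedge2 T (\<lambda>zs. ?\<theta> (u # v # zs)) r = shuffle (\<lambda>_ _. 0) r"
          unfolding wedge2_def by (rule shuffle_cong) (simp add: T2)
        finally show ?thesis by simp
      qed
      show "b p y (\<gamma> p r (?J i)) + (-1) * b p y (\<gamma>' p r (?J i)) = 0"
        using ev[OF \<gamma>] ev[OF \<gamma>'] eq[OF test_form[OF Y(1) Z(1) s(1) t(1)]] by simp
    qed
    note 0 = this
    have g: "\<gamma> p vs (?J i) \<in> fibre E p" "\<gamma>' p vs (?J i) \<in> fibre E p"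
      using end_form_fibre[OF \<gamma> J_fe_fibre[OF i]] end_form_fibre[OF \<gamma>' J_fe_fibre[OF i]] by auto
    have "\<gamma> p vs (?J i) - \<gamma>' p vs (?J i) = 0"
    proof (rule fib.nondeg)
      show d: "\<gamma> p vs (?J i) - \<gamma>' p vs (?J i) \<in> fibre E p" using g subspace_fibre subspace_diff by blast
      fix y assume y: "y \<in> fibre E p"
      show "b p (\<gamma> p vs (?J i) - \<gamma>' p vs (?J i)) y = 0"
        using 0[OF y] fib.diff_left[OF g y] fib.skew[OF y g(1)] fib.skew[OF y g(2)] by simp
    qed
    then show ?thesis by simp
  qed
  have f: "\<gamma> p vs (?f i) = \<gamma>' p vs (?f i)" if i: "i < 2 * m" for i
  proof (rule fib.J_frame_span[OF fe i])
    fix j c assume j: "j < 2 * m" "?f i = c *\<^sub>R ?J j"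
    then show ?thesis
      using J[OF j(1)] end_form_linear[OF \<gamma> J_fe_fibre[OF j(1)] J_fe_fibre[OF j(1)], where vs=vs and s=c and t=0]
        end_form_linear[OF \<gamma>' J_fe_fibre[OF j(1)] J_fe_fibre[OF j(1)], where vs=vs and s=c and t=0] by simp
  qed
  obtain c where c: "x = (\<Sum>i<2 * m. c i *\<^sub>R ?f i)" by (rule basis_family_span[OF fe_basis x])
  have "\<gamma> p vs (\<Sum>i\<in>I. c i *\<^sub>R ?f i) = \<gamma>' p vs (\<Sum>i\<in>I. c i *\<^sub>R ?f i) \<and> (\<Sum>i\<in>I. c i *\<^sub>R ?f i) \<in> fibre E p"
    if "I \<subseteq> {..<2 * m}" for I
  proof -
    have "finite I" using that finite_subset by blast
    then show ?thesis
      using that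
    proof (induction I)
      case empty
      have 0: "\<gamma> p vs 0 = 0" if "\<gamma> \<in> end_forms A E (2 * n - 2)" for \<gamma>
        using end_form_linear[OF that subspace_0[OF subspace_fibre] subspace_0[OF subspace_fibre], where vs=vs and s=0 and t=0] by simp
      then show ?case using 0[OF \<gamma>] 0[OF \<gamma>'] subspace_0[OF subspace_fibre] by simp
    next
      case (insert i I)
      then have i: "i < 2 * m" by auto
      from insert have s: "(\<Sum>i\<in>I. c i *\<^sub>R ?f i) \<in> fibre E p" "\<gamma> p vs (\<Sum>i\<in>I. c i *\<^sub>R ?f i) = \<gamma>' p vs (\<Sum>i\<in>I. c i *\<^sub>R ?f i)" by auto
      show ?case
        using insert.hyps f[OF i] s end_form_linear[OF \<gamma> fe_fibre[OF i] s(1), where vs=vs and s="c i" and t=1]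
          end_form_linear[OF \<gamma>' fe_fibre[OF i] s(1), where vs=vs and s="c i" and t=1] subspace_fibre fe_fibre[OF i]
        by (simp add: subspace_add subspace_mul)
    qed
  qed
  then show "\<gamma> p vs x = \<gamma>' p vs x" using c by blast
qed

text \<open>Both sides of the defining equation are of top degree, so they are compared on the
  single list \<open>es p\<close>, where the divided power of \<omega> has the value 1.\<close>

lemma hodge_star_eqI:
  assumes \<gamma>: "\<gamma> \<in> end_forms A E (2 * n - 2)" and \<beta>: "\<beta> \<in> end_forms A E 2"
    and eq: "\<And>\<alpha> p. \<alpha> \<in> end_forms A E 2 \<Longrightarrow> end_form_pairing n \<omega> m E b 2 \<alpha> \<beta> p = end_wedge m E b 2 (2 * n - 2) \<alpha> \<gamma> p (es p)"
  shows "hodge_star A n \<omega> m E b 2 \<beta> = \<gamma>"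
  unfolding hodge_star_def
proof (rule the_equality)
  have n2: "2 + (2 * n - 2) = 2 * n" using n_pos by simp
  have *: "(\<lambda>p vs. end_form_pairing n \<omega> m E b 2 \<alpha> \<beta> p * divided_power \<omega> n p vs) = end_wedge m E b 2 (2 * n - 2) \<alpha> \<gamma>"
    if \<alpha>: "\<alpha> \<in> end_forms A E 2" for \<alpha>
  proof
    fix p
    show "(\<lambda>vs. end_form_pairing n \<omega> m E b 2 \<alpha> \<beta> p * divided_power \<omega> n p vs) = end_wedge m E b 2 (2 * n - 2) \<alpha> \<gamma> p"
    proof (rule alternating_eqI[of _ _ p])
      show "alternating (2 * n) (\<lambda>vs. end_form_pairing n \<omega> m E b 2 \<alpha> \<beta> p * divided_power \<omega> n p vs)"
        by (rule alternating_mult_left[OF alternating_divided_power])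
      show "alternating (2 * n) (end_wedge m E b 2 (2 * n - 2) \<alpha> \<gamma> p)"
        using alternating_end_wedge[OF \<alpha> \<gamma>] unfolding n2 .
    qed (simp add: divided_power_es eq[OF \<alpha>])
  qed
  then show "\<gamma> \<in> end_forms A E (2 * n - 2) \<and> (\<forall>\<alpha>\<in>end_forms A E 2.
      (\<lambda>p vs. end_form_pairing n \<omega> m E b 2 \<alpha> \<beta> p * divided_power \<omega> n p vs) = end_wedge m E b 2 (2 * n - 2) \<alpha> \<gamma>)"
    using \<gamma> by blast
  fix \<gamma>' assume \<gamma>': "\<gamma>' \<in> end_forms A E (2 * n - 2) \<and> (\<forall>\<alpha>\<in>end_forms A E 2.
      (\<lambda>p vs. end_form_pairing n \<omega> m E b 2 \<alpha> \<beta> p * divided_power \<omega> n p vs) = end_wedge m E b 2 (2 * n - 2) \<alpha> \<gamma>')"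
  show "\<gamma>' = \<gamma>"
    by (rule end_wedge_nondegenerate) (use \<gamma> \<gamma>' * in auto)
qed

end

section \<open>The covariant derivative of the dual curvature\<close>

context symplectic_setting
begin

definition wedge_omega :: "('m \<Rightarrow> 'v list \<Rightarrow> 'e \<Rightarrow> 'e) \<Rightarrow> 'm \<Rightarrow> 'v list \<Rightarrow> 'e \<Rightarrow> 'e" where
  "wedge_omega \<alpha> p vs x = wedge2 (\<omega> p) (\<lambda>zs. \<alpha> p zs x) vs"

lemma wedge_omega_iter: "(wedge_omega ^^ k) \<alpha> p vs x = (wedge2 (\<omega> p) ^^ k) (\<lambda>zs. \<alpha> p zs x) vs"
proof (induction k arbitrary: vs)
  case (Suc k)
  then show ?case by (simp add: wedge_omega_def)
qed simp

lemma end_forms_scaleR: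
  assumes \<alpha>: "\<alpha> \<in> end_forms A E k"
  shows "(\<lambda>p vs x. c *\<^sub>R \<alpha> p vs x) \<in> end_forms A E k"
  unfolding end_forms_def
proof (intro CollectI conjI allI ballI impI)
  fix p vs
  show "(\<lambda>x. c *\<^sub>R \<alpha> p vs x) \<in> fibre_end (fibre E p)"
    using end_formsD(1)[OF \<alpha>, of p vs] subspace_fibre[of p]
    by (auto simp: fibre_end_def subspace_mul scaleR_right_distrib mult.commute)
  show "alternating k (\<lambda>vs. c *\<^sub>R \<alpha> p vs x)" for x
    by (rule alternating_scaleR[OF end_formsD(2)[OF \<alpha>]])
next
  fix Xs \<xi> assume "\<xi> \<in> sections A E" "length Xs = k \<and> set Xs \<subseteq> vector_fields A"
  then show "(\<lambda>p. c *\<^sub>R \<alpha> p (at_point Xs p) (\<xi> p)) \<in> sections A E"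
    using end_formsD(3)[OF \<alpha>] by (intro sections_scale[OF smooth_const]) auto
qed

text \<open>With \<open>T = \<alpha> \<otimes> \<beta>\<close>, these are \<open>\<Lambda>\<alpha> \<Lambda>\<beta>\<close> and \<open>\<langle>\<alpha>, \<beta>\<rangle>\<close>.\<close>

abbreviation "contraction T p \<equiv> (\<Sum>j<n. \<Sum>i<n. T [te p i, te p (n + i)] [te p j, te p (n + j)])"
abbreviation "inner_sum T p \<equiv> (\<Sum>I | I \<subseteq> {..<2 * n} \<and> card I = 2.
  T (map (te p) (sorted_list_of_set I)) (map (J_frame n (te p)) (sorted_list_of_set I)))"

lemma wedge2_iter_es_4:
  fixes T :: "'v list \<Rightarrow> 'v list \<Rightarrow> real"
  assumes "n = k + 2" "\<And>zs. alternating 2 (\<lambda>ys. T ys zs)" "\<And>ys. alternating 2 (T ys)"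
  shows "(wedge2 (\<omega> p) ^^ k) (shuffle T) (es p) = fact k * (contraction T p - inner_sum T p)"
proof -
  have "alternating (2 + 2) (shuffle T)" by (rule alternating_shuffle[OF assms(2,3)])
  then have z: "shuffle T vs = 0" if "length vs \<noteq> 4" for vs using alternating_length that by force
  have l: "length (map (\<lambda>i. (te p i, te p (n + i))) [0..<n]) = k + 2" using assms(1) by simp
  show ?thesis
    using wedge2_iter_pairs_4[OF alternating_omega[of p] symplectic_pairs_basis[OF alternating_omega te] l z]
    by (simp add: es_def pairs_sum_shuffle[OF assms(2,3)])
qed

text \<open>Instead of summing over pairs of indices, the form a \<and> \<omega> \<and> \<omega>^k
  is evaluated twice: by the identity for a \<otimes> \<omega>, and as k + 1 factors \<omega> next
  to the single 2-form a. With s the contraction of a and I the inner sum, k! (n s - I) = (k+1)! s,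
  and n = k + 2 leaves I = s.\<close>

lemma inner_sum_omega:
  fixes a :: "'v list \<Rightarrow> real"
  assumes n: "n = k + 2" and a: "alternating 2 a"
  shows "inner_sum (\<lambda>ys zs. a ys * \<omega> p zs) p = (\<Sum>i<n. a [te p i, te p (n + i)])"
    and "contraction (\<lambda>ys zs. a ys * \<omega> p zs) p = real n * (\<Sum>i<n. a [te p i, te p (n + i)])"
proof -
  let ?T = "\<lambda>ys zs. a ys * \<omega> p zs" and ?s = "\<Sum>i<n. a [te p i, te p (n + i)]"
  have 1: "\<omega> p [te p j, te p (n + j)] = 1" if "j < n" for j
    using te[of p] that by (simp add: symplectic_basis_def)
  show C: "contraction ?T p = real n * ?s"
    by (simp add: 1)
  have T: "alternating 2 (\<lambda>ys. ?T ys zs)" "alternating 2 (?T ys)" for ys zs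
    using alternating_scaleR_left[OF a, of "\<omega> p zs"] alternating_mult_left[OF alternating_omega, of "a ys" p] by simp_all
  have "shuffle ?T = wedge2 (\<omega> p) a"
  proof
    fix vs
    have "shuffle ?T vs = shuffle (\<lambda>ys zs. (-1) ^ (length ys * length zs) *\<^sub>R (a zs * \<omega> p ys)) vs"
      by (rule shuffle_commute)
    also have "\<dots> = shuffle (\<lambda>ys zs. \<omega> p ys *\<^sub>R a zs) vs"
    proof (rule shuffle_cong)
      fix ys zs
      show "(-1) ^ (length ys * length zs) *\<^sub>R (a zs * \<omega> p ys) = \<omega> p ys *\<^sub>R a zs"
        using alternating_length[OF a, of zs] by (cases "length zs = 2") auto
    qed
    finally show "shuffle ?T vs = wedge2 (\<omega> p) a vs" by (simp add: wedge2_def)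
  qed
  then have "(wedge2 (\<omega> p) ^^ Suc k) a (es p) = fact k * (contraction ?T p - inner_sum ?T p)"
    using wedge2_iter_es_4[OF n T, of p] by (simp add: funpow_swap1)
  moreover have "(wedge2 (\<omega> p) ^^ Suc k) a (es p) = fact (Suc k) * ?s"
  proof -
    have l: "length (map (\<lambda>i. (te p i, te p (n + i))) [0..<n]) = Suc (Suc k)" using n by simp
    show ?thesis
      using wedge2_iter_pairs_2[OF alternating_omega[of p] symplectic_pairs_basis[OF alternating_omega te] l alternating_length[OF a]]
      by (simp add: es_def comp_def interv_sum_list_conv_sum_set_nat atLeast0LessThan del: funpow.simps fact_Suc)
  qed
  ultimately have eq: "fact k * (contraction ?T p - inner_sum ?T p) = fact (Suc k) * ?s"
    by (rule trans[OF sym])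
  have solve: "I = s" if "fact k * (real n * s - I) = fact (Suc k) * s" for I s :: real
  proof -
    have "fact k * (real n * s - I) = fact k * (real (Suc k) * s)"
      using that unfolding fact_Suc by (simp only: mult_ac)
    then have "real n * s - I = real (Suc k) * s" by simp
    then show ?thesis using n by (simp add: algebra_simps)
  qed
  show "inner_sum ?T p = ?s"
    by (rule solve) (rule eq[unfolded C])
qed

context
  fixes \<alpha> \<beta> assumes \<alpha>: "\<alpha> \<in> end_forms A E 2" and \<beta>: "\<beta> \<in> end_forms A E 2"
begin

abbreviation "TT p i ys zs \<equiv> b p (\<alpha> p ys (fe p i)) (\<beta> p zs (J_frame m (fe p) i))"

lemma end_form_pairing_eq: "end_form_pairing n \<omega> m E b 2 \<alpha> \<beta> p = (\<Sum>i<2 * m. inner_sum (TT p i) p)"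
  unfolding end_form_pairing_def end_pairing_def Let_def by (rule sum.swap)

text \<open>Pairing with a fixed fibre element is linear on the fibre, so it passes through the
  factor \<open>c\<close> and the powers of \<omega>. These then move in front of \<alpha> \<and>
  \<beta>, and \<open>wedge2_iter_es_4\<close> applies.\<close>

lemma end_wedge_iter_es:
  assumes n: "n = k + 2" and \<gamma>: "(\<lambda>p vs x. c *\<^sub>R (wedge_omega ^^ k) \<beta> p vs x) \<in> end_forms A E (2 * n - 2)"
  shows "end_wedge m E b 2 (2 * n - 2) \<alpha> (\<lambda>p vs x. c *\<^sub>R (wedge_omega ^^ k) \<beta> p vs x) p (es p) =
    (\<Sum>i<2 * m. c * fact k * (contraction (TT p i) p - inner_sum (TT p i) p))"
  unfolding end_wedge_eq[OF \<alpha> \<gamma>]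
proof (rule sum.cong[OF refl])
  fix i assume "i \<in> {..<2 * m}"
  then have i: "i < 2 * m" by simp
  let ?J = "J_frame m (fe p) i"
  have \<beta>J: "\<beta> p zs ?J \<in> fibre E p" for zs by (rule end_form_fibre[OF \<beta> J_fe_fibre[OF i]])
  have \<alpha>f: "\<alpha> p ys (fe p i) \<in> fibre E p" for ys by (rule end_form_fibre[OF \<alpha> fe_fibre[OF i]])
  have "b p (\<alpha> p ys (fe p i)) (c *\<^sub>R (wedge_omega ^^ k) \<beta> p zs ?J) = c *\<^sub>R (wedge2 (\<omega> p) ^^ k) (TT p i ys) zs" for ys zs
  proof -
    let ?w = "(wedge2 (\<omega> p) ^^ k) (\<lambda>zs. \<beta> p zs ?J) zs"
    have "?w \<in> fibre E p" by (rule wedge2_iter_subspace[OF subspace_fibre \<beta>J])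
    then have "b p (\<alpha> p ys (fe p i)) (c *\<^sub>R ?w) = c * b p (\<alpha> p ys (fe p i)) ?w"
      using fib.lin_right[OF _ _ \<alpha>f, where x="?w" and y="?w" and s=c and t=0] by simp
    also have "b p (\<alpha> p ys (fe p i)) ?w = (wedge2 (\<omega> p) ^^ k) (TT p i ys) zs"
      by (rule wedge2_iter_hom[OF subspace_fibre _ \<beta>J]) (simp add: fib.lin_right \<alpha>f)
    finally show ?thesis by (simp add: wedge_omega_iter)
  qed
  then have "shuffle (\<lambda>ys zs. b p (\<alpha> p ys (fe p i)) (c *\<^sub>R (wedge_omega ^^ k) \<beta> p zs ?J)) (es p)
      = c * shuffle (\<lambda>ys us. (wedge2 (\<omega> p) ^^ k) (TT p i ys) us) (es p)"
    by (simp add: shuffle_mult)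
  also have "\<dots> = c * (fact k * (contraction (TT p i) p - inner_sum (TT p i) p))"
    unfolding shuffle_wedge2_iter[OF alternating_omega]
    by (subst wedge2_iter_es_4[OF n end_pairing_summand[OF \<alpha> \<beta> i]]) simp
  finally show "shuffle (\<lambda>ys zs. b p (\<alpha> p ys (fe p i)) (c *\<^sub>R (wedge_omega ^^ k) \<beta> p zs ?J)) (es p)
      = c * fact k * (contraction (TT p i) p - inner_sum (TT p i) p)" by simp
qed

end

end

section \<open>Closedness of the dual curvature in the two cases\<close>

locale symplectic_connection = symplectic_setting A E \<omega> b n m + bundle_connection A E D
  for A :: "('m::{t2_space,second_countable_topology}, 'v::euclidean_space) chart set" and E :: "('m, 'e::real_vector) vbundle"
    and \<omega> b n m D +
  assumes closed: "closed_form A 2 \<omega>"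
begin

abbreviation "R \<equiv> curvature A E D"

lemma R: "R \<in> end_forms A E 2"
  unfolding curvature_eq by (rule curv_form_end_form)

definition omega_fields :: "('m \<Rightarrow> 'v) list \<Rightarrow> 'm \<Rightarrow> real" where
  "omega_fields Xs p = \<omega> p (at_point Xs p)"

lemma adm_omega_fields: "da.a1.adm omega_fields"
  unfolding da.a1.adm_def
proof (intro allI impI)
  fix Xs assume Xs: "set Xs \<subseteq> VF"
  have "smooth (omega_fields Xs)"
  proof (cases "length Xs = 2")
    case True
    then show ?thesis unfolding omega_fields_def[abs_def] using Xs by (rule smooth_omega)
  next
    case False
    then have "omega_fields Xs = (\<lambda>p. 0)"
      using alternating_length[OF alternating_omega] by (simp add: omega_fields_def fun_eq_iff)
    then show ?thesis using smooth_const by simp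
  qed
  then show "omega_fields Xs \<in> Collect smooth" by simp
qed

lemma extD_omega:
  assumes Xs: "set Xs \<subseteq> VF"
  shows "extD (lie_bracket A) actR omega_fields Xs p = 0"
proof (cases "length Xs = 3")
  case False
  show ?thesis
    by (rule da.a1.extD_zero[OF UNIV_I adm_omega_fields Xs])
      (use False alternating_length[OF alternating_omega] in \<open>auto simp: omega_fields_def fun_eq_iff\<close>)
next
  case True
  have as: "antisym_list (\<lambda>Zs. omega_fields Zs p)" for p
    unfolding omega_fields_def at_point_def
    by (rule antisym_list_map) (rule alternating_antisym_list[OF alternating_omega])
  have l: "length Xs = Suc 2" using True by simp
  have "ext_deriv A 2 \<omega> Xs p = 0"
    using closed Xs l by (simp add: closed_form_def)
  then show ?thesis
    unfolding Koszul_formula[OF as, symmetric] ext_deriv_def l lessThan_Suc_atMost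
    by (simp add: actR_def omega_fields_def[abs_def])
qed

lemma on_fields_wedge_omega: "on_fields (wedge_omega \<alpha>) = da.prod omega_fields (on_fields \<alpha>)"
  by (intro ext) (simp add: on_fields_def da.prod_def wedge_omega_def wedge2_def omega_fields_def at_point_def shuffle_map)

lemma wedge_omega_end_form:
  assumes \<alpha>: "\<alpha> \<in> end_forms A E l"
  shows "wedge_omega \<alpha> \<in> end_forms A E (2 + l)"
  unfolding end_forms_def
proof (intro CollectI conjI allI ballI impI)
  fix p vs
  show "wedge_omega \<alpha> p vs \<in> fibre_end (fibre E p)"
    unfolding fibre_end_def
  proof (intro CollectI conjI allI ballI impI)
    fix x assume "x \<in> fibre E p"
    then show "wedge_omega \<alpha> p vs x \<in> fibre E p"
      unfolding wedge_omega_def using end_form_fibre[OF \<alpha>] by (intro wedge2_subspace[OF subspace_fibre])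
  next
    fix x assume "x \<notin> fibre E p"
    then show "wedge_omega \<alpha> p vs x = 0" by (simp add: wedge_omega_def end_form_outside[OF \<alpha>])
  next
    fix x y s t assume "x \<in> fibre E p" "y \<in> fibre E p"
    then show "wedge_omega \<alpha> p vs (s *\<^sub>R x + t *\<^sub>R y) = s *\<^sub>R wedge_omega \<alpha> p vs x + t *\<^sub>R wedge_omega \<alpha> p vs y"
      by (simp add: wedge_omega_def end_form_linear[OF \<alpha>] wedge2_add wedge2_scaleR)
  qed
  show "alternating (2 + l) (\<lambda>vs. wedge_omega \<alpha> p vs x)" for x
    using alternating_wedge2[OF alternating_omega end_formsD(2)[OF \<alpha>]] by (simp add: wedge_omega_def)
next
  fix Xs \<xi> assume \<xi>: "\<xi> \<in> SE" and Xs: "length Xs = 2 + l \<and> set Xs \<subseteq> VF"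
  have "da.a2.adm (on_fields (wedge_omega \<alpha>))"
    unfolding on_fields_wedge_omega by (rule da.adm_prod[OF adm_omega_fields adm_on_fields[OF \<alpha>]])
  then have "on_fields (wedge_omega \<alpha>) Xs \<in> endos"
    using Xs unfolding da.a2.adm_def by blast
  then show "(\<lambda>p. wedge_omega \<alpha> p (at_point Xs p) (\<xi> p)) \<in> SE"
    using \<xi> by (simp add: endos_def on_fields_def)
qed

text \<open>One term of the Leibniz rule contains d\<omega>, the other the derivative of \<alpha>;
  both are 0.\<close>

lemma extD_wedge_omega:
  assumes \<alpha>: "\<alpha> \<in> end_forms A E l"
    and 0: "\<And>Xs. set Xs \<subseteq> VF \<Longrightarrow> extD (lie_bracket A) actE (on_fields \<alpha>) Xs j = 0"
    and Xs: "set Xs \<subseteq> VF" and j: "j \<in> SE \<times> UNIV"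
  shows "extD (lie_bracket A) actE (on_fields (wedge_omega \<alpha>)) Xs j = 0"
proof -
  have "da.prod (extD (lie_bracket A) actR omega_fields) (on_fields \<alpha>) Xs j = da.prod (\<lambda>_ _. 0) (on_fields \<alpha>) Xs j"
    by (rule da.prod_cong[OF Xs]) (simp_all add: extD_omega)
  moreover have "da.prod (da.sgn1 omega_fields) (extD (lie_bracket A) actE (on_fields \<alpha>)) Xs j = da.prod (da.sgn1 omega_fields) (\<lambda>_ _. 0) Xs j"
    by (rule da.prod_cong[OF Xs]) (simp_all add: 0)
  ultimately show ?thesis
    unfolding on_fields_wedge_omega da.extD_prod[OF Xs adm_omega_fields adm_on_fields[OF \<alpha>] j]
    by (simp add: da.prod_def)
qed

lemma wedge_omega_iter_curvature:
  "(wedge_omega ^^ k) R \<in> end_forms A E (2 * k + 2) \<and>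
    (\<forall>Xs. \<forall>j\<in>SE \<times> UNIV. set Xs \<subseteq> VF \<longrightarrow> extD (lie_bracket A) actE (on_fields ((wedge_omega ^^ k) R)) Xs j = 0)"
proof (induction k)
  case 0
  then show ?case using R bianchi by (simp add: curvature_eq numeral_2_eq_2)
next
  case (Suc k)
  then have "(wedge_omega ^^ Suc k) R \<in> end_forms A E (2 + (2 * k + 2))"
    using wedge_omega_end_form by simp
  moreover have "extD (lie_bracket A) actE (on_fields ((wedge_omega ^^ Suc k) R)) Xs j = 0" if "j \<in> SE \<times> UNIV" "set Xs \<subseteq> VF" for Xs j
    using extD_wedge_omega[of "(wedge_omega ^^ k) R" "2 * k + 2" j Xs] Suc that by simp
  ultimately show ?case by simp
qed

text \<open>The caller supplies the constant \<open>c\<close> for which c R \<and> \<omega>^k is the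
  dual of R. The assumption \<open>eq\<close> is the defining property of the star on
  \<open>es p\<close>, compared summand by summand in the frame of the fibre.\<close>

lemma cov_ext_deriv_hodge_zero:
  assumes n: "n = k + 2"
    and eq: "\<And>\<alpha> p i. \<alpha> \<in> end_forms A E 2 \<Longrightarrow> i < 2 * m \<Longrightarrow>
      c * fact k * (contraction (\<lambda>ys zs. b p (\<alpha> p ys (fe p i)) (R p zs (J_frame m (fe p) i))) p
        - inner_sum (\<lambda>ys zs. b p (\<alpha> p ys (fe p i)) (R p zs (J_frame m (fe p) i))) p)
      = inner_sum (\<lambda>ys zs. b p (\<alpha> p ys (fe p i)) (R p zs (J_frame m (fe p) i))) p"
  shows "cov_ext_deriv A E D (2 * n - 2) (hodge_star A n \<omega> m E b 2 R) = (\<lambda>p vs x. 0)"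
proof -
  let ?\<gamma> = "\<lambda>p vs x. c *\<^sub>R (wedge_omega ^^ k) R p vs x"
  have k: "2 * k + 2 = 2 * n - 2" using n by simp
  have g: "(wedge_omega ^^ k) R \<in> end_forms A E (2 * n - 2)"
    using wedge_omega_iter_curvature[of k] unfolding k by blast
  have \<gamma>: "?\<gamma> \<in> end_forms A E (2 * n - 2)" by (rule end_forms_scaleR[OF g])
  have "hodge_star A n \<omega> m E b 2 R = ?\<gamma>"
  proof (rule hodge_star_eqI[OF \<gamma> R])
    fix \<alpha> p assume \<alpha>: "\<alpha> \<in> end_forms A E 2"
    show "end_form_pairing n \<omega> m E b 2 \<alpha> R p = end_wedge m E b 2 (2 * n - 2) \<alpha> ?\<gamma> p (es p)"
      unfolding end_form_pairing_eq[OF \<alpha> R] end_wedge_iter_es[OF \<alpha> R n \<gamma>]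
      by (rule sum.cong[OF refl]) (use eq[OF \<alpha>] in simp)
  qed
  moreover have "cov_ext_deriv A E D (2 * n - 2) ?\<gamma> = (\<lambda>p vs x. 0)"
  proof (rule cov_ext_deriv_zero[OF \<gamma>])
    fix Xs j assume Xs: "set Xs \<subseteq> VF" and j: "j \<in> SE \<times> (UNIV :: 'm set)"
    have "on_fields ?\<gamma> = (\<lambda>Zs j. c *\<^sub>R on_fields ((wedge_omega ^^ k) R) Zs j)"
      by (simp add: on_fields_def fun_eq_iff)
    then show "extD (lie_bracket A) actE (on_fields ?\<gamma>) Xs j = 0"
      using da.a2.extD_scale[OF j Xs adm_on_fields[OF g], of c] wedge_omega_iter_curvature[of k] j Xs by simp
  qed
  ultimately show ?thesis by simp
qed

lemma J_frame_te: "i < n \<Longrightarrow> J_frame n (te p) i = te p (n + i)"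
  by (simp add: J_frame_def)

lemma sRic_eq: "sRic A n \<omega> E D p x = (\<Sum>i<n. R p [te p i, te p (n + i)] x)"
  by (simp add: sRic_def Let_def J_frame_te)

lemma b_zero_right: "y \<in> fibre E p \<Longrightarrow> b p y 0 = 0"
  using fib.lin_right[of y p y y 0 0] by simp

lemma b_sum_right:
  assumes "y \<in> fibre E p" "\<And>i. i \<in> I \<Longrightarrow> g i \<in> fibre E p"
  shows "b p y (\<Sum>i\<in>I. g i) = (\<Sum>i\<in>I. b p y (g i))"
proof -
  have s: "(\<Sum>i\<in>I. g i) \<in> fibre E p" using assms(2) subspace_fibre by (intro subspace_sum) auto
  have "b p (\<Sum>i\<in>I. 1 *\<^sub>R g i) y = (\<Sum>i\<in>I. 1 * b p (g i) y)"
    by (rule fib.sum_left[OF assms(2,1)])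
  then have "- b p (\<Sum>i\<in>I. g i) y = (\<Sum>i\<in>I. - b p (g i) y)" by (simp add: sum_negf)
  then show ?thesis
    using fib.skew[OF s assms(1)] fib.skew[OF assms(2,1)] by simp
qed

lemma primitive_case:
  assumes "sRic A n \<omega> E D = (\<lambda>p x. 0)"
  shows "cov_ext_deriv A E D (2 * n - 2) (hodge_star A n \<omega> m E b 2 R) = (\<lambda>p vs x. 0)"
proof (cases "n = 1")
  case True
  \<comment> \<open>For n = 1 a 2-form has top degree and \<open>es p\<close> is a single hyperbolic
    pair, on which R takes the value sRic = 0.\<close>
  have "R p vs x = 0" for p vs x
  proof (rule alternating_top_zero[OF _ es(2,3)[of p], of "\<lambda>vs. R p vs x"])
    show "alternating (length (es p)) (\<lambda>vs. R p vs x)"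
      using end_formsD(2)[OF R] es(1)[of p] True by simp
    have "R p (es p) x = (\<Sum>i<n. R p [te p i, te p (n + i)] x)"
      unfolding es_def using True by simp
    then show "R p (es p) x = 0"
      unfolding sRic_eq[symmetric] assms .
  qed
  then have R0: "R = (\<lambda>p vs x. 0)" by (simp add: fun_eq_iff)
  have "hodge_star A n \<omega> m E b 2 R = (\<lambda>p vs x. 0)"
  proof (rule hodge_star_eqI[OF end_forms_zero R])
    fix \<alpha> p assume \<alpha>: "\<alpha> \<in> end_forms A E 2"
    have 0: "b p (\<alpha> p ys (fe p i)) 0 = 0" if "i < 2 * m" for i ys
      by (rule b_zero_right[OF end_form_fibre[OF \<alpha> fe_fibre[OF that]]])
    show "end_form_pairing n \<omega> m E b 2 \<alpha> R p = end_wedge m E b 2 (2 * n - 2) \<alpha> (\<lambda>p vs x. 0) p (es p)"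
      unfolding end_form_pairing_eq[OF \<alpha> R] end_wedge_eq[OF \<alpha> end_forms_zero]
      by (rule sum.cong[OF refl]) (simp add: R0 0)
  qed
  moreover have "cov_ext_deriv A E D (2 * n - 2) (\<lambda>p vs x. 0) = (\<lambda>p vs x. 0)"
  proof (rule cov_ext_deriv_zero[OF end_forms_zero])
    fix Xs j assume "set Xs \<subseteq> VF" "j \<in> SE \<times> (UNIV :: 'm set)"
    then show "extD (lie_bracket A) actE (on_fields (\<lambda>p vs x. 0)) Xs j = 0"
      using da.a2.extD_zero[OF _ adm_on_fields[OF end_forms_zero]] by (simp add: on_fields_def fun_eq_iff)
  qed
  ultimately show ?thesis by simp
next
  case False
  then obtain k where n: "n = k + 2" using n_pos by (metis add.commute add_2_eq_Suc less_numeral_extra(3) not0_implies_Suc One_nat_def)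
  show ?thesis
  \<comment> \<open>The contraction term is 0 along with sRic, so c k! has to be -1.\<close>
  proof (rule cov_ext_deriv_hodge_zero[OF n, of "- (1 / fact k)"])
    fix \<alpha> p i assume \<alpha>: "\<alpha> \<in> end_forms A E 2" and i: "i < 2 * m"
    let ?T = "\<lambda>ys zs. b p (\<alpha> p ys (fe p i)) (R p zs (J_frame m (fe p) i))"
    have "(\<Sum>j<n. ?T ys [te p j, te p (n + j)]) = 0" for ys
    proof -
      have \<alpha>f: "\<alpha> p ys (fe p i) \<in> fibre E p" by (rule end_form_fibre[OF \<alpha> fe_fibre[OF i]])
      have "(\<Sum>j<n. ?T ys [te p j, te p (n + j)]) = b p (\<alpha> p ys (fe p i)) (\<Sum>j<n. R p [te p j, te p (n + j)] (J_frame m (fe p) i))"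
        by (rule b_sum_right[OF \<alpha>f end_form_fibre[OF R J_fe_fibre[OF i]], symmetric])
      then show ?thesis
        unfolding sRic_eq[symmetric] assms using b_zero_right[OF \<alpha>f] by simp
    qed
    \<comment> \<open>After the swap the inner sum runs over the curvature slot and is an instance
      of sRic = 0.\<close>
    then have "contraction ?T p = 0" by (subst sum.swap) simp
    then show "- (1 / fact k) * fact k * (contraction ?T p - inner_sum ?T p) = inner_sum ?T p" by simp
  qed
qed

lemma proportional_case:
  assumes "n \<ge> 2"
    and R_eq: "R = (\<lambda>p vs x. (1 / real n) *\<^sub>R end_tensor_form (sRic A n \<omega> E D) \<omega> p vs x)"
  shows "cov_ext_deriv A E D (2 * n - 2) (hodge_star A n \<omega> m E b 2 R) = (\<lambda>p vs x. 0)"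
proof -
  obtain k where n: "n = k + 2" using assms(1) by (metis add.commute le_Suc_ex)
  let ?K = "sRic A n \<omega> E D"
  have K: "?K p x \<in> fibre E p" if "x \<in> fibre E p" for p x
    unfolding sRic_eq using end_form_fibre[OF R that] subspace_fibre by (intro subspace_sum) auto
  show ?thesis
  \<comment> \<open>With s the contraction of the 2-form \<open>a\<close> defined below, the two
    sums are n s and s, so c k! (n - 1) = 1. Since n - 1 = k + 1, this gives c = 1 / (k+1)!.\<close>
  proof (rule cov_ext_deriv_hodge_zero[OF n, of "1 / fact (Suc k)"])
    fix \<alpha> p i assume \<alpha>: "\<alpha> \<in> end_forms A E 2" and i: "i < 2 * m"
    let ?J = "J_frame m (fe p) i"
    let ?T = "\<lambda>ys zs. b p (\<alpha> p ys (fe p i)) (R p zs ?J)"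
    define a where "a ys = (1 / real n) * b p (\<alpha> p ys (fe p i)) (?K p ?J)" for ys
    have KJ: "?K p ?J \<in> fibre E p" by (rule K[OF J_fe_fibre[OF i]])
    have \<alpha>f: "\<alpha> p ys (fe p i) \<in> fibre E p" for ys by (rule end_form_fibre[OF \<alpha> fe_fibre[OF i]])
    have R': "R p zs ?J = ((1 / real n) * \<omega> p zs) *\<^sub>R ?K p ?J" for zs
      using fun_cong[OF fun_cong[OF fun_cong[OF R_eq, of p], of zs], of ?J] by (simp add: end_tensor_form_def)
    have T: "?T ys zs = a ys * \<omega> p zs" for ys zs
      using fib.lin_right[OF KJ KJ \<alpha>f, where t=0] unfolding R' by (simp add: a_def)
    have "alternating 2 (\<lambda>ys. b p (\<alpha> p ys (fe p i)) (?K p ?J))"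
      by (rule alternating_compose[OF end_formsD(2)[OF \<alpha>], of _ _ "fibre E p"]) (simp_all add: \<alpha>f fib.lin KJ)
    then have "alternating 2 a" unfolding a_def[abs_def] by (rule alternating_mult_left)
    note sums = inner_sum_omega[OF n this, of p]
    have "1 / fact (Suc k) * fact k * (real n * s - s) = s" for s :: real
    proof -
      have "real n * s - s = real (Suc k) * s" using n by (simp add: algebra_simps)
      moreover have "(1 / fact (Suc k)) * fact k * real (Suc k) = (1::real)"
        unfolding fact_Suc by (simp del: of_nat_Suc)
      ultimately show ?thesis by (metis mult.assoc mult_1)
    qed
    then show "1 / fact (Suc k) * fact k * (contraction ?T p - inner_sum ?T p) = inner_sum ?T p"
      unfolding T sums .
  qed
qed

end

theorem corollary5p3:
  fixes A :: "('m::{t2_space,second_countable_topology}, 'v::euclidean_space) chart set"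
    and \<omega> :: "'m \<Rightarrow> 'v list \<Rightarrow> real"
    and E :: "('m, 'e::real_vector) vbundle"
    and b :: "'m \<Rightarrow> 'e \<Rightarrow> 'e \<Rightarrow> real"
    and n m :: nat
  assumes "smooth_atlas A"
    and "compact (UNIV :: 'm set)"
    and "DIM('v) = 2 * n"
    and "almost_symplectic_form A \<omega>"
    and "vector_bundle A E"
    and "vb_rank E = 2 * m"
    and "almost_symplectic_bundle A E b"
    and "closed_form A 2 \<omega>"
  shows "(\<forall>D. connection A E D \<and> sRic A n \<omega> E D = (\<lambda>p x. 0) \<longrightarrow>
            cov_ext_deriv A E D (2 * n - 2) (hodge_star A n \<omega> m E b 2 (curvature A E D))
              = (\<lambda>p vs x. 0)) \<and>
         (n \<ge> 2 \<longrightarrow>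
          (\<forall>D. connection A E D \<and>
               curvature A E D
                 = (\<lambda>p vs x. (1 / real n) *\<^sub>R end_tensor_form (sRic A n \<omega> E D) \<omega> p vs x) \<longrightarrow>
            cov_ext_deriv A E D (2 * n - 2) (hodge_star A n \<omega> m E b 2 (curvature A E D))
              = (\<lambda>p vs x. 0)))"
proof -
  have loc: "symplectic_connection A E \<omega> b n m D" if "connection A E D" for D
    using assms that by unfold_locales
  show ?thesis
    using symplectic_connection.primitive_case[OF loc] symplectic_connection.proportional_case[OF loc] by blast
qed

end
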